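(* For every self-adjoint $\alpha\in\mathbb{C}[\mathrm{PSL}(2,\mathbb{Z})]$, $$\limsup_{p\to\infty}\left|u_1(\alpha^p)\right|^{\frac1p}\le\|\lambda(\alpha)\|,$$ where the right-hand side is the operator norm on $\ell^2(\mathrm{PSL}(2,\mathbb{Z}))$.
   Context: For $n\ge1$, $\mathcal{E}_n$ is the set of pairs $(\sigma,\tau)$ of permutations in $S_{6n}$ such that $\sigma$ has order $2$ and no fixed point and $\tau$ has order $3$ and no fixed point (all cycles of $\tau$ have length 3); $\mathbb{E}_n$ is the expectation for the uniform probability measure on $\mathcal{E}_n$. $\mathrm{PSL}(2,\mathbb{Z})\simeq\mathbb{Z}_2\star\mathbb{Z}_3$ is generated by $b=\begin{pmatrix}0&1\\-1&0\end{pmatrix}$ (order 2) and $c=\begin{pmatrix}0&1\\-1&1\end{pmatrix}$ (order 3). For $(\sigma,\tau)\in\mathcal{E}_n$, $\Phi(\sigma,\tau):\mathrm{PSL}(2,\mathbb{Z})\to S_{6n}$ is the homomorphism with $b\mapsto\sigma$, $c\mapsto\tau$; $\mathrm{std}$ is the $(6n-1)$-dimensional irreducible subrepresentation of the permutation representation of $S_{6n}$; and $\mathrm{tr}\,\Pi_\gamma(\sigma,\tau)=\frac1{6n}\mathrm{Tr}(\mathrm{std}\circ\Phi(\sigma,\tau)(\gamma))$. For each fixed $\gamma\in\mathrm{PSL}(2,\mathbb{Z})$, $\mathbb{E}_n[\mathrm{tr}\,\Pi_\gamma]$ has an asymptotic expansion $\sum_{i\ge0}u_i(\gamma)(6n)^{-i}$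 as $n\to\infty$, with $u_0(\gamma)=1$ if $\gamma=e$ and $0$ otherwise. The function $u_1$ is the coefficient of $(6n)^{-1}$, that is, $u_1(\gamma)=\lim_{n\to\infty}6n\left(\mathbb{E}_n[\mathrm{tr}\,\Pi_\gamma]-u_0(\gamma)\right)$; it is extended linearly to the group algebra $\mathbb{C}[\mathrm{PSL}(2,\mathbb{Z})]$. $\lambda$ is the left regular representation, $\lambda(\gamma)[f](x)=f(\gamma^{-1}x)$ on $\ell^2(\mathrm{PSL}(2,\mathbb{Z}))$, extended linearly to $\mathbb{C}[\mathrm{PSL}(2,\mathbb{Z})]$. An element $\alpha=\sum_\gamma a_\gamma\gamma$ is self-adjoint if $\sum_\gamma a_\gamma\gamma=\sum_\gamma\overline{a_\gamma}\gamma^{-1}$. *)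

theory Defs
  imports
    "HOL-Probability.Probability"
    "HOL-Algebra.Sym_Groups"
    "HOL-Algebra.Multiplicative_Group"
    "HOL-Library.Function_Algebras"
begin

section \<open>The modular group\<close>

definition SL2Z :: "(int^2^2) monoid" where
  "SL2Z = \<lparr>carrier = {A. det A = 1}, mult = (**), one = mat 1\<rparr>"

definition PSL2Z :: "(int^2^2) set monoid" where
  "PSL2Z = SL2Z Mod {mat 1, - mat 1}"

definition gen_b :: "(int^2^2) set" where
  "gen_b = {mat 1, - mat 1} #>\<^bsub>SL2Z\<^esub> vector [vector [0, 1], vector [-1, 0]]"

definition gen_c :: "(int^2^2) set" where
  "gen_c = {mat 1, - mat 1} #>\<^bsub>SL2Z\<^esub> vector [vector [0, 1], vector [-1, 1]]"


section \<open>Group algebras\<close>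

text \<open>
  An element \<open>\<Sum>\<^sub>\<gamma> a\<^sub>\<gamma> \<gamma>\<close> of \<open>\<complex>[G]\<close> is its coefficient function, which has finite support and
  vanishes off the carrier of \<open>G\<close>. Powers in \<open>\<complex>[G]\<close> are the monoid powers of this record.
\<close>

definition group_algebra :: "('a, 'm) monoid_scheme \<Rightarrow> ('a \<Rightarrow> complex) ring" where
  "group_algebra G =
    \<lparr>carrier = {a. finite {x. a x \<noteq> 0} \<and> {x. a x \<noteq> 0} \<subseteq> carrier G},
     mult = (\<lambda>a b z. \<Sum>(x, y) \<in> {(x, y). a x \<noteq> 0 \<and> b y \<noteq> 0 \<and> x \<otimes>\<^bsub>G\<^esub> y = z}. a x * b y),
     one = (\<lambda>z. if z = \<one>\<^bsub>G\<^esub> then 1 else 0),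
     zero = (\<lambda>z. 0),
     add = (\<lambda>a b z. a z + b z)\<rparr>"

definition ga_self_adjoint :: "('a, 'm) monoid_scheme \<Rightarrow> ('a \<Rightarrow> complex) \<Rightarrow> bool" where
  "ga_self_adjoint G a \<longleftrightarrow> (\<forall>x\<in>carrier G. a x = cnj (a (inv\<^bsub>G\<^esub> x)))"

definition linear_extension :: "('a \<Rightarrow> complex) \<Rightarrow> ('a \<Rightarrow> complex) \<Rightarrow> complex" where
  "linear_extension u a = (\<Sum>x | a x \<noteq> 0. a x * u x)"


section \<open>The left regular representation\<close>

text \<open>Elements of \<open>\<ell>\<^sup>2(G)\<close> are functions extended by 0 off the carrier of \<open>G\<close>.\<close>

definition l2_space :: "('a, 'm) monoid_scheme \<Rightarrow> ('a \<Rightarrow> complex) set" where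
  "l2_space G = {f. (\<forall>x. x \<notin> carrier G \<longrightarrow> f x = 0) \<and>
                    (\<lambda>x. (cmod (f x))\<^sup>2) summable_on carrier G}"

definition l2_norm :: "('a, 'm) monoid_scheme \<Rightarrow> ('a \<Rightarrow> complex) \<Rightarrow> real" where
  "l2_norm G f = sqrt (\<Sum>\<^sub>\<infinity>x\<in>carrier G. (cmod (f x))\<^sup>2)"

definition l2_opnorm ::
    "('a, 'm) monoid_scheme \<Rightarrow> (('a \<Rightarrow> complex) \<Rightarrow> ('a \<Rightarrow> complex)) \<Rightarrow> real" where
  "l2_opnorm G T = Sup {l2_norm G (T f) | f. f \<in> l2_space G \<and> l2_norm G f \<le> 1}"

definition left_reg ::
    "('a, 'm) monoid_scheme \<Rightarrow> 'a \<Rightarrow> ('a \<Rightarrow> complex) \<Rightarrow> ('a \<Rightarrow> complex)" where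
  "left_reg G g f = (\<lambda>x. if x \<in> carrier G then f (inv\<^bsub>G\<^esub> g \<otimes>\<^bsub>G\<^esub> x) else 0)"

definition left_reg_alg ::
    "('a, 'm) monoid_scheme \<Rightarrow> ('a \<Rightarrow> complex) \<Rightarrow> ('a \<Rightarrow> complex) \<Rightarrow> ('a \<Rightarrow> complex)" where
  "left_reg_alg G a f = (\<lambda>x. \<Sum>g | a g \<noteq> 0. a g * left_reg G g f x)"


section \<open>The standard representation of the symmetric group\<close>

text \<open>Functions \<open>nat \<Rightarrow> complex\<close> form a complex vector space under the pointwise operations.\<close>

interpretation cfun: vector_space "\<lambda>(c::complex) (f::nat \<Rightarrow> complex) i. c * f i"
  by unfold_locales (simp_all add: fun_eq_iff algebra_simps)

text \<open>
  \<open>\<complex>\<^sup>N\<close> is the space of functions supported in \<open>{1..N}\<close>, on which \<open>p\<close> acts by mapping the basis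
  vector \<open>e\<^sub>i\<close> to \<open>e\<^bsub>p i\<^esub>\<close>. The standard representation is the action on the vectors with
  coordinate sum 0.
\<close>

definition perm_rep :: "(nat \<Rightarrow> nat) \<Rightarrow> (nat \<Rightarrow> complex) \<Rightarrow> (nat \<Rightarrow> complex)" where
  "perm_rep p f = (\<lambda>i. f (inv' p i))"

definition std_space :: "nat \<Rightarrow> (nat \<Rightarrow> complex) set" where
  "std_space N = {f. (\<forall>i. i \<notin> {1..N} \<longrightarrow> f i = 0) \<and> (\<Sum>i\<in>{1..N}. f i) = 0}"

definition std :: "nat \<Rightarrow> (nat \<Rightarrow> nat) \<Rightarrow> (nat \<Rightarrow> complex) \<Rightarrow> (nat \<Rightarrow> complex)" where
  "std N p = restrict (perm_rep p) (std_space N)"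

text \<open>
  The trace of a linear endomorphism \<open>T\<close> of a finite-dimensional subspace \<open>V\<close>: the sum of the
  diagonal coefficients with respect to a (any) basis \<open>B\<close> of \<open>V\<close>.
\<close>

definition endo_trace ::
    "(nat \<Rightarrow> complex) set \<Rightarrow> ((nat \<Rightarrow> complex) \<Rightarrow> (nat \<Rightarrow> complex)) \<Rightarrow> complex" where
  "endo_trace V T =
    (let B = (SOME B. cfun.independent B \<and> cfun.span B = V)
     in \<Sum>v\<in>B. cfun.representation B (T v) v)"


section \<open>Random permutation representations of the modular group\<close>

definition perm_pairs :: "nat \<Rightarrow> ((nat \<Rightarrow> nat) \<times> (nat \<Rightarrow> nat)) set" where
  "perm_pairs n =
    {(\<sigma>, \<tau>). \<sigma> \<in> carrier (sym_group (6 * n)) \<and> group.ord (sym_group (6 * n)) \<sigma> = 2 \<and>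
             (\<forall>i\<in>{1..6 * n}. \<sigma> i \<noteq> i) \<and>
             \<tau> \<in> carrier (sym_group (6 * n)) \<and> group.ord (sym_group (6 * n)) \<tau> = 3 \<and>
             (\<forall>i\<in>{1..6 * n}. \<tau> i \<noteq> i)}"

text \<open>The extensionality condition fixes the values off the carrier, so that the map is unique.\<close>

definition Phi :: "nat \<Rightarrow> (nat \<Rightarrow> nat) \<times> (nat \<Rightarrow> nat) \<Rightarrow> (int^2^2) set \<Rightarrow> (nat \<Rightarrow> nat)" where
  "Phi n = (\<lambda>(\<sigma>, \<tau>). THE h. h \<in> hom PSL2Z (sym_group (6 * n)) \<and> h \<in> extensional (carrier PSL2Z) \<and>
                            h gen_b = \<sigma> \<and> h gen_c = \<tau>)"

definition trPi :: "nat \<Rightarrow> (int^2^2) set \<Rightarrow> (nat \<Rightarrow> nat) \<times> (nat \<Rightarrow> nat) \<Rightarrow> complex" where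
  "trPi n \<gamma> st = endo_trace (std_space (6 * n)) (std (6 * n) (Phi n st \<gamma>)) / of_nat (6 * n)"

definition expect_trPi :: "nat \<Rightarrow> (int^2^2) set \<Rightarrow> complex" where
  "expect_trPi n \<gamma> = measure_pmf.expectation (pmf_of_set (perm_pairs n)) (trPi n \<gamma>)"

definition u0 :: "(int^2^2) set \<Rightarrow> complex" where
  "u0 \<gamma> = (if \<gamma> = \<one>\<^bsub>PSL2Z\<^esub> then 1 else 0)"

definition u1 :: "(int^2^2) set \<Rightarrow> complex" where
  "u1 \<gamma> = lim (\<lambda>n. of_nat (6 * n) * (expect_trPi n \<gamma> - u0 \<gamma>))"

end

theory Submission
  imports Defs "HOL-Real_Asymp.Real_Asymp"
begin

text \<open>
  The trace of the standard representation is the number of fixed points minus 1, so the value of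
  \<open>u1\<close> at \<open>\<gamma>\<close> is, for \<open>\<gamma> \<noteq> e\<close>, one less than the limit of the expected number of fixed points of
  \<open>\<gamma>\<close>. This limit is 0 for torsion elements. Otherwise \<open>\<gamma>\<close> is conjugate to a cyclic word in
  \<open>bc\<close> and \<open>bc\<inverse>\<close> of some length \<open>k\<close>; a pattern of coincidences along a closed walk labelled by this
  word involves \<open>m\<close> cycles of \<open>\<tau>\<close> and \<open>a \<ge> m\<close> cycles of \<open>\<sigma>\<close> and contributes of order
  \<open>n\<^sup>m / n\<^sup>a\<close>. Patterns with \<open>a = m\<close> correspond to periods of the cyclic word. Hence the limit is
  between 1 and \<open>k\<close>, and it is 1 unless \<open>\<gamma>\<close> is a proper power. Consequently \<open>u1\<close> grows at most
  linearly in the word length and is supported on torsion elements and proper powers.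

  It remains to sum the absolute values of the coefficients of \<open>\<alpha>\<^sup>p\<close> over this exceptional set.
  Its elements split as reduced products \<open>\<gamma> = k h\<close> in which, within polynomially many families, each
  factor determines \<open>\<gamma>\<close>. A walk from \<open>e\<close> to \<open>\<gamma>\<close> with steps in the support of \<open>\<alpha>\<close> must pass near \<open>h\<close>;
  decomposing it at its last visit there bounds the coefficient of \<open>\<gamma>\<close> in \<open>\<alpha>\<^sup>p\<close> by products of a
  coefficient depending on \<open>h\<close>, one depending on \<open>k\<close>, and a power of the operator norm. By the
  Cauchy--Schwarz inequality each family contributes a polynomial in \<open>p\<close> times the \<open>p\<close>-th power of
  the operator norm.
\<close>

section \<open>The trace of the standard representation\<close>

text \<open>The exceptional elements up to a given length are exponentially many, roughly the square
  root of the number of all elements, so estimating the sum of their coefficients by the l2 norm of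
  \<alpha>^p alone would lose an exponential factor. With one factor indexed by \<open>h\<close> and
  one by \<open>k\<close>, Cauchy--Schwarz needs only that each indexing is injective: each sum of
  squares is then part of a single l2 norm. Two obstacles shape the splitting. The coefficients are
  complex, so walks cannot be compared one by one in absolute value; instead the decomposition is an
  identity between operators, with the convolution operator compressed to the complement of a finite
  set, which does not increase the norm. Moreover, after the last visit the walk avoids a set that
  depends on \<open>h\<close>, so its weight is not a function of \<open>k\<close> alone. The
  first-return identity rewrites this weight through unrestricted powers, and invariance under right
  translation then removes \<open>h\<close>.\<close>

definition unit_fun :: "nat \<Rightarrow> nat \<Rightarrow> complex" where
  "unit_fun i = (\<lambda>j. if j = i then 1 else 0)"

text \<open>The projection onto \<open>std_space N\<close> along the constant vectors, composed with
  truncation to \<open>{1..N}\<close>.\<close>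

definition center :: "nat \<Rightarrow> (nat \<Rightarrow> complex) \<Rightarrow> nat \<Rightarrow> complex" where
  "center N f = (\<lambda>j. if j \<in> {1..N} then f j - (\<Sum>i\<in>{1..N}. f i) / of_nat N else 0)"

lemma sum_fun_apply: "(\<Sum>i\<in>A. h i) x = (\<Sum>i\<in>A. h i x)" for h :: "'b \<Rightarrow> nat \<Rightarrow> complex"
  by (induction A rule: infinite_finite_induct) auto

lemma subspace_std_space: "cfun.subspace (std_space N)"
  by (rule cfun.subspaceI) (auto simp: std_space_def sum.distrib sum_distrib_left[symmetric])

text \<open>\<open>endo_trace\<close> sums over a basis obtained from \<open>SOME\<close>; over an
  infinite basis the sum would take the default value 0.\<close>

lemma finite_independent_std_space:
  assumes "cfun.independent B" "cfun.span B = std_space N"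
  shows "finite B"
proof -
  have "B \<subseteq> cfun.span (unit_fun ` {1..N})"
  proof
    fix f assume "f \<in> B"
    then have "f \<in> std_space N"
      using assms(2) cfun.span_base by blast
    then have "f = (\<Sum>i\<in>{1..N}. (\<lambda>j. f i * unit_fun i j))"
      by (auto simp: fun_eq_iff sum_fun_apply unit_fun_def std_space_def if_distrib cong: if_cong)
    also have "\<dots> \<in> cfun.span (unit_fun ` {1..N})"
      by (intro cfun.span_sum cfun.span_scale cfun.span_base) auto
    finally show "f \<in> cfun.span (unit_fun ` {1..N})" .
  qed
  then show ?thesis
    using cfun.independent_span_bound[of "unit_fun ` {1..N}" B] assms(1) by auto
qed

lemma center_in_std_space: "N \<ge> 1 \<Longrightarrow> center N f \<in> std_space N"
  by (auto simp: std_space_def center_def sum_subtractf)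

lemma center_id: "f \<in> std_space N \<Longrightarrow> center N f = f"
  by (auto simp: std_space_def center_def)

lemma center_linear:
  "center N (\<lambda>j. \<Sum>i\<in>A. c i * g i j) = (\<lambda>j. \<Sum>i\<in>A. c i * center N (g i) j)"
proof
  fix j
  have "(\<Sum>l\<in>{1..N}. \<Sum>i\<in>A. c i * g i l) = (\<Sum>i\<in>A. c i * (\<Sum>l\<in>{1..N}. g i l))"
    by (subst sum.swap) (simp add: sum_distrib_left)
  moreover have "(\<Sum>i\<in>A. c i * (g i j - (\<Sum>l\<in>{1..N}. g i l) / of_nat N)) =
      (\<Sum>i\<in>A. c i * g i j) - (\<Sum>i\<in>A. c i * (\<Sum>l\<in>{1..N}. g i l)) / of_nat N"
    unfolding sum_divide_distrib[of "\<lambda>i. c i * (\<Sum>l\<in>{1..N}. g i l)"] sum_subtractf[symmetric]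
    by (intro sum.cong refl) (simp add: right_diff_distrib)
  ultimately show "center N (\<lambda>j. \<Sum>i\<in>A. c i * g i j) j = (\<Sum>i\<in>A. c i * center N (g i) j)"
    by (cases "j \<in> {1..N}") (simp_all only: center_def if_True if_False mult_zero_right sum.neutral_const)
qed

lemma representation_linear:
  assumes "cfun.independent B" "\<And>i. i \<in> A \<Longrightarrow> g i \<in> cfun.span B"
  shows "cfun.representation B (\<lambda>j. \<Sum>i\<in>A. c i * g i j) v = (\<Sum>i\<in>A. c i * cfun.representation B (g i) v)"
proof -
  have eq: "(\<lambda>j. \<Sum>i\<in>A. c i * g i j) = (\<Sum>i\<in>A. (\<lambda>j. c i * g i j))"
    by (simp add: fun_eq_iff sum_fun_apply)
  have "cfun.representation B (\<Sum>i\<in>A. (\<lambda>j. c i * g i j)) = (\<lambda>b. \<Sum>i\<in>A. cfun.representation B (\<lambda>j. c i * g i j) b)"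
    by (rule cfun.representation_sum) (auto intro!: assms cfun.span_scale)
  then show ?thesis
    unfolding eq using assms by (simp add: cfun.representation_scale)
qed

text \<open>The trace on the subspace is the trace of \<open>T\<close> composed with the projection \<open>center N\<close>,
  computed in the standard basis.\<close>

lemma endo_trace_std_space:
  assumes N: "N \<ge> 1"
    and T: "\<And>f. f \<in> std_space N \<Longrightarrow> T f \<in> std_space N"
    and lin: "\<And>(B :: (nat \<Rightarrow> complex) set) c. finite B \<Longrightarrow> B \<subseteq> std_space N \<Longrightarrow>
      T (\<lambda>j. \<Sum>v\<in>B. c v * v j) = (\<lambda>j. \<Sum>v\<in>B. c v * T v j)"
  shows "endo_trace (std_space N) T = (\<Sum>i\<in>{1..N}. T (center N (unit_fun i)) i)"
proof -
  define B where "B = (SOME B. cfun.independent B \<and> cfun.span B = std_space N)"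
  obtain B' where "cfun.independent B'" "cfun.span B' = std_space N"
    using cfun.basis_exists[of "std_space N"] cfun.span_minimal[OF _ subspace_std_space]
    by (metis subset_antisym)
  then have B: "cfun.independent B" "cfun.span B = std_space N"
    unfolding B_def by (metis (mono_tags, lifting) someI_ex)+
  have fin: "finite B"
    using B by (rule finite_independent_std_space)
  have sub: "B \<subseteq> std_space N"
    using B(2) cfun.span_superset by blast
  have expand: "f = (\<lambda>j. \<Sum>v\<in>B. cfun.representation B f v * v j)" if "f \<in> std_space N" for f
  proof -
    have "f = (\<Sum>v\<in>B. (\<lambda>j. cfun.representation B f v * v j))"
      using cfun.sum_representation_eq[OF B(1), of f B] that B(2) fin by auto
    then have "f j = (\<Sum>v\<in>B. (\<lambda>j. cfun.representation B f v * v j)) j" for j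
      by (rule fun_cong)
    then show ?thesis
      unfolding sum_fun_apply by (rule ext)
  qed
  \<comment> \<open>Both traces equal the double sum over \<open>i\<close> and \<open>v\<close> of
    \<open>T v i\<close> times the \<open>v\<close>-coordinate of
    \<open>center N (unit_fun i)\<close>: one side expands the centred unit vectors in
    \<open>B\<close>, the other expands \<open>T v\<close> in unit vectors.\<close>
  have "(\<Sum>i\<in>{1..N}. T (center N (unit_fun i)) i) =
      (\<Sum>i\<in>{1..N}. \<Sum>v\<in>B. cfun.representation B (center N (unit_fun i)) v * T v i)"
  proof (intro sum.cong refl)
    fix i
    let ?f = "center N (unit_fun i)"
    have "T ?f = T (\<lambda>j. \<Sum>v\<in>B. cfun.representation B ?f v * v j)"
      by (rule arg_cong[OF expand[OF center_in_std_space[OF N]]])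
    also have "\<dots> = (\<lambda>j. \<Sum>v\<in>B. cfun.representation B ?f v * T v j)"
      by (rule lin[OF fin sub])
    finally show "T ?f i = (\<Sum>v\<in>B. cfun.representation B ?f v * T v i)"
      by (rule fun_cong)
  qed
  also have "\<dots> = (\<Sum>v\<in>B. \<Sum>i\<in>{1..N}. T v i * cfun.representation B (center N (unit_fun i)) v)"
    by (subst sum.swap) (simp add: mult.commute)
  also have "\<dots> = (\<Sum>v\<in>B. cfun.representation B (T v) v)"
  proof (intro sum.cong refl)
    fix v assume "v \<in> B"
    then have Tv: "T v \<in> std_space N"
      using T sub by blast
    have "T v = (\<lambda>j. \<Sum>i\<in>{1..N}. T v i * unit_fun i j)"
      using Tv by (auto simp: fun_eq_iff unit_fun_def std_space_def if_distrib cong: if_cong)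
    then have "T v = (\<lambda>j. \<Sum>i\<in>{1..N}. T v i * center N (unit_fun i) j)"
      using center_id[OF Tv] center_linear by metis
    then have "cfun.representation B (T v) v =
        cfun.representation B (\<lambda>j. \<Sum>i\<in>{1..N}. T v i * center N (unit_fun i) j) v"
      by simp
    also have "\<dots> = (\<Sum>i\<in>{1..N}. T v i * cfun.representation B (center N (unit_fun i)) v)"
      by (rule representation_linear[OF B(1)]) (use B(2) center_in_std_space[OF N] in auto)
    finally show "(\<Sum>i\<in>{1..N}. T v i * cfun.representation B (center N (unit_fun i)) v) =
        cfun.representation B (T v) v" by simp
  qed
  finally show ?thesis
    unfolding endo_trace_def B_def[symmetric] Let_def by simp
qed

text \<open>Each diagonal entry is that of the permutation matrix minus \<open>1 / N\<close>, the
  share of the mean that \<open>center\<close> removes.\<close>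

lemma endo_trace_std:
  assumes N: "N \<ge> 1" and p: "p permutes {1..N}"
  shows "endo_trace (std_space N) (std N p) = of_nat (card {i\<in>{1..N}. p i = i}) - 1"
proof -
  have inv: "inv' p permutes {1..N}"
    using p by (rule permutes_inv)
  have perm: "perm_rep p f \<in> std_space N" if "f \<in> std_space N" for f
  proof -
    have "(\<Sum>i\<in>{1..N}. f (inv' p i)) = (\<Sum>i\<in>{1..N}. f i)"
      using sum.permute[OF inv, of f] by (simp add: comp_def)
    moreover have "f (inv' p i) = 0" if "i \<notin> {1..N}" for i
      using that \<open>f \<in> std_space N\<close> inv by (auto simp: std_space_def permutes_not_in)
    ultimately show ?thesis
      using that by (auto simp: std_space_def perm_rep_def)
  qed
  have "endo_trace (std_space N) (std N p) = (\<Sum>i\<in>{1..N}. std N p (center N (unit_fun i)) i)"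
  proof (rule endo_trace_std_space[OF N])
    show "std N p f \<in> std_space N" if "f \<in> std_space N" for f
      using that perm by (simp add: std_def)
    show "std N p (\<lambda>j. \<Sum>v\<in>B. c v * v j) = (\<lambda>j. \<Sum>v\<in>B. c v * std N p v j)"
      if "finite B" "B \<subseteq> std_space N" for B :: "(nat \<Rightarrow> complex) set" and c
    proof -
      have "(\<lambda>j. \<Sum>v\<in>B. c v * v j) = (\<Sum>v\<in>B. (\<lambda>j. c v * v j))"
        by (simp add: fun_eq_iff sum_fun_apply)
      also have "\<dots> \<in> std_space N"
        using that(2) by (intro cfun.subspace_sum cfun.subspace_scale subspace_std_space) auto
      finally show ?thesis
        using that(2) by (auto simp: std_def perm_rep_def fun_eq_iff intro!: sum.cong)
    qed
  qed
  also have "\<dots> = (\<Sum>i\<in>{1..N}. (if p i = i then 1 else 0) - 1 / of_nat N)"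
  proof (intro sum.cong refl)
    fix i assume i: "i \<in> {1..N}"
    have "inv' p i \<in> {1..N}" "inv' p i = i \<longleftrightarrow> p i = i"
      using i permutes_in_image[OF inv] permutes_inverses[OF p] by metis+
    then show "std N p (center N (unit_fun i)) i = (if p i = i then 1 else 0) - 1 / of_nat N"
      using i N center_in_std_space[OF N, of "unit_fun i"]
      by (auto simp: std_def perm_rep_def center_def unit_fun_def)
  qed
  also have "\<dots> = of_nat (card {i\<in>{1..N}. p i = i}) - 1"
    using N by (simp add: sum_subtractf sum.If_cases Int_def)
  finally show ?thesis .
qed

section \<open>Fixed-point-free permutations of order 2 and 3\<close>

text \<open>For prime \<open>q\<close> all cycles on \<open>S\<close> have length \<open>q\<close>;
  \<open>S = {1..6 * n}\<close> with \<open>q\<close> equal to 2 or 3 gives the two components of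
  the probability space. \<open>S\<close> is arbitrary because the counting removes cycles and
  continues on the rest.\<close>

definition fpf_perms :: "nat \<Rightarrow> 'a set \<Rightarrow> ('a \<Rightarrow> 'a) set" where
  "fpf_perms q S = {s. s permutes S \<and> (\<forall>x. (s ^^ q) x = x) \<and> (\<forall>x\<in>S. s x \<noteq> x)}"

lemma fpf_permsI:
  assumes "q > 0" "\<And>x. (s ^^ q) x = x" "\<And>x. x \<notin> S \<Longrightarrow> s x = x" "\<And>x. x \<in> S \<Longrightarrow> s x \<noteq> x"
  shows "s \<in> fpf_perms q S"
proof -
  obtain m where m: "q = Suc m" using assms(1) by (cases q) auto
  have "bij s"
  proof (rule o_bij)
    show "(s ^^ m) \<circ> s = id" "s \<circ> (s ^^ m) = id"
      using assms(2) unfolding m by (simp_all add: fun_eq_iff funpow_swap1)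
  qed
  then have "s permutes S"
    using assms(3) by (simp add: permutes_def bij_iff)
  then show ?thesis
    using assms by (auto simp: fpf_perms_def)
qed

lemma fpf_permsD:
  assumes "s \<in> fpf_perms q S"
  shows "s permutes S" "(s ^^ q) x = x" "x \<in> S \<Longrightarrow> s x \<noteq> x" "s x \<in> S \<longleftrightarrow> x \<in> S" "x \<notin> S \<Longrightarrow> s x = x"
    "s x = s y \<longleftrightarrow> x = y"
  using assms permutes_inj[of s S] permutes_in_image[of s S]
  by (auto simp: fpf_perms_def permutes_not_in dest: injD)

lemma fpf_perms_2D: "s \<in> fpf_perms 2 S \<Longrightarrow> s (s x) = x"
  using fpf_permsD(2)[of s 2 S x] by (simp add: numeral_2_eq_2)

lemma fpf_perms_3D: "s \<in> fpf_perms 3 S \<Longrightarrow> s (s (s x)) = x"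
  using fpf_permsD(2)[of s 3 S x] by (simp add: numeral_3_eq_3)

lemma finite_fpf_perms: "finite S \<Longrightarrow> finite (fpf_perms q S)"
  by (rule finite_subset[OF _ finite_permutations[of S]]) (auto simp: fpf_perms_def)

lemma fpf_perms_restrict:
  assumes s: "s \<in> fpf_perms q S" and "q > 0" "A \<subseteq> S" "\<And>x. s x \<in> A \<longleftrightarrow> x \<in> A"
  shows "(\<lambda>x. if x \<in> A then s x else x) \<in> fpf_perms q A"
proof (rule fpf_permsI[OF \<open>q > 0\<close>])
  let ?r = "\<lambda>x. if x \<in> A then s x else x"
  have "(?r ^^ n) x = (if x \<in> A then (s ^^ n) x else x) \<and> ((s ^^ n) x \<in> A \<longleftrightarrow> x \<in> A)" for n x
    by (induction n) (auto simp: assms(4))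
  then show "(?r ^^ q) x = x" for x
    using fpf_permsD(2)[OF s] by auto
qed (use assms fpf_permsD(3)[OF s] in auto)

text \<open>An extension of \<open>s\<close> preserves \<open>A\<close>, hence also
  \<open>S - A\<close>; restriction to \<open>S - A\<close> and composition with \<open>s\<close>
  are inverse bijections.\<close>

lemma card_fpf_perms_extending:
  assumes "q > 0" "A \<subseteq> S" "s \<in> fpf_perms q A"
  shows "card {r \<in> fpf_perms q S. \<forall>a\<in>A. r a = s a} = card (fpf_perms q (S - A))"
proof (rule bij_betw_same_card)
  let ?X = "{r \<in> fpf_perms q S. \<forall>a\<in>A. r a = s a}"
  let ?f = "\<lambda>r x. if x \<in> S - A then r x else x" and ?g = "\<lambda>r. s \<circ> r"
  note sD = fpf_permsD[OF assms(3)]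
  show "bij_betw ?f ?X (fpf_perms q (S - A))"
  proof (rule bij_betw_byWitness[where f' = ?g])
    have inA: "r x \<in> A \<longleftrightarrow> x \<in> A" if "r \<in> ?X" for r x
    proof
      assume "r x \<in> A"
      then obtain y where "y \<in> A" "r x = s y"
        using permutes_image[OF sD(1)] by blast
      then have "r x = r y" using that by auto
      then have "x = y" using that fpf_permsD(6)[of r q S x y] by simp
      then show "x \<in> A" using \<open>y \<in> A\<close> by simp
    qed (use that sD in auto)
    show "\<forall>r\<in>?X. ?g (?f r) = r"
    proof
      fix r assume r: "r \<in> ?X"
      show "?g (?f r) = r"
      proof
        fix x
        show "?g (?f r) x = r x"
          using r inA[OF r, of x] sD(5)[of "r x"] sD(5)[of x] fpf_permsD(4,5)[of r q S x] by auto
      qed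
    qed
    show "\<forall>r\<in>fpf_perms q (S - A). ?f (?g r) = r"
    proof
      fix r assume r: "r \<in> fpf_perms q (S - A)"
      show "?f (?g r) = r"
        using sD(5) fpf_permsD(4,5)[OF r] by fastforce
    qed
    show "?f ` ?X \<subseteq> fpf_perms q (S - A)"
    proof clarify
      fix r assume r: "r \<in> fpf_perms q S" "\<forall>a\<in>A. r a = s a"
      show "?f r \<in> fpf_perms q (S - A)"
        using fpf_perms_restrict[OF r(1) \<open>q > 0\<close>, of "S - A"] inA[of r] r fpf_permsD(4)[OF r(1)] by blast
    qed
    show "?g ` fpf_perms q (S - A) \<subseteq> ?X"
    proof (intro image_subsetI CollectI conjI ballI)
      fix r assume r: "r \<in> fpf_perms q (S - A)"
      note rD = fpf_permsD[OF r]
      show "(s \<circ> r) a = s a" if "a \<in> A" for a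
        using that rD(5)[of a] by simp
      show "s \<circ> r \<in> fpf_perms q S"
      proof (rule fpf_permsI[OF \<open>q > 0\<close>])
        have "((s \<circ> r) ^^ n) x = (if x \<in> A then (s ^^ n) x else (r ^^ n) x)
            \<and> ((s ^^ n) x \<in> A \<longleftrightarrow> x \<in> A) \<and> ((r ^^ n) x \<in> S - A \<longleftrightarrow> x \<in> S - A) \<and> (x \<notin> S \<longrightarrow> (r ^^ n) x = x)" for n x
          by (induction n) (use sD(4,5) rD(4,5) assms(2) in auto)
        then show "((s \<circ> r) ^^ q) x = x" for x
          using sD(2) rD(2) by auto
        show "(s \<circ> r) x = x" if "x \<notin> S" for x
          using that rD(5)[of x] sD(5)[of x] assms(2) by auto
        show "(s \<circ> r) x \<noteq> x" if "x \<in> S" for x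
          using that rD(3-5)[of x] sD(3)[of x] sD(5)[of "r x"] assms(2) by (cases "x \<in> A") auto
      qed
    qed
  qed
qed

lemma fpf_perms_transport:
  assumes s: "s \<in> fpf_perms q U" and "q > 0" and g: "inj_on g U"
  obtains r where "r \<in> fpf_perms q (g ` U)" "\<And>u. u \<in> U \<Longrightarrow> r (g u) = g (s u)"
proof
  let ?r = "\<lambda>y. if y \<in> g ` U then g (s (inv_into U g y)) else y"
  note sD = fpf_permsD[OF s]
  show *: "?r (g u) = g (s u)" if "u \<in> U" for u
    using that g by simp
  show "?r \<in> fpf_perms q (g ` U)"
  proof (rule fpf_permsI[OF \<open>q > 0\<close>])
    have pow: "(?r ^^ n) (g u) = g ((s ^^ n) u) \<and> (s ^^ n) u \<in> U" if "u \<in> U" for n u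
    proof (induction n)
      case (Suc n)
      then show ?case
        using *[of "(s ^^ n) u"] sD(4)[of "(s ^^ n) u"] by simp
    qed (use that in simp)
    have "(?r ^^ n) y = y" if "y \<notin> g ` U" for n y
      by (induction n) (use that in auto)
    then show "(?r ^^ q) y = y" for y
      using pow sD(2) by (cases "y \<in> g ` U") auto
    show "?r y \<noteq> y" if "y \<in> g ` U" for y
      using that * sD(3,4) g by (auto simp: inj_on_eq_iff)
  qed auto
qed

lemma card_fpf_perms_transport:
  assumes "s \<in> fpf_perms q U" "q > 0" "inj_on g U" "g ` U \<subseteq> S"
  shows "card {r \<in> fpf_perms q S. \<forall>u\<in>U. r (g u) = g (s u)} = card (fpf_perms q (S - g ` U))"
proof -
  obtain r where r: "r \<in> fpf_perms q (g ` U)" "\<And>u. u \<in> U \<Longrightarrow> r (g u) = g (s u)"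
    using fpf_perms_transport assms by metis
  show ?thesis
    using card_fpf_perms_extending[OF assms(2,4) r(1)] r(2) by simp
qed

text \<open>These are (2m-1)!! and (3m)! / (3^m m!). Passing from \<open>m\<close> to
  \<open>m + 1\<close> multiplies by the number of choices for the cycle through a given
  point.\<close>

definition count2 :: "nat \<Rightarrow> nat" where "count2 m = (\<Prod>i<m. 2 * i + 1)"
definition count3 :: "nat \<Rightarrow> nat" where "count3 m = (\<Prod>i<m. (3 * i + 1) * (3 * i + 2))"

lemma fpf_perms_empty: "q > 0 \<Longrightarrow> fpf_perms q {} = {id}"
  by (auto simp: fpf_perms_def)

lemma card_fpf_perms_2_fix:
  assumes "x \<in> S" "y \<in> S" "x \<noteq> y"
  shows "card {r \<in> fpf_perms 2 S. r x = y} = card (fpf_perms 2 (S - {x, y}))"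
proof -
  let ?s = "\<lambda>z. if z = x then y else if z = y then x else z"
  have "?s \<in> fpf_perms 2 {x, y}"
    by (rule fpf_permsI) (use assms in \<open>auto simp: numeral_2_eq_2\<close>)
  moreover have "{r \<in> fpf_perms 2 S. r x = y} = {r \<in> fpf_perms 2 S. \<forall>a\<in>{x, y}. r a = ?s a}"
    using assms fpf_perms_2D[where x = x] by auto
  ultimately show ?thesis
    using card_fpf_perms_extending[of 2 "{x, y}" S ?s] assms by simp
qed

lemma card_fpf_perms_3_fix:
  assumes "x \<in> S" "y \<in> S" "z \<in> S" "x \<noteq> y" "x \<noteq> z" "y \<noteq> z"
  shows "card {r \<in> fpf_perms 3 S. r x = y \<and> r y = z} = card (fpf_perms 3 (S - {x, y, z}))"
proof -
  let ?s = "\<lambda>u. if u = x then y else if u = y then z else if u = z then x else u"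
  have "?s \<in> fpf_perms 3 {x, y, z}"
    by (rule fpf_permsI) (use assms in \<open>auto simp: numeral_3_eq_3\<close>)
  moreover have "{r \<in> fpf_perms 3 S. r x = y \<and> r y = z} = {r \<in> fpf_perms 3 S. \<forall>a\<in>{x, y, z}. r a = ?s a}"
    using assms fpf_perms_3D[where x = x] by auto
  ultimately show ?thesis
    using card_fpf_perms_extending[of 3 "{x, y, z}" S ?s] assms by simp
qed

lemma fpf_perms_3_distinct:
  assumes "t \<in> fpf_perms 3 S" "x \<in> S"
  shows "t x \<noteq> x" "t (t x) \<noteq> x" "t (t x) \<noteq> t x"
  using assms fpf_permsD(3,6)[OF assms(1), of x] fpf_permsD(6)[OF assms(1)]
    fpf_perms_3D[OF assms(1), of x] by metis+

lemma card_fpf_perms_2: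
  "finite S \<Longrightarrow> card S = 2 * m \<Longrightarrow> card (fpf_perms 2 S) = count2 m"
proof (induction m arbitrary: S)
  case 0
  then show ?case by (simp add: fpf_perms_empty count2_def)
next
  case (Suc m)
  then obtain x where x: "x \<in> S" by fastforce
  have "fpf_perms 2 S = (\<Union>y\<in>S - {x}. {r \<in> fpf_perms 2 S. r x = y})"
    using x fpf_permsD(3,4) by fastforce
  then have "card (fpf_perms 2 S) = card (\<Union>y\<in>S - {x}. {r \<in> fpf_perms 2 S. r x = y})"
    by simp
  also have "\<dots> = (\<Sum>y\<in>S - {x}. card {r \<in> fpf_perms 2 S. r x = y})"
    by (rule card_UN_disjoint) (use Suc.prems finite_fpf_perms[of S 2] in auto)
  also have "\<dots> = (\<Sum>y\<in>S - {x}. count2 m)"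
  proof (rule sum.cong[OF refl])
    fix y assume y: "y \<in> S - {x}"
    then have "x \<noteq> y" by auto
    have "card (S - {x, y}) = 2 * m"
      using x y Suc.prems by (subst card_Diff_subset) auto
    then show "card {r \<in> fpf_perms 2 S. r x = y} = count2 m"
      using card_fpf_perms_2_fix[of x S y] x y \<open>x \<noteq> y\<close> Suc.IH[of "S - {x, y}"] Suc.prems by simp
  qed
  also have "\<dots> = count2 (Suc m)"
    using x Suc.prems by (simp add: count2_def)
  finally show ?case .
qed

lemma card_fpf_perms_3:
  "finite S \<Longrightarrow> card S = 3 * m \<Longrightarrow> card (fpf_perms 3 S) = count3 m"
proof (induction m arbitrary: S)
  case 0
  then show ?case by (simp add: fpf_perms_empty count3_def)
next
  case (Suc m)
  then obtain x where x: "x \<in> S" by fastforce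
  let ?P = "SIGMA y : S - {x}. S - {x, y}"
  let ?F = "\<lambda>p. {r \<in> fpf_perms 3 S. r x = fst p \<and> r (fst p) = snd p}"
  have "fpf_perms 3 S = (\<Union>p\<in>?P. ?F p)"
  proof (intro equalityI subsetI)
    fix r assume r: "r \<in> fpf_perms 3 S"
    have "(r x, r (r x)) \<in> ?P"
      using x fpf_perms_3_distinct[OF r x] fpf_permsD(4)[OF r] by auto
    then show "r \<in> (\<Union>p\<in>?P. ?F p)"
      using r by force
  qed auto
  then have "card (fpf_perms 3 S) = card (\<Union>p\<in>?P. ?F p)"
    by simp
  also have "\<dots> = (\<Sum>p\<in>?P. card (?F p))"
    by (rule card_UN_disjoint) (use Suc.prems finite_fpf_perms[of S 3] in auto)
  also have "\<dots> = (\<Sum>p\<in>?P. count3 m)"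
  proof (rule sum.cong[OF refl])
    fix p assume p: "p \<in> ?P"
    have neq: "x \<noteq> fst p" "x \<noteq> snd p" "fst p \<noteq> snd p" "fst p \<in> S" "snd p \<in> S"
      using p by auto
    then have "card {x, fst p, snd p} = 3"
      by simp
    then have "card (S - {x, fst p, snd p}) = 3 * m"
      using x neq Suc.prems by (subst card_Diff_subset) auto
    then show "card (?F p) = count3 m"
      using card_fpf_perms_3_fix[of x S "fst p" "snd p"] x neq Suc.IH[of "S - {x, fst p, snd p}"] Suc.prems
      by simp
  qed
  also have "\<dots> = count3 (Suc m)"
  proof -
    have "card (S - {x, y}) = 3 * m + 1" if "y \<in> S - {x}" for y
      using x that Suc.prems by (subst card_Diff_subset) auto
    then have "card ?P = (3 * m + 2) * (3 * m + 1)"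
      using x Suc.prems by (subst card_SigmaI) auto
    then show ?thesis
      by (simp add: count3_def)
  qed
  finally show ?case .
qed

lemma even_card_fpf_perms_2:
  "finite S \<Longrightarrow> s \<in> fpf_perms 2 S \<Longrightarrow> \<exists>m. card S = 2 * m"
proof (induction "card S" arbitrary: S s rule: less_induct)
  case less
  show ?case
  proof (cases "S = {}")
    case False
    then obtain x where x: "x \<in> S" by auto
    let ?y = "s x"
    have y: "?y \<in> S" "x \<noteq> ?y"
      using fpf_permsD(3,4)[OF less.prems(2)] x by metis+
    have fin: "finite (fpf_perms 2 S)"
      using less.prems finite_fpf_perms by blast
    \<comment> \<open>The permutations that agree with \<open>s\<close> at \<open>x\<close> form a
      nonempty set, so by the counting identity there is also one on \<open>S\<close> without the
      cycle of \<open>x\<close>.\<close>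
    have "s \<in> {r \<in> fpf_perms 2 S. r x = ?y}"
      using less.prems by simp
    then have "card (fpf_perms 2 (S - {x, ?y})) > 0"
      using card_fpf_perms_2_fix[OF x y] fin card_gt_0_iff[of "{r \<in> fpf_perms 2 S. r x = ?y}"] by auto
    then obtain s' where "s' \<in> fpf_perms 2 (S - {x, ?y})"
      by (fastforce simp: card_gt_0_iff)
    moreover have card: "card S = Suc (Suc (card (S - {x, ?y})))"
      using x y less.prems by (simp add: card_Diff_subset card_gt_0_iff)
        (metis One_nat_def Suc_pred card_2_iff card_mono empty_subsetI finite.emptyI finite_insert
          insert_subset le_add_diff_inverse2 numeral_2_eq_2 add_Suc_right add_0_right)
    ultimately obtain m where "card (S - {x, ?y}) = 2 * m"
      using less.hyps[of "S - {x, ?y}"] less.prems by auto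
    then show ?thesis
      using card by (intro exI[of _ "Suc m"]) simp
  qed auto
qed

lemma count_pos: "count2 m > 0" "count3 m > 0"
  by (auto simp: count2_def count3_def intro!: prod_pos)

section \<open>Closed walks of a cyclic word\<close>

text \<open>\<open>e\<close> lists the exponents of a cyclic word, extended periodically to all of \<open>\<nat>\<close>.\<close>

locale cyclic_word =
  fixes k :: nat and e :: "nat \<Rightarrow> nat"
  assumes k_pos: "k > 0" and e_range: "e j \<in> {1, 2}" and e_add: "e (j + k) = e j"
begin

lemma e_mod: "e (j mod k) = e j"
proof (induction j rule: less_induct)
  case (less j)
  show ?case
  proof (cases "j < k")
    case False
    then show ?thesis
      using less[of "j - k"] e_add[of "j - k"] k_pos by (simp add: le_mod_geq)
  qed simp
qed

text \<open>One step is one syllable: the power of \<open>t\<close> acts before \<open>s\<close>, as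
  in the composition of permutations. It moves inside a \<open>t\<close>-cycle and leaves it along
  \<open>s\<close>.\<close>

primrec walk :: "('a \<Rightarrow> 'a) \<Rightarrow> ('a \<Rightarrow> 'a) \<Rightarrow> 'a \<Rightarrow> nat \<Rightarrow> 'a" where
  "walk s t x 0 = x"
| "walk s t x (Suc j) = s ((t ^^ e j) (walk s t x j))"

text \<open>Pairs of permutations with a marked fixed point of the word; dividing the cardinality by
  the number of pairs gives the expected number of fixed points.\<close>

definition closed_walks :: "'a set \<Rightarrow> (('a \<Rightarrow> 'a) \<times> ('a \<Rightarrow> 'a) \<times> 'a) set" where
  "closed_walks S = {(s, t, x). s \<in> fpf_perms 2 S \<and> t \<in> fpf_perms 3 S \<and> x \<in> S \<and> walk s t x k = x}"

text \<open>The index \<open>3 * j + i\<close> with \<open>i < 3\<close> encodes the point \<open>\<tau>\<^sup>i y\<^sub>j\<close>, where \<open>y\<^sub>j\<close> is the \<open>j\<close>-th point of the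
  walk.\<close>

fun corner :: "('a \<Rightarrow> 'a) \<times> ('a \<Rightarrow> 'a) \<times> 'a \<Rightarrow> nat \<Rightarrow> 'a" where
  "corner (s, t, x) p = (t ^^ (p mod 3)) (walk s t x (p div 3))"

text \<open>The coincidences among corners describe the labelled graph traced by the walk up to
  isomorphism. The set of possible patterns is finite and independent of the underlying set.\<close>

definition pattern :: "('a \<Rightarrow> 'a) \<times> ('a \<Rightarrow> 'a) \<times> 'a \<Rightarrow> (nat \<times> nat) set" where
  "pattern \<omega> = {(p, q). p < 3 * k \<and> q < 3 * k \<and> corner \<omega> p = corner \<omega> q}"

text \<open>For \<open>d\<close> dividing \<open>k\<close>, the coincidences of a walk that runs
  \<open>k / d\<close> times around a circuit through \<open>d\<close> distinct cycles of
  \<tau>.\<close>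

definition periodic_pattern :: "nat \<Rightarrow> (nat \<times> nat) set" where
  "periodic_pattern d = {(p, q). p < 3 * k \<and> q < 3 * k \<and> p mod 3 = q mod 3 \<and> (p div 3) mod d = (q div 3) mod d}"

end

lemma corner_index: "a < 3 \<Longrightarrow> j < k \<Longrightarrow> 3 * j + a < 3 * (k :: nat)" "a < 3 \<Longrightarrow> (3 * j + a) div 3 = (j::nat)"
    "a < 3 \<Longrightarrow> (3 * j + a) mod 3 = (a::nat)"
  by auto

lemma nat_lt_3_cases: "(a :: nat) < 3 \<Longrightarrow> a = 0 \<or> a = 1 \<or> a = 2"
  by auto

locale closed_walk = cyclic_word +
  fixes S :: "'a set" and s t :: "'a \<Rightarrow> 'a" and x :: 'a
  assumes s: "s \<in> fpf_perms 2 S" and t: "t \<in> fpf_perms 3 S" and x: "x \<in> S" and closed: "walk s t x k = x"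
begin

text \<open>\<open>Y j\<close> is where the walk enters its \<open>j\<close>-th \<tau>-cycle,
  \<open>Z j\<close> where it leaves that cycle.\<close>

abbreviation Y where "Y j \<equiv> walk s t x j"
abbreviation Z where "Z j \<equiv> (t ^^ e j) (Y j)"

definition orb where "orb y = {y, t y, t (t y)}"

text \<open>The walk involves \<open>t\<close> on the whole cycles that it meets
  (\<open>corners\<close>), but \<open>s\<close> only on the entry and exit points
  (\<open>ports\<close>). A walk with the same pattern is prescribed exactly there.\<close>

definition corners where "corners = corner (s, t, x) ` {..<3 * k}"
definition ports where "ports = Y ` {..<k} \<union> Z ` {..<k}"

lemma ss: "s (s y) = y" and ttt: "t (t (t y)) = y"
  using fpf_perms_2D[OF s] fpf_perms_3D[OF t] by auto

lemma s_inj: "s y = s z \<longleftrightarrow> y = z"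
  by (rule fpf_permsD(6)[OF s])

lemma t_in: "t y \<in> S \<longleftrightarrow> y \<in> S" and s_in: "s y \<in> S \<longleftrightarrow> y \<in> S"
  using fpf_permsD(4)[OF s] fpf_permsD(4)[OF t] by auto

lemma e_cases: "e j = 1 \<or> e j = 2"
  using e_range by auto

lemma Z_cases: "e j = 1 \<and> Z j = t (Y j) \<or> e j = 2 \<and> Z j = t (t (Y j))"
  using e_cases[of j] by (auto simp: numeral_2_eq_2)

lemma Y_in: "Y j \<in> S"
proof (induction j)
  case (Suc j)
  then show ?case using Z_cases[of j] by (auto simp: s_in t_in)
qed (use x in simp)

lemma Y_add: "Y (j + k) = Y j"
  by (induction j) (use closed e_add in auto)

lemma Y_mod: "Y (j mod k) = Y j"
proof (induction j rule: less_induct)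
  case (less j)
  show ?case
  proof (cases "j < k")
    case False
    then show ?thesis
      using less[of "j - k"] Y_add[of "j - k"] k_pos by (simp add: le_mod_geq)
  qed simp
qed

lemma orb_distinct: "y \<in> S \<Longrightarrow> t y \<noteq> y" "y \<in> S \<Longrightarrow> t (t y) \<noteq> y" "y \<in> S \<Longrightarrow> t (t y) \<noteq> t y"
  using fpf_perms_3_distinct[OF t] by auto

lemma Y_neq_Z: "Y j \<noteq> Z j"
  using Z_cases[of j] orb_distinct[OF Y_in[of j]] by metis

lemma Z_in_orb: "Z j \<in> orb (Y j)"
  using Z_cases[of j] by (auto simp: orb_def)

lemma orb_self: "y \<in> orb y"
  by (simp add: orb_def)

lemma orb_eq: "z \<in> orb y \<Longrightarrow> orb z = orb y"
  using ttt by (auto simp: orb_def)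

lemma s_Z: "s (Z j) = Y (Suc j)" and s_Y: "s (Y (Suc j)) = Z j"
  by (simp_all add: ss)

lemma s_fpf: "s (Z j) \<noteq> Z j"
  using fpf_permsD(3)[OF s, of "Z j"] Y_in[of j] Z_cases[of j] by (auto simp: t_in)

lemma Y_in_ports: "Y j \<in> ports" and Z_in_ports: "Z j \<in> ports"
proof -
  have "Y (j mod k) \<in> ports" "Z (j mod k) \<in> ports"
    unfolding ports_def using k_pos by (intro UnI1 UnI2 imageI; simp)+
  then show "Y j \<in> ports" "Z j \<in> ports"
    by (simp_all only: Y_mod e_mod)
qed

lemma corners_eq: "corners = (\<Union>j<k. orb (Y j))"
proof (intro equalityI subsetI)
  fix y assume "y \<in> corners"
  then obtain p where p: "p < 3 * k" "y = (t ^^ (p mod 3)) (Y (p div 3))"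
    by (auto simp: corners_def)
  have "p mod 3 = 0 \<or> p mod 3 = 1 \<or> p mod 3 = 2" by auto
  then have "y \<in> orb (Y (p div 3))"
    using p by (auto simp: numeral_2_eq_2 orb_def)
  moreover have "p div 3 < k" using p by auto
  ultimately show "y \<in> (\<Union>j<k. orb (Y j))" by blast
next
  fix y assume "y \<in> (\<Union>j<k. orb (Y j))"
  then obtain j where j: "j < k" "y \<in> orb (Y j)" by auto
  then obtain a where a: "a < 3" "y = (t ^^ a) (Y j)"
    using that[of 0] that[of 1] that[of 2] by (auto simp: numeral_2_eq_2 orb_def)
  then have "y = corner (s, t, x) (3 * j + a)"
    by (simp only: corner.simps corner_index(2,3))
  then show "y \<in> corners"
    using a(1) j(1) corner_index(1) unfolding corners_def by blast
qed

lemma orb_in_corners: "y \<in> orb (Y j) \<Longrightarrow> y \<in> corners"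
  using k_pos Y_mod[of j] by (auto simp: corners_eq intro!: bexI[of _ "j mod k"])

lemma ports_subset_corners: "ports \<subseteq> corners"
  unfolding ports_def by (auto intro!: orb_in_corners[OF Z_in_orb] orb_in_corners[OF orb_self])

lemma corners_subset: "corners \<subseteq> S"
  using Y_in t_in by (auto simp: corners_eq orb_def)

lemma s_ports: "s y \<in> ports \<longleftrightarrow> y \<in> ports"
proof -
  have *: "s y \<in> ports" if y: "y \<in> ports" for y
  proof -
    consider j where "y = Y j" | j where "y = Z j"
      using y by (auto simp: ports_def)
    then show ?thesis
    proof cases
      case (1 j)
      \<comment> \<open>Adding the period \<open>k\<close> gives \<open>Y j\<close> a predecessor,
        also for \<open>j = 0\<close>.\<close>
      have "y = Y (Suc (j + k - 1))"
        using 1 k_pos Y_add[of j] by simp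
      then show ?thesis
        using s_Y[of "j + k - 1"] Z_in_ports[of "j + k - 1"] by simp
    next
      case (2 j)
      then show ?thesis
        using Y_in_ports[of "Suc j"] by simp
    qed
  qed
  show ?thesis
    using *[of y] *[of "s y"] ss by auto
qed

lemma t_corners: "t y \<in> corners \<longleftrightarrow> y \<in> corners"
proof -
  have *: "t y \<in> corners" if "y \<in> corners" for y
    using that ttt by (auto simp: corners_eq orb_def)
  show ?thesis
    using *[of y] *[of "t y"] *[of "t (t y)"] ttt by auto
qed

lemma finite_corners: "finite corners" and finite_ports: "finite ports"
  by (auto simp: corners_def ports_def)

lemma restrict_s: "(\<lambda>y. if y \<in> ports then s y else y) \<in> fpf_perms 2 ports"
  by (rule fpf_perms_restrict[OF s]) (use ports_subset_corners corners_subset s_ports in auto)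

lemma restrict_t: "(\<lambda>y. if y \<in> corners then t y else y) \<in> fpf_perms 3 corners"
  by (rule fpf_perms_restrict[OF t]) (use corners_subset t_corners in auto)

text \<open>\<open>m \<le> a\<close> because every cycle of \<open>t\<close> met by the walk contains the two distinct ports \<open>Y j\<close> and
  \<open>Z j\<close>.\<close>

lemma card_corners_ports:
  obtains m a where "card corners = 3 * m" "card ports = 2 * a" "m \<le> a"
    "m = a \<longrightarrow> (\<forall>i j. Y j \<in> orb (Y i) \<longrightarrow> {Y i, Z i} = {Y j, Z j})"
proof -
  define Os where "Os = (\<lambda>j. orb (Y j)) ` {..<k}"
  have fin: "finite Os" and OsE: "\<And>o1. o1 \<in> Os \<Longrightarrow> \<exists>j. o1 = orb (Y j)" and corners: "corners = \<Union>Os"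
    by (auto simp: Os_def corners_eq)
  have finorb: "finite (orb y)" for y
    by (simp add: orb_def)
  have disj: "o1 \<inter> o2 = {}" if o12: "o1 \<in> Os" "o2 \<in> Os" "o1 \<noteq> o2" for o1 o2
  proof (rule ccontr)
    assume "o1 \<inter> o2 \<noteq> {}"
    then obtain z where z: "z \<in> o1" "z \<in> o2" by auto
    obtain i j where ij: "o1 = orb (Y i)" "o2 = orb (Y j)"
      using o12 OsE by metis
    have "orb z = o1" "orb z = o2"
      using orb_eq[of z "Y i"] orb_eq[of z "Y j"] z unfolding ij by blast+
    then show False
      using o12(3) by blast
  qed
  have "card (\<Union>Os) = (\<Sum>o1\<in>Os. card o1)"
    by (rule card_Union_disjoint) (use OsE finorb disj in \<open>auto simp: pairwise_def disjnt_def\<close>)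
  also have "\<dots> = (\<Sum>o1\<in>Os. 3)"
  proof (rule sum.cong[OF refl])
    fix o1 assume "o1 \<in> Os"
    then obtain j where "o1 = orb (Y j)" using OsE by blast
    then show "card o1 = 3"
      using orb_distinct[OF Y_in[of j]] by (simp add: eq_commute orb_def)
  qed
  finally have m: "card corners = 3 * card Os"
    by (simp add: corners)
  have two: "card {Y j, Z j} = 2" for j
    using Y_neq_Z[of j] by simp
  have sub: "{Y j, Z j} \<subseteq> ports \<inter> orb (Y j)" for j
    by (simp add: Y_in_ports Z_in_ports Z_in_orb orb_self)
  have ge: "2 \<le> card (ports \<inter> o1)" if o1: "o1 \<in> Os" for o1
  proof -
    obtain j where j: "o1 = orb (Y j)" using OsE[OF o1] by blast
    show ?thesis
      using card_mono[OF _ sub, of j] finite_ports unfolding j two by blast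
  qed
  have "ports = (\<Union>o1\<in>Os. ports \<inter> o1)"
    using ports_subset_corners by (auto simp: corners)
  then have "card ports = card (\<Union>o1\<in>Os. ports \<inter> o1)"
    by simp
  also have "\<dots> = (\<Sum>o1\<in>Os. card (ports \<inter> o1))"
    by (rule card_UN_disjoint) (use fin finite_ports disj in blast)+
  finally have sum: "card ports = (\<Sum>o1\<in>Os. card (ports \<inter> o1))" .
  obtain a where a: "card ports = 2 * a"
    using even_card_fpf_perms_2[OF finite_ports restrict_s] by blast
  have le: "card Os \<le> a"
    using sum_mono[of Os "\<lambda>_. 2" "\<lambda>o1. card (ports \<inter> o1)"] ge sum a by simp
  \<comment> \<open>When \<open>m = a\<close>, the average number of ports per cycle is the minimum
    2, so \<open>Y i\<close> and \<open>Z i\<close> are the only ports in their cycle.\<close>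
  have "{Y i, Z i} = {Y j, Z j}" if eq: "card Os = a" and ij: "Y j \<in> orb (Y i)" for i j
  proof -
    have *: "ports \<inter> orb (Y i) = {Y i, Z i}" for i
    proof -
      have in_O: "orb (Y i) \<in> Os"
        using k_pos unfolding Os_def by (intro image_eqI[of _ _ "i mod k"]) (simp_all add: Y_mod)
      have "card (ports \<inter> orb (Y i)) = 2"
      proof (rule ccontr)
        assume "card (ports \<inter> orb (Y i)) \<noteq> 2"
        then have "2 < card (ports \<inter> orb (Y i))" using ge[OF in_O] by linarith
        then have "(\<Sum>o1\<in>Os. 2) < (\<Sum>o1\<in>Os. card (ports \<inter> o1))"
          using ge in_O fin by (intro sum_strict_mono_ex1) auto
        then show False using sum a eq by simp
      qed
      then show ?thesis
        using card_subset_eq[OF _ sub, of i] finite_ports two[of i] by (metis finite_Int)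
    qed
    have "orb (Y j) = orb (Y i)"
      using orb_eq[OF ij] .
    then show ?thesis using *[of i] *[of j] by simp
  qed
  then show ?thesis
    using that[OF m a le] by blast
qed

section \<open>Walks with exactly two ports in every cycle\<close>

context
  assumes tight: "\<And>i j. Y j \<in> orb (Y i) \<Longrightarrow> {Y i, Z i} = {Y j, Z j}"
begin

text \<open>If the walk traversed some \<open>\<tau>\<close>-cycle in both directions, the two passages could be followed
  until they meet, at a fixed point of \<open>\<sigma>\<close> or of a power of \<open>\<tau>\<close>.\<close>

lemma no_reversal: "i \<le> j \<Longrightarrow> Y i = Z j \<Longrightarrow> Z i = Y j \<Longrightarrow> False"
proof (induction "j - i" arbitrary: i j rule: less_induct)
  case less
  consider "j = i" | "j = Suc i" | "Suc (Suc i) \<le> j"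
    using less.prems(1) by linarith
  then show False
  proof cases
    case 1
    then show False using less.prems(2) Y_neq_Z[of i] by blast
  next
    case 2
    then show False using less.prems(3) s_fpf[of i] s_Z[of i] by metis
  next
    case 3
    then obtain j' where j: "j = Suc j'" by (cases j) auto
    \<comment> \<open>A reversed passage at times \<open>i\<close> and \<open>j\<close> forces one
      at \<open>i + 1\<close> and \<open>j - 1\<close>, so the distance drops by 2.\<close>
    have "Y (Suc i) = s (Y j)"
      using less.prems(3) s_Z[of i] by metis
    also have "\<dots> = Z j'"
      using s_Y[of j'] j by simp
    finally have YZ: "Y (Suc i) = Z j'" .
    then have "orb (Y (Suc i)) = orb (Y j')"
      using orb_eq[OF Z_in_orb[of j']] by simp
    then have "Y j' \<in> orb (Y (Suc i))" using orb_self by metis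
    then have "{Y (Suc i), Z (Suc i)} = {Y j', Z j'}"
      by (rule tight)
    then have "Z (Suc i) = Y j'"
      using YZ Y_neq_Z[of "Suc i"] by (metis doubleton_eq_iff)
    then show False
      using less.hyps[of j' "Suc i", OF _ _ YZ] 3 j by linarith
  qed
qed

lemma orb_Y_imp_eq: "Y j \<in> orb (Y i) \<Longrightarrow> Y i = Y j \<and> Z i = Z j"
proof (rule ccontr)
  assume "Y j \<in> orb (Y i)" and neg: "\<not> (Y i = Y j \<and> Z i = Z j)"
  from tight[OF this(1)] neg have *: "Y i = Z j" "Z i = Y j"
    by (metis doubleton_eq_iff)+
  show False
  proof (cases "i \<le> j")
    case True
    then show False using no_reversal * by blast
  next
    case False
    then have "j \<le> i" by simp
    then show False using no_reversal *(2)[symmetric] *(1)[symmetric] by blast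
  qed
qed

lemma Y_eq_imp_e_eq:
  assumes "Y i = Y j"
  shows "e i = e j"
proof -
  have "Z i = Z j" using orb_Y_imp_eq[of j i] assms by (simp add: orb_self)
  then show ?thesis
    using Z_cases[of i] Z_cases[of j] assms orb_distinct[OF Y_in[of j]] by metis
qed

text \<open>Forwards, equal points have equal exponents; backwards, equal points come from a common
  cycle, which is always traversed in the same way. Hence coincidences are invariant under shifting
  both times.\<close>

lemma Y_Suc_eq_iff: "Y (Suc i) = Y (Suc j) \<longleftrightarrow> Y i = Y j"
proof
  assume "Y (Suc i) = Y (Suc j)"
  then have "Z i = Z j" by (simp add: s_inj)
  then have "orb (Y i) = orb (Y j)"
    using orb_eq[OF Z_in_orb[of i]] orb_eq[OF Z_in_orb[of j]] by simp
  then have "Y j \<in> orb (Y i)" using orb_self by metis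
  then show "Y i = Y j"
    using orb_Y_imp_eq by blast
next
  assume "Y i = Y j"
  then show "Y (Suc i) = Y (Suc j)" using Y_eq_imp_e_eq[of i j] by simp
qed

lemma Y_add_eq_iff: "Y (i + n) = Y (j + n) \<longleftrightarrow> Y i = Y j"
  by (induction n) (simp_all only: Y_Suc_eq_iff add_Suc_right add_0_right)

text \<open>By shift invariance the first return time \<open>d\<close> to the start is a period of
  the walk and of its exponents, and no two points within one period coincide.\<close>

lemma pattern_periodic:
  obtains d where "d > 0" "d dvd k" "pattern (s, t, x) = periodic_pattern d" "\<And>j. e (j + d) = e j"
proof -
  define d where "d = (LEAST d. d > 0 \<and> Y d = Y 0)"
  have "k > 0 \<and> Y k = Y 0" using k_pos closed by simp
  then have d: "d > 0 \<and> Y d = Y 0"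
    unfolding d_def by (rule LeastI)
  have d_min: "d \<le> n" if "n > 0" "Y n = Y 0" for n
    unfolding d_def using that by (intro Least_le) auto
  have Y_add_d: "Y (j + d) = Y j" for j
    using Y_add_eq_iff[of d j 0] d by (simp add: add.commute)
  have Y_mod_d: "Y (j mod d) = Y j" for j
  proof (induction j rule: less_induct)
    case (less j)
    show ?case
    proof (cases "j < d")
      case False
      then show ?thesis
        using less[of "j - d"] Y_add_d[of "j - d"] d by (simp add: le_mod_geq)
    qed simp
  qed
  have noless: False if "i < j" "j < d" "Y i = Y j" for i j
    using that Y_add_eq_iff[of 0 i "j - i"] d_min[of "j - i"] by simp
  have Y_iff: "Y i = Y j \<longleftrightarrow> i mod d = j mod d" for i j
  proof
    assume "Y i = Y j"
    then have eq: "Y (i mod d) = Y (j mod d)"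
      by (simp only: Y_mod_d)
    have "i mod d < d" "j mod d < d" using d by auto
    then show "i mod d = j mod d"
      using noless[of "i mod d" "j mod d"] noless[of "j mod d" "i mod d"] eq
      by (metis linorder_neqE_nat)
  next
    assume "i mod d = j mod d"
    then show "Y i = Y j" using Y_mod_d by metis
  qed
  have "d dvd k"
    using Y_iff[of k 0] closed by auto
  moreover have "e (j + d) = e j" for j
    using Y_eq_imp_e_eq Y_add_d by blast
  moreover have "pattern (s, t, x) = periodic_pattern d"
  proof -
    have "(t ^^ a) (Y i) = (t ^^ b) (Y j) \<longleftrightarrow> a = b \<and> Y i = Y j" if "a < 3" "b < 3" for a b i j
    proof
      assume eq: "(t ^^ a) (Y i) = (t ^^ b) (Y j)"
      have "(t ^^ a) (Y i) \<in> orb (Y i)" "(t ^^ b) (Y j) \<in> orb (Y j)"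
        using nat_lt_3_cases[OF that(1)] nat_lt_3_cases[OF that(2)] by (auto simp: numeral_2_eq_2 orb_def)
      then have "orb (Y i) = orb (Y j)"
        using eq orb_eq by metis
      then have "Y j \<in> orb (Y i)" using orb_self by metis
      then have Y: "Y i = Y j"
        using orb_Y_imp_eq by blast
      then show "a = b \<and> Y i = Y j"
        using eq nat_lt_3_cases[OF that(1)] nat_lt_3_cases[OF that(2)] orb_distinct[OF Y_in[of j]]
        by (auto simp: numeral_2_eq_2)
    qed auto
    then show ?thesis
      by (auto simp: pattern_def periodic_pattern_def Y_iff)
  qed
  ultimately show ?thesis
    using that d by blast
qed

end

section \<open>Counting the closed walks with a prescribed pattern\<close>

lemma t_pow_mod: "(t ^^ (a mod 3)) y = (t ^^ a) y"
  by (rule funpow_mod_eq) (rule fpf_permsD(2)[OF t])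

lemma corner_eq: "(t ^^ a) (Y j) = corner (s, t, x) (3 * (j mod k) + a mod 3)"
  by (simp add: t_pow_mod Y_mod)

lemma corner_in: "(t ^^ a) (Y j) \<in> corners"
proof -
  have "3 * (j mod k) + a mod 3 < 3 * k"
    using k_pos by (intro corner_index) auto
  then show ?thesis
    unfolding corner_eq corners_def by blast
qed

lemma cornersE:
  assumes "y \<in> corners"
  obtains a j where "y = (t ^^ a) (Y j)"
  using assms by (auto simp: corners_def)

lemma embedding_walk:
  fixes s' t' :: "'b \<Rightarrow> 'b"
  assumes "\<And>u. u \<in> ports \<Longrightarrow> s' (g u) = g (s u)" "\<And>u. u \<in> corners \<Longrightarrow> t' (g u) = g (t u)"
  shows "(t' ^^ a) (walk s' t' (g x) j) = g ((t ^^ a) (Y j))"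
proof (induction j arbitrary: a)
  case 0
  show ?case
    using corner_in[of _ 0] assms(2) by (induction a) auto
next
  case (Suc j)
  have "walk s' t' (g x) (Suc j) = g (Y (Suc j))"
    using Suc assms(1)[OF Z_in_ports] by simp
  moreover have "(t' ^^ a) (g (Y (Suc j))) = g ((t ^^ a) (Y (Suc j)))"
    using corner_in[of _ "Suc j"] assms(2) by (induction a) (auto simp del: walk.simps)
  ultimately show ?case by simp
qed

text \<open>A closed walk on \<open>S'\<close> with this pattern amounts to an injection
  \<open>g\<close> of \<open>corners\<close> into \<open>S'\<close> together with an extension of
  the transported \<open>s\<close> and one of the transported \<open>t\<close>: a falling factorial
  times two cycle counts on the remaining points. If \<open>6 * n < 3 * m\<close> there is no
  injection, and the product contains the factor 0.\<close>

lemma card_same_pattern: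
  fixes S' :: "'b set"
  assumes fin: "finite S'" and card_S': "card S' = 6 * n"
    and m: "card corners = 3 * m" and a: "card ports = 2 * a"
  shows "card {\<omega> \<in> closed_walks S'. pattern \<omega> = pattern (s, t, x)} =
    (\<Prod>i<3 * m. 6 * n - i) * (count2 (3 * n - a) * count3 (2 * n - m))"
proof -
  define G where "G = {g \<in> corners \<rightarrow>\<^sub>E S'. inj_on g corners}"
  define P where "P g = {r \<in> fpf_perms 2 S'. \<forall>u\<in>ports. r (g u) = g (s u)}" for g
  define Q where "Q g = {r \<in> fpf_perms 3 S'. \<forall>u\<in>corners. r (g u) = g (t u)}" for g
  have finG: "finite G"
    by (rule finite_subset[of _ "corners \<rightarrow>\<^sub>E S'"]) (auto simp: G_def intro: finite_PiE fin finite_corners)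
  have cardG: "card G = (\<Prod>i<3 * m. 6 * n - i)"
    using card_inj_on_subset_funcset[OF finite_corners fin subset_refl] card_S' m
    by (simp add: G_def lessThan_atLeast0)
  have cardP: "card (P g) = count2 (3 * n - a)" if "g \<in> G" for g
  proof -
    have g: "inj_on g ports" "g ` ports \<subseteq> S'"
      using that ports_subset_corners by (auto simp: G_def intro: inj_on_subset)
    have "P g = {r \<in> fpf_perms 2 S'. \<forall>u\<in>ports. r (g u) = g (if u \<in> ports then s u else u)}"
      by (auto simp: P_def)
    then have "card (P g) = card (fpf_perms 2 (S' - g ` ports))"
      using card_fpf_perms_transport[OF restrict_s _ g] by simp
    moreover have "card (S' - g ` ports) = 2 * (3 * n - a)"
      using g fin a card_S' by (simp add: card_Diff_subset finite_subset card_image)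
    ultimately show ?thesis
      using card_fpf_perms_2[of "S' - g ` ports"] fin by simp
  qed
  have cardQ: "card (Q g) = count3 (2 * n - m)" if "g \<in> G" for g
  proof -
    have g: "inj_on g corners" "g ` corners \<subseteq> S'"
      using that by (auto simp: G_def)
    have "Q g = {r \<in> fpf_perms 3 S'. \<forall>u\<in>corners. r (g u) = g (if u \<in> corners then t u else u)}"
      by (auto simp: Q_def)
    then have "card (Q g) = card (fpf_perms 3 (S' - g ` corners))"
      using card_fpf_perms_transport[OF restrict_t _ g] by simp
    moreover have "card (S' - g ` corners) = 3 * (2 * n - m)"
      using g fin m card_S' by (simp add: card_Diff_subset finite_subset card_image)
    ultimately show ?thesis
      using card_fpf_perms_3[of "S' - g ` corners"] fin by simp
  qed
  let ?h = "\<lambda>(g, r, q). (r, q, g x)"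
  let ?W = "{\<omega> \<in> closed_walks S'. pattern \<omega> = pattern (s, t, x)}"
  have x_corner: "x \<in> corners"
    using corner_in[of 0 0] by simp
  have "bij_betw ?h (SIGMA g : G. P g \<times> Q g) ?W"
  proof (rule bij_betw_imageI)
    have pow: "(q ^^ c) (walk r q (g x) j) = g ((t ^^ c) (Y j))"
      if "g \<in> G" "r \<in> P g" "q \<in> Q g" for g r q c j
      using that embedding_walk[of r g q c j] by (auto simp: P_def Q_def)
    show "inj_on ?h (SIGMA g : G. P g \<times> Q g)"
    proof (rule inj_onI)
      fix z z' assume z: "z \<in> (SIGMA g : G. P g \<times> Q g)" "z' \<in> (SIGMA g : G. P g \<times> Q g)" "?h z = ?h z'"
      obtain g r q where zgrq: "z = (g, r, q)" by (cases z) auto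
      obtain g' r' q' where zgrq': "z' = (g', r', q')" by (cases z') auto
      have rq: "r' = r" "q' = q"
        using z(3) by (simp_all add: zgrq zgrq')
      have g: "g \<in> G" "g' \<in> G" "r \<in> P g" "r \<in> P g'" "q \<in> Q g" "q \<in> Q g'" "g x = g' x"
        using z by (auto simp: zgrq zgrq' rq)
      have "g y = g' y" if y: "y \<in> corners" for y
      proof -
        obtain c j where "y = (t ^^ c) (Y j)"
          using cornersE[OF y] by blast
        then show ?thesis
          using pow[of g r q c j] pow[of g' r q c j] g by metis
      qed
      then have "g = g'"
        using g(1,2) unfolding G_def by (blast intro: PiE_ext)
      then show "z = z'"
        by (simp add: zgrq zgrq' rq)
    qed
    show "?h ` (SIGMA g : G. P g \<times> Q g) = ?W"
    proof (intro equalityI subsetI)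
      fix \<omega> assume "\<omega> \<in> ?h ` (SIGMA g : G. P g \<times> Q g)"
      then obtain g r q where g: "g \<in> G" "r \<in> P g" "q \<in> Q g" and \<omega>: "\<omega> = (r, q, g x)"
        by auto
      note pw = pow[OF g]
      have "walk r q (g x) k = g x"
        using pw[of 0 k] closed by simp
      moreover have "g x \<in> S'"
        using g x_corner by (auto simp: G_def)
      moreover have "pattern \<omega> = pattern (s, t, x)"
      proof -
        have "corner \<omega> p = g (corner (s, t, x) p)" for p
          by (simp add: \<omega> pw)
        moreover have "inj_on g corners" using g by (simp add: G_def)
        ultimately have "corner \<omega> p = corner \<omega> p' \<longleftrightarrow> corner (s, t, x) p = corner (s, t, x) p'"
          if "p < 3 * k" "p' < 3 * k" for p p'
          using that by (auto simp: corners_def inj_on_eq_iff simp del: corner.simps)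
        then show ?thesis by (auto simp: pattern_def simp del: corner.simps)
      qed
      ultimately show "\<omega> \<in> ?W"
        using g by (auto simp: closed_walks_def \<omega> P_def Q_def)
    next
      fix \<omega> assume \<omega>: "\<omega> \<in> ?W"
      obtain r q y where rqy: "\<omega> = (r, q, y)" by (cases \<omega>) auto
      interpret W: closed_walk k e S' r q y
        using \<omega> by unfold_locales (auto simp: closed_walks_def rqy)
      have pat: "corner (s, t, x) p = corner (s, t, x) p' \<longleftrightarrow> corner (r, q, y) p = corner (r, q, y) p'"
        if "p < 3 * k" "p' < 3 * k" for p p'
      proof -
        have "(p, p') \<in> pattern (s, t, x) \<longleftrightarrow> (p, p') \<in> pattern (r, q, y)"
          using \<omega> rqy by simp
        then show ?thesis
          using that by (simp add: pattern_def)
      qed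
      \<comment> \<open>Corners are matched by index; equality of the patterns makes the choice of
        the index immaterial and \<open>g\<close> injective.\<close>
      define g where "g = restrict (\<lambda>u. corner (r, q, y) (SOME p. p < 3 * k \<and> corner (s, t, x) p = u)) corners"
      have g_corner: "g (corner (s, t, x) p) = corner (r, q, y) p" if p: "p < 3 * k" for p
      proof -
        let ?p = "SOME p'. p' < 3 * k \<and> corner (s, t, x) p' = corner (s, t, x) p"
        have "?p < 3 * k \<and> corner (s, t, x) ?p = corner (s, t, x) p"
          by (rule someI[of _ p]) (use p in simp)
        then have "corner (r, q, y) ?p = corner (r, q, y) p"
          using pat p by blast
        moreover have "corner (s, t, x) p \<in> corners"
          using p by (auto simp: corners_def)
        ultimately show ?thesis
          by (simp only: g_def restrict_apply' )
      qed
      have g_pow: "g ((t ^^ c) (Y j)) = (q ^^ c) (walk r q y j)" for c j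
      proof -
        have "3 * (j mod k) + c mod 3 < 3 * k"
          using k_pos by (intro corner_index) auto
        then show ?thesis
          unfolding corner_eq W.corner_eq by (rule g_corner)
      qed
      have "g \<in> G"
        unfolding G_def
      proof (intro CollectI conjI inj_onI)
        show "g \<in> corners \<rightarrow>\<^sub>E S'"
        proof (rule PiE_I)
          fix u assume "u \<in> corners"
          then obtain c j where "u = (t ^^ c) (Y j)" by (rule cornersE)
          then show "g u \<in> S'"
            using g_pow W.corner_in W.corners_subset by (metis subsetD)
        qed (simp add: g_def)
        fix u v assume uv: "u \<in> corners" "v \<in> corners" "g u = g v"
        then obtain p p' where "p < 3 * k" "p' < 3 * k" "u = corner (s, t, x) p" "v = corner (s, t, x) p'"
          unfolding corners_def by blast
        then show "u = v"
          using uv(3) g_corner pat by metis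
      qed
      moreover have "r \<in> P g"
        unfolding P_def
      proof (intro CollectI conjI ballI W.s)
        fix u assume "u \<in> ports"
        then obtain j where "u = Y j \<or> u = Z j" by (auto simp: ports_def)
        then have "\<exists>j. u = Y (Suc j) \<or> u = Z j"
        proof
          assume "u = Y j"
          then have "u = Y (Suc (j + k - 1))"
            using k_pos Y_add[of j] by simp
          then show ?thesis by blast
        qed blast
        then obtain j where "u = Y (Suc j) \<or> u = Z j" by blast
        then show "r (g u) = g (s u)"
        proof
          assume u: "u = Y (Suc j)"
          have "r (g u) = r (walk r q y (Suc j))"
            using g_pow[of 0 "Suc j"] u by simp
          also have "\<dots> = g (Z j)"
            using g_pow[of "e j" j] by (simp add: W.ss)
          also have "\<dots> = g (s u)"
            using s_Y[of j] u by simp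
          finally show ?thesis .
        next
          assume u: "u = Z j"
          have "r (g u) = walk r q y (Suc j)"
            using g_pow[of "e j" j] u by simp
          also have "\<dots> = g (s u)"
            using g_pow[of 0 "Suc j"] u by simp
          finally show ?thesis .
        qed
      qed
      moreover have "q \<in> Q g"
        unfolding Q_def
      proof (intro CollectI conjI ballI W.t)
        fix u assume "u \<in> corners"
        then obtain c j where "u = (t ^^ c) (Y j)" by (rule cornersE)
        then show "q (g u) = g (t u)"
          using g_pow[of c j] g_pow[of "Suc c" j] by simp
      qed
      moreover have "g x = y"
        using g_pow[of 0 0] by simp
      ultimately show "\<omega> \<in> ?h ` (SIGMA g : G. P g \<times> Q g)"
        unfolding rqy by (intro image_eqI[of _ _ "(g, r, q)"]) auto
    qed
  qed
  then have "card ?W = card (SIGMA g : G. P g \<times> Q g)"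
    by (simp add: bij_betw_same_card)
  also have "\<dots> = (\<Sum>g\<in>G. card (P g \<times> Q g))"
    by (rule card_SigmaI) (use finG fin finite_fpf_perms[of S'] in \<open>auto simp: P_def Q_def\<close>)
  also have "\<dots> = card G * (count2 (3 * n - a) * count3 (2 * n - m))"
    using cardP cardQ by (simp add: card_cartesian_product)
  finally show ?thesis
    unfolding cardG .
qed

end

section \<open>Asymptotics of the counts\<close>

text \<open>The quotient of the counts is a product of \<open>a\<close> factors
  \<open>1 / (6n - 2i - 1)\<close>, each asymptotic to \<open>1 / (6n)\<close>.\<close>

lemma tendsto_count2: "(\<lambda>n. (6 * real n) ^ a * count2 (3 * n - a) / count2 (3 * n)) \<longlonglongrightarrow> 1"
proof (induction a)
  case 0
  then show ?case
    using count_pos by (simp add: neq0_conv[symmetric] del: neq0_conv)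
next
  case (Suc a)
  have "(\<lambda>n. 6 * real n / (6 * real n - 2 * real a - 1)) \<longlonglongrightarrow> 1"
    by real_asymp
  from tendsto_mult[OF Suc this]
  have "(\<lambda>n. (6 * real n) ^ a * count2 (3 * n - a) / count2 (3 * n) * (6 * real n / (6 * real n - 2 * real a - 1))) \<longlonglongrightarrow> 1"
    by simp
  moreover have "\<forall>\<^sub>F n in sequentially. (6 * real n) ^ a * count2 (3 * n - a) / count2 (3 * n) * (6 * real n / (6 * real n - 2 * real a - 1))
      = (6 * real n) ^ Suc a * count2 (3 * n - Suc a) / count2 (3 * n)"
    using eventually_ge_at_top[of "Suc a"]
  proof eventually_elim
    case (elim n)
    then have "count2 (3 * n - a) = count2 (3 * n - Suc a) * (2 * (3 * n - Suc a) + 1)"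
      by (subst Suc_diff_Suc[symmetric]) (auto simp: count2_def)
    moreover have "real (2 * (3 * n - Suc a) + 1) = 6 * real n - 2 * real a - 1"
      using elim by (simp add: of_nat_diff)
    ultimately have "real (count2 (3 * n - a)) = real (count2 (3 * n - Suc a)) * (6 * real n - 2 * real a - 1)"
      by (simp only: of_nat_mult)
    moreover have "6 * real n - 2 * real a - 1 \<noteq> 0"
      using elim by simp
    ultimately show ?case
      by simp
  qed
  ultimately show ?case
    by (rule Lim_transform_eventually)
qed

text \<open>Each removed 3-cycle accounts for two factors close to \<open>6n\<close>, hence the
  exponent \<open>2 * m\<close>.\<close>

lemma tendsto_count3: "(\<lambda>n. (6 * real n) ^ (2 * m) * count3 (2 * n - m) / count3 (2 * n)) \<longlonglongrightarrow> 1"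
proof (induction m)
  case 0
  then show ?case
    using count_pos by (simp add: neq0_conv[symmetric] del: neq0_conv)
next
  case (Suc m)
  let ?q = "\<lambda>n. (6 * real n - 3 * real m - 2) * (6 * real n - 3 * real m - 1)"
  have "(\<lambda>n. (6 * real n) ^ 2 / ?q n) \<longlonglongrightarrow> 1"
    by real_asymp
  from tendsto_mult[OF Suc this]
  have "(\<lambda>n. (6 * real n) ^ (2 * m) * count3 (2 * n - m) / count3 (2 * n) * ((6 * real n) ^ 2 / ?q n)) \<longlonglongrightarrow> 1"
    by simp
  moreover have "\<forall>\<^sub>F n in sequentially. (6 * real n) ^ (2 * m) * count3 (2 * n - m) / count3 (2 * n) * ((6 * real n) ^ 2 / ?q n)
      = (6 * real n) ^ (2 * Suc m) * count3 (2 * n - Suc m) / count3 (2 * n)"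
    using eventually_ge_at_top[of "Suc m"]
  proof eventually_elim
    case (elim n)
    then have "count3 (2 * n - m) = count3 (2 * n - Suc m) * ((3 * (2 * n - Suc m) + 1) * (3 * (2 * n - Suc m) + 2))"
      by (subst Suc_diff_Suc[symmetric]) (auto simp: count3_def)
    moreover have "real (3 * (2 * n - Suc m) + 1) = 6 * real n - 3 * real m - 2"
      "real (3 * (2 * n - Suc m) + 2) = 6 * real n - 3 * real m - 1"
      using elim by (simp_all add: of_nat_diff)
    ultimately have *: "real (count3 (2 * n - m)) = real (count3 (2 * n - Suc m)) * ?q n"
      by (simp only: of_nat_mult)
    have "?q n \<noteq> 0"
      using elim by simp
    then show ?case
      unfolding * by (simp add: power_add power2_eq_square)
  qed
  ultimately show ?case
    by (rule Lim_transform_eventually)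
qed

lemma tendsto_falling: "(\<lambda>n. real (\<Prod>i<c. 6 * n - i) / (6 * real n) ^ c) \<longlonglongrightarrow> 1"
proof (induction c)
  case (Suc c)
  have "(\<lambda>n. (6 * real n - real c) / (6 * real n)) \<longlonglongrightarrow> 1"
    by real_asymp
  from tendsto_mult[OF Suc this]
  have "(\<lambda>n. real (\<Prod>i<c. 6 * n - i) / (6 * real n) ^ c * ((6 * real n - real c) / (6 * real n))) \<longlonglongrightarrow> 1"
    by simp
  moreover have "\<forall>\<^sub>F n in sequentially. real (\<Prod>i<c. 6 * n - i) / (6 * real n) ^ c * ((6 * real n - real c) / (6 * real n))
    = real (\<Prod>i<Suc c. 6 * n - i) / (6 * real n) ^ Suc c"
    using eventually_ge_at_top[of "Suc c"]
    by eventually_elim (simp add: of_nat_diff algebra_simps)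
  ultimately show ?case
    by (rule Lim_transform_eventually)
qed simp

text \<open>The injections contribute the order \<open>3m\<close> in \<open>6n\<close>, prescribing
  \<open>s\<close> costs \<open>a\<close> and prescribing \<open>t\<close> costs \<open>2m\<close>;
  the total order is \<open>m - a\<close>.\<close>

lemma tendsto_pattern:
  assumes "m \<le> a"
  shows "(\<lambda>n. real ((\<Prod>i<3 * m. 6 * n - i) * (count2 (3 * n - a) * count3 (2 * n - m))) /
      real (count2 (3 * n) * count3 (2 * n))) \<longlonglongrightarrow> (if m = a then 1 else 0)"
proof -
  obtain d where d: "a = m + d" using assms by (auto simp: le_iff_add)
  have inv: "(\<lambda>n. (1 / (6 * real n)) ^ d) \<longlonglongrightarrow> (if m = a then 1 else 0)"
  proof -
    have "(\<lambda>n. 1 / (6 * real n)) \<longlonglongrightarrow> 0" by real_asymp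
    from tendsto_power[OF this, of d] show ?thesis
      using d by (auto simp: power_0_left)
  qed
  have "(\<lambda>n. real (\<Prod>i<3 * m. 6 * n - i) / (6 * real n) ^ (3 * m) *
      ((6 * real n) ^ a * count2 (3 * n - a) / count2 (3 * n)) *
      ((6 * real n) ^ (2 * m) * count3 (2 * n - m) / count3 (2 * n)) * (1 / (6 * real n)) ^ d)
      \<longlonglongrightarrow> 1 * 1 * 1 * (if m = a then 1 else 0)"
    by (intro tendsto_mult tendsto_falling tendsto_count2 tendsto_count3 inv)
  then have lim: "(\<lambda>n. real (\<Prod>i<3 * m. 6 * n - i) / (6 * real n) ^ (3 * m) *
      ((6 * real n) ^ a * count2 (3 * n - a) / count2 (3 * n)) *
      ((6 * real n) ^ (2 * m) * count3 (2 * n - m) / count3 (2 * n)) * (1 / (6 * real n)) ^ d)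
      \<longlonglongrightarrow> (if m = a then 1 else 0)"
    by simp
  moreover have "\<forall>\<^sub>F n in sequentially. real (\<Prod>i<3 * m. 6 * n - i) / (6 * real n) ^ (3 * m) *
      ((6 * real n) ^ a * count2 (3 * n - a) / count2 (3 * n)) *
      ((6 * real n) ^ (2 * m) * count3 (2 * n - m) / count3 (2 * n)) * (1 / (6 * real n)) ^ d
      = real ((\<Prod>i<3 * m. 6 * n - i) * (count2 (3 * n - a) * count3 (2 * n - m))) /
      real (count2 (3 * n) * count3 (2 * n))"
    using eventually_gt_at_top[of 0]
  proof eventually_elim
    case (elim n)
    define z where "z = 6 * real n"
    have "z \<noteq> 0" using elim by (simp add: z_def)
    have "z ^ a * z ^ (2 * m) = z ^ (3 * m) * z ^ d"
      by (simp add: d power_add[symmetric])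
    then have "F / z ^ (3 * m) * (z ^ a * c / c') * (z ^ (2 * m) * b / b') * (1 / z) ^ d = F * (c * b) / (c' * b')"
      for F c c' b b' :: real
      using \<open>z \<noteq> 0\<close> by (simp add: field_simps power_divide)
    then show ?case
      unfolding z_def[symmetric] of_nat_mult .
  qed
  ultimately show ?thesis
    by (rule Lim_transform_eventually)
qed

section \<open>The limit of the expected number of fixed points\<close>

context cyclic_word begin

text \<open>A walk through \<open>k\<close> distinct cycles, whose points are the corner indices
  themselves. It realises the pattern without proper coincidences, which yields the lower bound 1
  for the limit.\<close>

lemma trivial_pattern:
  obtains \<omega> where "\<omega> \<in> closed_walks {..<6 * k}" "pattern \<omega> = periodic_pattern k"
proof -
  define U where "U = {..<3 * k}"
  define P where "P = {p \<in> U. p mod 3 = 0 \<or> p mod 3 = e (p div 3)}"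
  define t0 where "t0 p = (if p \<in> U then if p mod 3 = 2 then p - 2 else p + 1 else p)" for p
  \<comment> \<open>\<open>s0\<close> exchanges the exit of each cycle with the entry of the next
    one, cyclically. Adding \<open>k - 1\<close> modulo \<open>k\<close> stands for subtracting 1,
    which would fail at 0.\<close>
  define s0 where "s0 p = (if p \<in> P then
      if p mod 3 = 0 then let j = (p div 3 + (k - 1)) mod k in 3 * j + e j
      else 3 * ((p div 3 + 1) mod k) else p)" for p
  have e_lt: "e j < 3" "e j > 0" for j
    using e_range[of j] by auto
  have U3: "3 * j + a \<in> U \<longleftrightarrow> j < k" if "a < 3" for j a
    using that by (auto simp: U_def)
  have t0: "t0 (3 * j) = 3 * j + 1" "t0 (3 * j + 1) = 3 * j + 2" "t0 (3 * j + 2) = 3 * j" if "j < k" for j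
    using that U3[of 0 j] U3[of 1 j] U3[of 2 j] corner_index(3)[of 1 j] corner_index(3)[of 2 j]
    by (simp_all add: t0_def)
  have split3: "\<exists>j. p = 3 * j \<or> p = 3 * j + 1 \<or> p = 3 * j + 2" for p :: nat
    by presburger
  have "t0 \<in> fpf_perms 3 U"
  proof (rule fpf_permsI)
    fix p
    show "(t0 ^^ 3) p = p"
    proof (cases "p \<in> U")
      case True
      obtain j where j: "p = 3 * j \<or> p = 3 * j + 1 \<or> p = 3 * j + 2" using split3 by blast
      with True have "j < k" by (auto simp: U_def)
      then show ?thesis using j t0[of j] by (auto simp: numeral_3_eq_3)
    qed (simp add: t0_def numeral_3_eq_3)
    show "p \<notin> U \<Longrightarrow> t0 p = p" by (simp add: t0_def)
    show "p \<in> U \<Longrightarrow> t0 p \<noteq> p"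
      by (auto simp: t0_def)
  qed simp
  have P1: "3 * j \<in> P" "3 * j + e j \<in> P" if "j < k" for j
    using that e_lt[of j] U3[of 0 j] U3[of "e j" j] by (simp_all add: P_def corner_index)
  have P2: "\<exists>j<k. p = 3 * j \<or> p = 3 * j + e j" if p: "p \<in> P" for p
  proof (intro exI conjI)
    show "p div 3 < k" using p by (auto simp: P_def U_def)
    have "p mod 3 = 0 \<or> p mod 3 = e (p div 3)"
      using p by (simp add: P_def)
    then show "p = 3 * (p div 3) \<or> p = 3 * (p div 3) + e (p div 3)"
      using mult_div_mod_eq[of 3 p] by (metis add_0_right)
  qed
  define pre where "pre j = (j + (k - 1)) mod k" for j
  have pre: "(pre j + 1) mod k = j" "pre ((j + 1) mod k) = j" "pre j < k" if "j < k" for j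
    using that k_pos unfolding pre_def mod_add_left_eq by simp_all
  have s0: "s0 (3 * j) = 3 * pre j + e (pre j)" "s0 (3 * j + e j) = 3 * ((j + 1) mod k)" if "j < k" for j
    using P1[OF that] e_lt[of j] by (simp_all add: s0_def pre_def Let_def corner_index)
  have "s0 \<in> fpf_perms 2 P"
  proof (rule fpf_permsI)
    fix p
    show "(s0 ^^ 2) p = p"
    proof (cases "p \<in> P")
      case True
      from P2[OF this] obtain j where j: "j < k" "p = 3 * j \<or> p = 3 * j + e j" by blast
      then show ?thesis
        using s0[OF j(1)] s0(1)[of "(j + 1) mod k"] s0(2)[of "pre j"] pre[OF j(1)] k_pos
        by (auto simp: numeral_2_eq_2)
    qed (simp add: s0_def numeral_2_eq_2)
    show "p \<notin> P \<Longrightarrow> s0 p = p" by (simp add: s0_def)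
    show "s0 p \<noteq> p" if "p \<in> P"
    proof
      assume eq: "s0 p = p"
      from P2[OF that] obtain j where j: "j < k" "p = 3 * j \<or> p = 3 * j + e j" by blast
      then have "3 * pre j + e (pre j) = 3 * j \<or> 3 * ((j + 1) mod k) = 3 * j + e j"
        using s0[OF j(1)] eq by auto
      moreover have "3 * y + b \<noteq> 3 * z" if "0 < b" "b < 3" for y b z :: nat
        using that by presburger
      ultimately show False
        using e_lt[of j] e_lt[of "pre j"] by metis
    qed
  qed simp
  have sub: "P \<subseteq> {..<6 * k}" "U \<subseteq> {..<6 * k}" and fin: "finite P" "finite U"
    by (auto simp: P_def U_def)
  obtain a where a: "card P = 2 * a"
    using even_card_fpf_perms_2[OF fin(1) \<open>s0 \<in> _\<close>] by blast
  \<comment> \<open>Among \<open>6 * k\<close> points an even number lies outside \<open>P\<close>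
    and a multiple of 3 outside \<open>U\<close>, so both partial permutations extend;
    \<open>3 * k\<close> itself may be odd.\<close>
  have "card ({..<6 * k} - P) = 2 * (3 * k - a)" "card ({..<6 * k} - U) = 3 * k"
    using sub fin a by (simp_all add: card_Diff_subset U_def)
  then have "card (fpf_perms 2 ({..<6 * k} - P)) > 0" "card (fpf_perms 3 ({..<6 * k} - U)) > 0"
    using card_fpf_perms_2[of "{..<6 * k} - P" "3 * k - a"] card_fpf_perms_3[of "{..<6 * k} - U" k] count_pos
    by simp_all
  then have "{r \<in> fpf_perms 2 {..<6 * k}. \<forall>p\<in>P. r p = s0 p} \<noteq> {}"
      "{r \<in> fpf_perms 3 {..<6 * k}. \<forall>p\<in>U. r p = t0 p} \<noteq> {}"
    using card_fpf_perms_extending[OF _ sub(1) \<open>s0 \<in> _\<close>] card_fpf_perms_extending[OF _ sub(2) \<open>t0 \<in> _\<close>]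
    by (metis card.empty less_irrefl zero_less_numeral)+
  then obtain s t where s: "s \<in> fpf_perms 2 {..<6 * k}" "\<And>p. p \<in> P \<Longrightarrow> s p = s0 p"
      and t: "t \<in> fpf_perms 3 {..<6 * k}" "\<And>p. p \<in> U \<Longrightarrow> t p = t0 p"
    by blast
  have t_pow: "(t ^^ a) (3 * j) = 3 * j + a" if "j < k" "a < 3" for j a
  proof -
    have "t (3 * j) = 3 * j + 1" "t (3 * j + 1) = 3 * j + 2"
      using t(2) t0[OF that(1)] U3[of 0 j] U3[of 1 j] that by auto
    then show ?thesis
      using nat_lt_3_cases[OF that(2)] by (auto simp: numeral_2_eq_2)
  qed
  have walk: "walk s t 0 j = 3 * (j mod k)" for j
  proof (induction j)
    case (Suc j)
    have jk: "j mod k < k" using k_pos by simp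
    have "walk s t 0 (Suc j) = s (3 * (j mod k) + e (j mod k))"
      using Suc t_pow[OF jk e_lt(1)] by (simp add: e_mod)
    also have "\<dots> = 3 * (Suc j mod k)"
      using s(2)[OF P1(2)[OF jk]] s0(2)[OF jk] by (simp add: mod_simps)
    finally show ?case .
  qed simp
  have corner: "corner (s, t, 0) p = p" if "p < 3 * k" for p
    using that t_pow[of "p div 3" "p mod 3"] walk[of "p div 3"] by (simp add: less_mult_imp_div_less mult.commute)
  have "(s, t, 0) \<in> closed_walks {..<6 * k}"
    using s t walk[of k] k_pos by (simp add: closed_walks_def)
  moreover have "pattern (s, t, 0) = periodic_pattern k"
  proof -
    have iff: "p mod 3 = q mod 3 \<and> p div 3 mod k = q div 3 mod k \<longleftrightarrow> p = q" if "p < 3 * k" "q < 3 * k" for p q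
    proof -
      have "p div 3 < k" "q div 3 < k" using that by auto
      then show ?thesis
        using mult_div_mod_eq[of 3 p] mult_div_mod_eq[of 3 q]
          mod_less[of "p div 3" k] mod_less[of "q div 3" k] by metis
    qed
    show ?thesis
      by (auto simp: pattern_def periodic_pattern_def corner intro: iff[THEN iffD1] simp del: corner.simps)
  qed
  ultimately show ?thesis by (rule that)
qed

lemma finite_closed_walks: "finite S \<Longrightarrow> finite (closed_walks S)"
  by (rule finite_subset[of _ "fpf_perms 2 S \<times> fpf_perms 3 S \<times> S"])
    (auto simp: closed_walks_def finite_fpf_perms)

text \<open>The counts depend only on \<open>m\<close> and \<open>a\<close>, so any one walk
  realising the pattern, on whatever set, decides whether it survives. A pattern that is never
  realised contributes 0.\<close>

lemma pattern_limit:
  fixes r :: "(nat \<times> nat) set"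
  obtains v :: nat where
    "(\<lambda>n. real (card {\<omega> \<in> closed_walks {1..6 * n}. pattern \<omega> = r}) / real (count2 (3 * n) * count3 (2 * n))) \<longlonglongrightarrow> real v"
    "v = 0 \<or> v = 1 \<and> (\<exists>d>0. d dvd k \<and> r = periodic_pattern d \<and> (\<forall>j. e (j + d) = e j))"
    "r = periodic_pattern k \<Longrightarrow> v = 1"
proof (cases "\<exists>S :: nat set. \<exists>\<omega>\<in>closed_walks S. pattern \<omega> = r")
  case False
  have "r \<noteq> periodic_pattern k"
    using False trivial_pattern by metis
  moreover have empty: "{\<omega> \<in> closed_walks {1..6 * n}. pattern \<omega> = r} = {}" for n :: nat
    using False by blast
  have "(\<lambda>n. real (card {\<omega> \<in> closed_walks {1..6 * n}. pattern \<omega> = r}) /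
      real (count2 (3 * n) * count3 (2 * n))) \<longlonglongrightarrow> real 0"
    by (simp only: empty card.empty of_nat_0 div_0 tendsto_const)
  ultimately show ?thesis
    using that[of 0] by blast
next
  case True
  then obtain S :: "nat set" and s t x where \<omega>: "(s, t, x) \<in> closed_walks S" "pattern (s, t, x) = r"
    by auto
  interpret closed_walk k e S s t x
    using \<omega> by unfold_locales (auto simp: closed_walks_def)
  obtain m a where ma: "card corners = 3 * m" "card ports = 2 * a" "m \<le> a"
    "m = a \<longrightarrow> (\<forall>i j. Y j \<in> orb (Y i) \<longrightarrow> {Y i, Z i} = {Y j, Z j})"
    by (rule card_corners_ports)
  have "card {\<omega> \<in> closed_walks {1..6 * n}. pattern \<omega> = r} =
      (\<Prod>i<3 * m. 6 * n - i) * (count2 (3 * n - a) * count3 (2 * n - m))" for n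
    using card_same_pattern[OF _ _ ma(1,2), of "{1..6 * n}" n] \<omega>(2) by simp
  then have lim: "(\<lambda>n. real (card {\<omega> \<in> closed_walks {1..6 * n}. pattern \<omega> = r}) / real (count2 (3 * n) * count3 (2 * n)))
      \<longlonglongrightarrow> (if m = a then 1 else 0)"
    using tendsto_pattern[OF ma(3)] by presburger
  show ?thesis
  proof (rule that[of "if m = a then 1 else 0"])
    show "(\<lambda>n. real (card {\<omega> \<in> closed_walks {1..6 * n}. pattern \<omega> = r}) / real (count2 (3 * n) * count3 (2 * n)))
      \<longlonglongrightarrow> real (if m = a then 1 else 0)"
      using lim by (cases "m = a") simp_all
    have "\<exists>d>0. d dvd k \<and> r = periodic_pattern d \<and> (\<forall>j. e (j + d) = e j)" if "m = a"
    proof -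
      have "{Y i, Z i} = {Y j, Z j}" if "Y j \<in> orb (Y i)" for i j
        using ma(4) \<open>m = a\<close> that by blast
      from pattern_periodic[OF this] show ?thesis
        using \<omega>(2) by metis
    qed
    then show "(if m = a then 1 else 0) = 0 \<or> (if m = a then 1 else 0) = (1::nat) \<and>
      (\<exists>d>0. d dvd k \<and> r = periodic_pattern d \<and> (\<forall>j. e (j + d) = e j))"
      by auto
    \<comment> \<open>Distinct corners give \<open>m = k\<close>, while \<open>k\<close> entries and
      \<open>k\<close> exits give \<open>a \<le> k\<close>; with \<open>m \<le> a\<close> equality
      follows.\<close>
    show "(if m = a then 1 else 0) = (1::nat)" if r: "r = periodic_pattern k"
    proof -
      have inj: "p = q" if "p < 3 * k" "q < 3 * k" "corner (s, t, x) p = corner (s, t, x) q" for p q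
      proof -
        have "(p, q) \<in> periodic_pattern k"
          using that \<omega>(2) r by (auto simp: pattern_def simp del: corner.simps)
        then have "p mod 3 = q mod 3" "p div 3 = q div 3"
          using that by (auto simp: periodic_pattern_def less_mult_imp_div_less mult.commute)
        then show ?thesis
          by (metis mult_div_mod_eq)
      qed
      have "card corners = 3 * k"
        unfolding corners_def by (subst card_image) (auto simp: inj_on_def inj simp del: corner.simps)
      moreover have "card ports \<le> 2 * k"
      proof -
        have "card ports \<le> card (Y ` {..<k}) + card (Z ` {..<k})"
          unfolding ports_def by (rule card_Un_le)
        also have "\<dots> \<le> k + k"
          using card_image_le[of "{..<k}" Y] card_image_le[of "{..<k}" Z] by (intro add_mono) auto
        finally show ?thesis by simp
      qed
      ultimately show ?thesis
        using ma by simp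
    qed
  qed
qed

text \<open>\<open>L\<close> is the number of surviving patterns. They lie among the
  \<open>k\<close> relations \<open>periodic_pattern d\<close>, and \<open>d = k\<close> always
  survives; any further one exhibits a proper period.\<close>

theorem closed_walks_limit:
  obtains L :: nat where
    "(\<lambda>n. real (card (closed_walks {1..6 * n})) / real (count2 (3 * n) * count3 (2 * n))) \<longlonglongrightarrow> real L"
    "1 \<le> L" "L \<le> k" "L \<noteq> 1 \<Longrightarrow> \<exists>d. 0 < d \<and> d < k \<and> d dvd k \<and> (\<forall>j. e (j + d) = e j)"
proof -
  define R where "R = Pow ({..<3 * k} \<times> {..<3 * k})"
  define w where "w r = (\<lambda>n. real (card {\<omega> \<in> closed_walks {1..6 * n}. pattern \<omega> = r}) /
    real (count2 (3 * n) * count3 (2 * n)))" for r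
  define Q where "Q r v \<longleftrightarrow> w r \<longlonglongrightarrow> real v \<and>
    (v = 0 \<or> v = 1 \<and> (\<exists>d>0. d dvd k \<and> r = periodic_pattern d \<and> (\<forall>j. e (j + d) = e j))) \<and>
    (r = periodic_pattern k \<longrightarrow> v = 1)" for r v
  have "\<exists>v. Q r v" for r
    using pattern_limit[of r "\<exists>v. Q r v"] unfolding Q_def w_def by blast
  then have "\<exists>v. \<forall>r. Q r (v r)"
    by (intro choice allI)
  then obtain v where "\<And>r. Q r (v r)"
    by blast
  then have v: "\<And>r. w r \<longlonglongrightarrow> real (v r)"
    "\<And>r. v r = 0 \<or> v r = 1 \<and> (\<exists>d>0. d dvd k \<and> r = periodic_pattern d \<and> (\<forall>j. e (j + d) = e j))"
    "v (periodic_pattern k) = 1"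
    unfolding Q_def by blast+
  have finR: "finite R" by (simp add: R_def)
  have pk: "periodic_pattern k \<in> R"
    by (auto simp: R_def periodic_pattern_def)
  have "(\<lambda>n. \<Sum>r\<in>R. w r n) \<longlonglongrightarrow> (\<Sum>r\<in>R. real (v r))"
    by (intro tendsto_sum v)
  moreover have "(\<Sum>r\<in>R. w r n) = real (card (closed_walks {1..6 * n})) / real (count2 (3 * n) * count3 (2 * n))" for n
  proof -
    have "pattern \<omega> \<in> R" for \<omega> :: "(nat \<Rightarrow> nat) \<times> (nat \<Rightarrow> nat) \<times> nat"
      by (auto simp: R_def pattern_def)
    then have "closed_walks {1..6 * n} = (\<Union>r\<in>R. {\<omega> \<in> closed_walks {1..6 * n}. pattern \<omega> = r})"
      by blast
    then have "card (closed_walks {1..6 * n}) = card (\<Union>r\<in>R. {\<omega> \<in> closed_walks {1..6 * n}. pattern \<omega> = r})"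
      by (rule arg_cong)
    also have "\<dots> = (\<Sum>r\<in>R. card {\<omega> \<in> closed_walks {1..6 * n}. pattern \<omega> = r})"
      by (rule card_UN_disjoint) (use finR finite_closed_walks[of "{1..6 * n}"] in auto)
    finally show ?thesis
      by (simp add: w_def sum_divide_distrib)
  qed
  ultimately have "(\<lambda>n. real (card (closed_walks {1..6 * n})) / real (count2 (3 * n) * count3 (2 * n))) \<longlonglongrightarrow> real (\<Sum>r\<in>R. v r)"
    by simp
  moreover have "1 \<le> (\<Sum>r\<in>R. v r)"
    using member_le_sum[OF pk, of v] finR v(3) by simp
  moreover have "(\<Sum>r\<in>R. v r) \<le> k"
  proof -
    have "(\<Sum>r\<in>R. v r) = (\<Sum>r\<in>{r\<in>R. v r = 1}. v r)"
    proof (rule sum.mono_neutral_right[OF finR])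
      show "\<forall>r\<in>R - {r \<in> R. v r = 1}. v r = 0"
        using v(2) by blast
    qed auto
    also have "\<dots> = card {r\<in>R. v r = 1}"
      by simp
    also have "\<dots> \<le> card (periodic_pattern ` {1..k})"
    proof (rule card_mono)
      show "{r \<in> R. v r = 1} \<subseteq> periodic_pattern ` {1..k}"
      proof
        fix r assume "r \<in> {r \<in> R. v r = 1}"
        then obtain d where "d > 0" "d dvd k" "r = periodic_pattern d"
          using v(2)[of r] by auto
        then show "r \<in> periodic_pattern ` {1..k}"
          using dvd_imp_le[OF _ k_pos, of d] by auto
      qed
    qed simp
    also have "\<dots> \<le> k"
      using card_image_le[of "{1..k}" periodic_pattern] by simp
    finally show ?thesis .
  qed
  moreover have "\<exists>d. 0 < d \<and> d < k \<and> d dvd k \<and> (\<forall>j. e (j + d) = e j)" if "(\<Sum>r\<in>R. v r) \<noteq> 1"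
  proof -
    have "(\<Sum>r\<in>R. v r) = v (periodic_pattern k) + (\<Sum>r\<in>R - {periodic_pattern k}. v r)"
      using finR pk by (rule sum.remove)
    then have "(\<Sum>r\<in>R - {periodic_pattern k}. v r) \<noteq> 0"
      using that v(3) by simp
    then obtain r where r: "r \<in> R - {periodic_pattern k}" "v r \<noteq> 0"
      by (rule sum.not_neutral_contains_not_neutral)
    have "\<exists>d>0. d dvd k \<and> r = periodic_pattern d \<and> (\<forall>j. e (j + d) = e j)"
      using v(2)[of r] r(2) by (elim disjE conjE) simp_all
    then obtain d where d: "d > 0" "d dvd k" "r = periodic_pattern d" "\<forall>j. e (j + d) = e j"
      by (elim exE conjE)
    have "d \<le> k"
      using d(2) k_pos by (rule dvd_imp_le)
    moreover have "d \<noteq> k"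
      using d(3) r(1) by blast
    ultimately have "d < k"
      by simp
    then show ?thesis
      using d by (intro exI[of _ d] conjI)
  qed
  ultimately show ?thesis by (rule that)
qed

end

section \<open>The left regular representation\<close>

lemma (in group) inv_mult_cancel_left: "g \<in> carrier G \<Longrightarrow> x \<in> carrier G \<Longrightarrow> inv g \<otimes> (g \<otimes> x) = x"
  and mult_inv_cancel_left: "g \<in> carrier G \<Longrightarrow> x \<in> carrier G \<Longrightarrow> g \<otimes> (inv g \<otimes> x) = x"
  by (simp_all add: m_assoc[symmetric])

lemma (in group) bij_betw_mult_left: "g \<in> carrier G \<Longrightarrow> bij_betw (\<lambda>x. g \<otimes> x) (carrier G) (carrier G)"
  by (rule bij_betw_byWitness[where f' = "\<lambda>x. inv g \<otimes> x"])
    (auto simp: inv_mult_cancel_left mult_inv_cancel_left)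

lemma has_sum_finite_sum:
  fixes f :: "'i \<Rightarrow> 'b \<Rightarrow> real"
  assumes "finite F" "\<And>i. i \<in> F \<Longrightarrow> (f i has_sum S i) A"
  shows "((\<lambda>x. \<Sum>i\<in>F. f i x) has_sum (\<Sum>i\<in>F. S i)) A"
  using assms by (induction F rule: finite_induct) (simp_all add: has_sum_add)

locale ga_element = group G for G (structure) +
  fixes \<alpha> :: "'a \<Rightarrow> complex"
  assumes \<alpha>: "\<alpha> \<in> carrier (group_algebra G)"
begin

abbreviation supp where "supp \<equiv> {g. \<alpha> g \<noteq> 0}"
abbreviation T where "T \<equiv> left_reg_alg G \<alpha>"
abbreviation \<kappa> where "\<kappa> \<equiv> l2_opnorm G T"
abbreviation fin_supp where "fin_supp \<equiv> carrier (group_algebra G)"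

definition \<delta> :: "'a \<Rightarrow> 'a \<Rightarrow> complex" where "\<delta> s = (\<lambda>x. if x = s then 1 else 0)"

lemma finite_supp: "finite supp" and supp_carrier: "g \<in> supp \<Longrightarrow> g \<in> carrier G" "\<alpha> g \<noteq> 0 \<Longrightarrow> g \<in> carrier G"
  using \<alpha> by (auto simp: group_algebra_def)

lemma fin_supp_iff: "f \<in> fin_supp \<longleftrightarrow> finite {x. f x \<noteq> 0} \<and> {x. f x \<noteq> 0} \<subseteq> carrier G"
  by (auto simp: group_algebra_def)

lemma T_eq: "T f x = (if x \<in> carrier G then \<Sum>g\<in>supp. \<alpha> g * f (inv g \<otimes> x) else 0)"
  by (simp add: left_reg_alg_def left_reg_def)

lemma T_fin_supp: "f \<in> fin_supp \<Longrightarrow> T f \<in> fin_supp"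
proof -
  assume f: "f \<in> fin_supp"
  have "{x. T f x \<noteq> 0} \<subseteq> (\<lambda>(g, x). g \<otimes> x) ` (supp \<times> {x. f x \<noteq> 0})"
  proof
    fix x assume "x \<in> {x. T f x \<noteq> 0}"
    then have x: "x \<in> carrier G" "(\<Sum>g\<in>supp. \<alpha> g * f (inv g \<otimes> x)) \<noteq> 0"
      by (auto simp: T_eq split: if_splits)
    then obtain g where "g \<in> supp" "\<alpha> g * f (inv g \<otimes> x) \<noteq> 0"
      using sum.not_neutral_contains_not_neutral by meson
    then show "x \<in> (\<lambda>(g, x). g \<otimes> x) ` (supp \<times> {x. f x \<noteq> 0})"
      using x(1) supp_carrier by (intro image_eqI[of _ _ "(g, inv g \<otimes> x)"]) (auto simp: mult_inv_cancel_left)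
  qed
  moreover have "finite ((\<lambda>(g, x). g \<otimes> x) ` (supp \<times> {x. f x \<noteq> 0}))"
    using finite_supp f by (auto simp: fin_supp_iff)
  ultimately show ?thesis
    by (auto simp: fin_supp_iff T_eq dest: finite_subset split: if_splits)
qed

lemma \<delta>_fin_supp: "s \<in> carrier G \<Longrightarrow> \<delta> s \<in> fin_supp"
  by (auto simp: fin_supp_iff \<delta>_def)

lemma fin_supp_summable:
  assumes "f \<in> fin_supp"
  shows "(\<lambda>x. (cmod (f x))\<^sup>2) summable_on carrier G"
proof -
  have "(\<lambda>x. (cmod (f x))\<^sup>2) summable_on {x. f x \<noteq> 0}"
    using assms by (intro summable_on_finite) (auto simp: fin_supp_iff)
  then show ?thesis
    by (rule summable_on_cong_neutral[THEN iffD1, rotated -1]) (use assms in \<open>auto simp: fin_supp_iff\<close>)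
qed

lemma fin_supp_l2: "f \<in> fin_supp \<Longrightarrow> f \<in> l2_space G"
  using fin_supp_summable by (auto simp: l2_space_def fin_supp_iff)

lemma l2_norm_sq: "(l2_norm G f)\<^sup>2 = (\<Sum>\<^sub>\<infinity>x\<in>carrier G. (cmod (f x))\<^sup>2)"
  by (simp add: l2_norm_def infsum_nonneg)

lemma l2_norm_nonneg: "l2_norm G f \<ge> 0"
  by (simp add: l2_norm_def infsum_nonneg)

lemma sum_le_l2_norm_sq:
  assumes "f \<in> fin_supp" "finite I" "inj_on \<phi> I" "\<phi> ` I \<subseteq> carrier G"
  shows "(\<Sum>i\<in>I. (cmod (f (\<phi> i)))\<^sup>2) \<le> (l2_norm G f)\<^sup>2"
proof -
  have "(\<Sum>i\<in>I. (cmod (f (\<phi> i)))\<^sup>2) = (\<Sum>x\<in>\<phi> ` I. (cmod (f x))\<^sup>2)"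
    using assms(3) by (simp add: sum.reindex)
  also have "\<dots> \<le> (\<Sum>\<^sub>\<infinity>x\<in>carrier G. (cmod (f x))\<^sup>2)"
    by (rule finite_sum_le_infsum[OF fin_supp_summable]) (use assms in auto)
  finally show ?thesis
    by (simp add: l2_norm_sq)
qed

lemma cmod_le_l2_norm: "f \<in> fin_supp \<Longrightarrow> x \<in> carrier G \<Longrightarrow> cmod (f x) \<le> l2_norm G f"
  using sum_le_l2_norm_sq[of f "{x}" id] l2_norm_nonneg[of f] by (simp add: power2_le_iff_abs_le)

text \<open>A crude bound whose only purpose is that the supremum defining the operator norm is
  taken over a bounded set.\<close>

lemma T_l2_bound:
  assumes f: "f \<in> l2_space G"
  shows "(l2_norm G (T f))\<^sup>2 \<le> (\<Sum>g\<in>supp. (cmod (\<alpha> g))\<^sup>2) * (card supp * (l2_norm G f)\<^sup>2)"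
proof -
  let ?C = "\<Sum>g\<in>supp. (cmod (\<alpha> g))\<^sup>2"
  let ?F = "\<lambda>x. (cmod (f x))\<^sup>2"
  have sum_f: "?F summable_on carrier G"
    using f by (simp add: l2_space_def)
  have bij: "bij_betw (\<lambda>x. inv g \<otimes> x) (carrier G) (carrier G)" if "g \<in> supp" for g
    using that supp_carrier by (intro bij_betw_mult_left) auto
  have has_sum_g: "((\<lambda>x. ?F (inv g \<otimes> x)) has_sum (l2_norm G f)\<^sup>2) (carrier G)" if "g \<in> supp" for g
    using has_sum_reindex_bij_betw[OF bij[OF that], of ?F] has_sum_infsum[OF sum_f] by (simp add: l2_norm_sq)
  have has_sum: "((\<lambda>x. ?C * (\<Sum>g\<in>supp. ?F (inv g \<otimes> x))) has_sum ?C * (\<Sum>g\<in>supp. (l2_norm G f)\<^sup>2)) (carrier G)"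
    by (intro has_sum_cmult_right has_sum_finite_sum finite_supp has_sum_g)
  have le: "(cmod (T f x))\<^sup>2 \<le> ?C * (\<Sum>g\<in>supp. ?F (inv g \<otimes> x))" if "x \<in> carrier G" for x
  proof -
    have "cmod (T f x) \<le> (\<Sum>g\<in>supp. cmod (\<alpha> g) * cmod (f (inv g \<otimes> x)))"
      using that by (auto simp: T_eq norm_mult intro!: sum_norm_le)
    then have "(cmod (T f x))\<^sup>2 \<le> (\<Sum>g\<in>supp. cmod (\<alpha> g) * cmod (f (inv g \<otimes> x)))\<^sup>2"
      by (intro power_mono) auto
    also have "\<dots> \<le> ?C * (\<Sum>g\<in>supp. ?F (inv g \<otimes> x))"
      by (rule Cauchy_Schwarz_ineq_sum)
    finally show ?thesis .
  qed
  have sum_r: "(\<lambda>x. ?C * (\<Sum>g\<in>supp. ?F (inv g \<otimes> x))) summable_on carrier G"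
    using has_sum by (rule has_sum_imp_summable)
  have "(l2_norm G (T f))\<^sup>2 \<le> (\<Sum>\<^sub>\<infinity>x\<in>carrier G. ?C * (\<Sum>g\<in>supp. ?F (inv g \<otimes> x)))"
    unfolding l2_norm_sq
    by (intro infsum_mono sum_r le summable_on_comparison_test[OF sum_r]) auto
  also have "\<dots> = ?C * (card supp * (l2_norm G f)\<^sup>2)"
    using infsumI[OF has_sum] by simp
  finally show ?thesis .
qed

lemma bdd_above_T: "bdd_above {l2_norm G (T f) | f. f \<in> l2_space G \<and> l2_norm G f \<le> 1}"
proof (rule bdd_aboveI)
  let ?K = "(\<Sum>g\<in>supp. (cmod (\<alpha> g))\<^sup>2) * card supp"
  fix y assume "y \<in> {l2_norm G (T f) | f. f \<in> l2_space G \<and> l2_norm G f \<le> 1}"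
  then obtain f where f: "y = l2_norm G (T f)" "f \<in> l2_space G" "l2_norm G f \<le> 1" by blast
  have "?K * (l2_norm G f)\<^sup>2 \<le> ?K * 1"
    using f(3) l2_norm_nonneg[of f] by (intro mult_left_mono) (auto intro!: mult_nonneg_nonneg sum_nonneg simp: power_le_one)
  then have "y\<^sup>2 \<le> ?K"
    using T_l2_bound[OF f(2)] by (simp add: f(1) mult.assoc)
  then show "y \<le> sqrt ?K"
    by (rule real_le_rsqrt)
qed

lemma \<kappa>_nonneg: "\<kappa> \<ge> 0"
proof -
  have "(\<lambda>x. 0) \<in> l2_space G" "l2_norm G (\<lambda>x. 0) = 0" "T (\<lambda>x. 0) = (\<lambda>x. 0)"
    by (auto simp: l2_space_def l2_norm_def T_eq)
  then have "0 \<in> {l2_norm G (T f) | f. f \<in> l2_space G \<and> l2_norm G f \<le> 1}"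
    by (force intro: exI[of _ "\<lambda>x. 0"])
  then show ?thesis
    unfolding l2_opnorm_def by (rule cSup_upper[OF _ bdd_above_T])
qed

lemma l2_norm_scale: "l2_norm G (\<lambda>x. c * f x) = cmod c * l2_norm G f"
  by (simp add: l2_norm_def norm_mult power_mult_distrib infsum_cmult_right' real_sqrt_mult)

lemma T_scale: "T (\<lambda>x. c * f x) = (\<lambda>x. c * T f x)"
  by (auto simp: T_eq sum_distrib_left mult_ac intro!: sum.cong)

lemma l2_norm_T:
  assumes f: "f \<in> fin_supp"
  shows "l2_norm G (T f) \<le> \<kappa> * l2_norm G f"
proof (cases "l2_norm G f = 0")
  case True
  then have "f x = 0" for x
    using cmod_le_l2_norm[OF f, of x] f by (cases "x \<in> carrier G") (auto simp: fin_supp_iff)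
  then have "T f = (\<lambda>x. 0)"
    by (auto simp: T_eq)
  then show ?thesis
    by (simp add: l2_norm_def True[unfolded l2_norm_def])
next
  case False
  let ?c = "complex_of_real (1 / l2_norm G f)"
  have pos: "l2_norm G f > 0"
    using False l2_norm_nonneg[of f] by simp
  have "(\<lambda>x. ?c * f x) \<in> fin_supp"
    using f pos by (auto simp: fin_supp_iff)
  moreover have "l2_norm G (\<lambda>x. ?c * f x) = 1"
    unfolding l2_norm_scale using pos by (simp add: norm_divide)
  ultimately have "l2_norm G (T (\<lambda>x. ?c * f x)) \<le> \<kappa>"
    unfolding l2_opnorm_def using fin_supp_l2 by (intro cSup_upper[OF _ bdd_above_T]) force
  then have "1 / l2_norm G f * l2_norm G (T f) \<le> \<kappa>"
    unfolding T_scale l2_norm_scale using pos by (simp add: norm_divide)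
  then show ?thesis
    using pos by (simp add: field_simps)
qed

section \<open>Walks that avoid a set\<close>

definition cut :: "'a set \<Rightarrow> ('a \<Rightarrow> complex) \<Rightarrow> 'a \<Rightarrow> complex" where
  "cut H f = (\<lambda>x. if x \<in> H then 0 else f x)"

definition keep :: "'a set \<Rightarrow> ('a \<Rightarrow> complex) \<Rightarrow> 'a \<Rightarrow> complex" where
  "keep H f = (\<lambda>x. if x \<in> H then f x else 0)"

text \<open>The projection off \<open>H\<close> follows \<open>T\<close>, so a walk is killed when
  it lands in \<open>H\<close> but may start there.\<close>

definition step :: "'a set \<Rightarrow> ('a \<Rightarrow> complex) \<Rightarrow> 'a \<Rightarrow> complex" where
  "step H f = cut H (T f)"

lemma step_apply: "step H f x = (if x \<in> H then 0 else T f x)"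
  by (simp add: step_def cut_def)

lemma step_Suc: "(step H ^^ Suc n) f = cut H (T ((step H ^^ n) f))"
  unfolding funpow.simps comp_apply by (rule step_def)

lemma cut_fin_supp: "f \<in> fin_supp \<Longrightarrow> cut H f \<in> fin_supp"
  by (auto simp: fin_supp_iff cut_def elim: finite_subset[rotated])

lemma l2_norm_cut:
  assumes "f \<in> fin_supp"
  shows "l2_norm G (cut H f) \<le> l2_norm G f"
  unfolding l2_norm_def
  by (intro real_sqrt_le_mono infsum_mono fin_supp_summable cut_fin_supp assms) (simp add: cut_def)

text \<open>Projections are contractions, so forbidding \<open>H\<close> costs nothing in the norm
  bound.\<close>

lemma step_pow:
  assumes "f \<in> fin_supp"
  shows "(step H ^^ n) f \<in> fin_supp \<and> l2_norm G ((step H ^^ n) f) \<le> \<kappa> ^ n * l2_norm G f"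
proof (induction n)
  case (Suc n)
  let ?g = "(step H ^^ n) f"
  have "l2_norm G ((step H ^^ Suc n) f) \<le> l2_norm G (T ?g)"
    unfolding step_Suc using Suc by (intro l2_norm_cut T_fin_supp) auto
  also have "\<dots> \<le> \<kappa> * l2_norm G ?g"
    using Suc by (intro l2_norm_T) auto
  also have "\<dots> \<le> \<kappa> * (\<kappa> ^ n * l2_norm G f)"
    using Suc \<kappa>_nonneg by (intro mult_left_mono) auto
  finally have "l2_norm G ((step H ^^ Suc n) f) \<le> \<kappa> ^ Suc n * l2_norm G f"
    by (simp only: power_Suc mult.assoc)
  then show ?case
    using Suc cut_fin_supp[OF T_fin_supp, of ?g H] unfolding step_Suc by blast
qed (use assms in simp)

lemma T_step: "T = step {}"
  by (intro ext) (simp add: step_apply)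

lemma T_pow: "f \<in> fin_supp \<Longrightarrow> (T ^^ n) f \<in> fin_supp \<and> l2_norm G ((T ^^ n) f) \<le> \<kappa> ^ n * l2_norm G f"
  using step_pow[of f n "{}"] by (simp add: T_step[symmetric])

lemma l2_norm_\<delta>: "s \<in> carrier G \<Longrightarrow> l2_norm G (\<delta> s) = 1"
proof -
  assume "s \<in> carrier G"
  then have "(\<Sum>\<^sub>\<infinity>x\<in>carrier G. (cmod (\<delta> s x))\<^sup>2) = (\<Sum>\<^sub>\<infinity>x\<in>{s}. (cmod (\<delta> s x))\<^sup>2)"
    by (intro infsum_cong_neutral) (auto simp: \<delta>_def)
  then show ?thesis
    by (simp add: l2_norm_def \<delta>_def)
qed

lemma step_sum: "step H (\<lambda>x. \<Sum>i\<in>I. c i * f i x) = (\<lambda>x. \<Sum>i\<in>I. c i * step H (f i) x)"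
proof
  fix x
  have "(\<Sum>g\<in>supp. \<alpha> g * (\<Sum>i\<in>I. c i * f i (inv g \<otimes> x))) = (\<Sum>i\<in>I. c i * (\<Sum>g\<in>supp. \<alpha> g * f i (inv g \<otimes> x)))"
    unfolding sum_distrib_left by (subst sum.swap) (simp add: mult_ac)
  then show "step H (\<lambda>x. \<Sum>i\<in>I. c i * f i x) x = (\<Sum>i\<in>I. c i * step H (f i) x)"
    by (simp add: step_def cut_def T_eq)
qed

lemma step_pow_sum: "(step H ^^ n) (\<lambda>x. \<Sum>i\<in>I. c i * f i x) = (\<lambda>x. \<Sum>i\<in>I. c i * (step H ^^ n) (f i) x)"
  by (induction n) (simp_all add: step_sum)

lemma T_pow_sum: "(T ^^ n) (\<lambda>x. \<Sum>i\<in>I. c i * f i x) = (\<lambda>x. \<Sum>i\<in>I. c i * (T ^^ n) (f i) x)"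
  using step_pow_sum[where H = "{}"] by (simp add: T_step[symmetric])

lemma step_add: "step H (\<lambda>x. f x + g x) = (\<lambda>x. step H f x + step H g x)"
  by (auto simp: step_def cut_def T_eq sum.distrib distrib_left)

lemma keep_sum: "finite H \<Longrightarrow> keep H f = (\<lambda>x. \<Sum>h\<in>H. f h * \<delta> h x)"
  by (auto simp: keep_def \<delta>_def if_distrib cong: if_cong)

text \<open>The matrix entries of \<open>T ^^ n\<close> are sums over walks with \<open>n\<close> steps in the support of \<open>\<alpha>\<close>. The
  next two identities split these walks at the last visit to \<open>H\<close> and at the first return to it.\<close>

lemma last_visit:
  "(T ^^ p) f x = (\<Sum>n\<le>p. (step H ^^ (p - n)) (keep H ((T ^^ n) f)) x) + (step H ^^ p) (cut H f) x"
proof (induction p arbitrary: x)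
  case 0
  then show ?case by (simp add: keep_def cut_def)
next
  case (Suc p)
  \<comment> \<open>The coefficient 1 gives the sum the shape required by
    \<open>step_sum\<close>.\<close>
  let ?S = "\<lambda>x. \<Sum>n\<le>p. 1 * (step H ^^ (p - n)) (keep H ((T ^^ n) f)) x"
  have "(T ^^ p) f = (\<lambda>x. ?S x + (step H ^^ p) (cut H f) x)"
    using Suc by auto
  then have "step H ((T ^^ p) f) = (\<lambda>x. step H ?S x + (step H ^^ Suc p) (cut H f) x)"
    by (simp only: step_add funpow.simps comp_apply)
  also have "step H ?S = (\<lambda>x. \<Sum>n\<le>p. 1 * step H ((step H ^^ (p - n)) (keep H ((T ^^ n) f))) x)"
    by (rule step_sum)
  finally have "step H ((T ^^ p) f) x =
      (\<Sum>n\<le>p. (step H ^^ (Suc p - n)) (keep H ((T ^^ n) f)) x) + (step H ^^ Suc p) (cut H f) x"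
    by (simp add: Suc_diff_le)
  moreover have "(T ^^ Suc p) f x = keep H ((T ^^ Suc p) f) x + step H ((T ^^ p) f) x"
    by (simp add: keep_def step_def cut_def)
  ultimately show ?case
    by simp
qed

lemma first_return:
  "(T ^^ n) f x = (step H ^^ n) f x + (\<Sum>j<n. (T ^^ (n - Suc j)) (keep H (T ((step H ^^ j) f))) x)"
proof (induction n arbitrary: x)
  case (Suc n)
  let ?S = "\<lambda>x. \<Sum>j<n. 1 * (T ^^ (n - Suc j)) (keep H (T ((step H ^^ j) f))) x"
  have "(T ^^ n) f = (\<lambda>x. (step H ^^ n) f x + ?S x)"
    using Suc by auto
  then have "T ((T ^^ n) f) = (\<lambda>x. T ((step H ^^ n) f) x + T ?S x)"
    unfolding T_step by (simp only: step_add)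
  also have "T ?S = (\<lambda>x. \<Sum>j<n. 1 * T ((T ^^ (n - Suc j)) (keep H (T ((step H ^^ j) f)))) x)"
    by (rule step_sum[of "{}", folded T_step])
  finally have "(T ^^ Suc n) f x = T ((step H ^^ n) f) x +
      (\<Sum>j<n. (T ^^ Suc (n - Suc j)) (keep H (T ((step H ^^ j) f))) x)"
    by simp
  also have "(\<Sum>j<n. (T ^^ Suc (n - Suc j)) (keep H (T ((step H ^^ j) f))) x) =
      (\<Sum>j<n. (T ^^ (Suc n - Suc j)) (keep H (T ((step H ^^ j) f))) x)"
    by (intro sum.cong refl) (simp add: Suc_diff_Suc del: funpow.simps)
  also have "T ((step H ^^ n) f) x = (step H ^^ Suc n) f x + keep H (T ((step H ^^ n) f)) x"
    by (simp add: keep_def step_def cut_def)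
  finally show ?case by simp
qed simp

text \<open>\<open>first_return\<close> is solved for the restricted entry. What remains are entries
  of powers of \<open>T\<close>, in which \<open>H\<close> appears only through starting points; the
  weight of a first return after \<open>j + 1\<close> steps is at most
  \<open>\<kappa> ^ Suc j\<close>.\<close>

lemma cmod_step_le:
  assumes H: "finite H" "H \<subseteq> carrier G" and h: "h \<in> carrier G"
  shows "cmod ((step H ^^ n) (\<delta> h) x) \<le> cmod ((T ^^ n) (\<delta> h) x) +
    (\<Sum>j<n. \<Sum>h'\<in>H. \<kappa> ^ Suc j * cmod ((T ^^ (n - Suc j)) (\<delta> h') x))"
proof -
  have ret: "cmod ((T ^^ m) (keep H (T ((step H ^^ j) (\<delta> h)))) x) \<le> (\<Sum>h'\<in>H. \<kappa> ^ Suc j * cmod ((T ^^ m) (\<delta> h') x))" for m j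
  proof -
    let ?g = "T ((step H ^^ j) (\<delta> h))"
    have sp: "(step H ^^ j) (\<delta> h) \<in> fin_supp" "l2_norm G ((step H ^^ j) (\<delta> h)) \<le> \<kappa> ^ j"
      using step_pow[OF \<delta>_fin_supp[OF h], of j H] l2_norm_\<delta>[OF h] by auto
    have g: "cmod (?g h') \<le> \<kappa> ^ Suc j" if "h' \<in> H" for h'
    proof -
      have "cmod (?g h') \<le> l2_norm G ?g"
        using that H sp by (intro cmod_le_l2_norm T_fin_supp) auto
      also have "\<dots> \<le> \<kappa> * l2_norm G ((step H ^^ j) (\<delta> h))"
        by (intro l2_norm_T sp)
      also have "\<dots> \<le> \<kappa> ^ Suc j"
        using sp(2) \<kappa>_nonneg by (simp add: mult_left_mono)
      finally show ?thesis .
    qed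
    have "(T ^^ m) (keep H ?g) x = (\<Sum>h'\<in>H. ?g h' * (T ^^ m) (\<delta> h') x)"
      unfolding keep_sum[OF H(1)] T_pow_sum ..
    then have "cmod ((T ^^ m) (keep H ?g) x) \<le> (\<Sum>h'\<in>H. cmod (?g h') * cmod ((T ^^ m) (\<delta> h') x))"
      by (simp add: norm_mult sum_norm_le)
    also have "\<dots> \<le> (\<Sum>h'\<in>H. \<kappa> ^ Suc j * cmod ((T ^^ m) (\<delta> h') x))"
      by (intro sum_mono mult_right_mono g) auto
    finally show ?thesis .
  qed
  have "(step H ^^ n) (\<delta> h) x = (T ^^ n) (\<delta> h) x -
      (\<Sum>j<n. (T ^^ (n - Suc j)) (keep H (T ((step H ^^ j) (\<delta> h)))) x)"
    using first_return[where H = H and n = n and f = "\<delta> h" and x = x] by simp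
  then have "cmod ((step H ^^ n) (\<delta> h) x) \<le> cmod ((T ^^ n) (\<delta> h) x) +
      cmod (\<Sum>j<n. (T ^^ (n - Suc j)) (keep H (T ((step H ^^ j) (\<delta> h)))) x)"
    by (simp add: norm_triangle_ineq4)
  also have "\<dots> \<le> cmod ((T ^^ n) (\<delta> h) x) +
      (\<Sum>j<n. \<Sum>h'\<in>H. \<kappa> ^ Suc j * cmod ((T ^^ (n - Suc j)) (\<delta> h') x))"
    by (intro add_left_mono sum_norm_le ret)
  finally show ?thesis .
qed

text \<open>\<open>V\<close> is a region that walks can only enter through \<open>H\<close>.\<close>

lemma step_avoids:
  assumes V: "\<And>y g. y \<in> carrier G \<Longrightarrow> y \<notin> V \<Longrightarrow> g \<in> supp \<Longrightarrow> g \<otimes> y \<in> V \<Longrightarrow> g \<otimes> y \<in> H"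
    and f: "\<And>y. y \<in> V \<Longrightarrow> f y = 0"
  shows "y \<in> V \<Longrightarrow> (step H ^^ n) f y = 0"
proof (induction n arbitrary: y)
  case (Suc n)
  show ?case
  proof (cases "y \<in> H \<or> y \<notin> carrier G")
    case False
    have "(step H ^^ n) f (inv g \<otimes> y) = 0" if "g \<in> supp" for g
    proof (rule ccontr)
      assume "(step H ^^ n) f (inv g \<otimes> y) \<noteq> 0"
      then have "inv g \<otimes> y \<notin> V" using Suc.IH by blast
      then show False
        using V[of "inv g \<otimes> y" g] that supp_carrier[of g] False Suc.prems
        by (auto simp: mult_inv_cancel_left)
    qed
    then show ?thesis
      unfolding step_Suc by (simp add: cut_def T_eq)
  next
    case True
    then show ?thesis
      unfolding step_Suc by (auto simp: cut_def T_eq)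
  qed
qed (use f in auto)

text \<open>Once the start is cut by \<open>H\<close>, nothing begins in \<open>V\<close>, and
  \<open>V\<close> can be entered only through \<open>H\<close>. So the final term of
  \<open>last_visit\<close> vanishes at \<open>x\<close>, and \<open>cmod_step_le\<close> bounds the
  others.\<close>

lemma cmod_T_pow_le:
  assumes H: "finite H" "H \<subseteq> carrier G" and s: "s \<in> carrier G"
    and V: "\<And>y g. y \<in> carrier G \<Longrightarrow> y \<notin> V \<Longrightarrow> g \<in> supp \<Longrightarrow> g \<otimes> y \<in> V \<Longrightarrow> g \<otimes> y \<in> H"
    and sx: "s \<in> V \<Longrightarrow> s \<in> H" "x \<in> V"
  shows "cmod ((T ^^ p) (\<delta> s) x) \<le> (\<Sum>n\<le>p. \<Sum>h\<in>H. cmod ((T ^^ n) (\<delta> s) h) *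
    (cmod ((T ^^ (p - n)) (\<delta> h) x) +
    (\<Sum>j<p - n. \<Sum>h'\<in>H. \<kappa> ^ Suc j * cmod ((T ^^ (p - n - Suc j)) (\<delta> h') x))))"
proof -
  have "(step H ^^ p) (cut H (\<delta> s)) x = 0"
    by (rule step_avoids[where V = V, OF V]) (use sx in \<open>auto simp: cut_def \<delta>_def\<close>)
  then have "(T ^^ p) (\<delta> s) x = (\<Sum>n\<le>p. (step H ^^ (p - n)) (keep H ((T ^^ n) (\<delta> s))) x)"
    using last_visit[where H = H and p = p and f = "\<delta> s" and x = x] by simp
  also have "\<dots> = (\<Sum>n\<le>p. \<Sum>h\<in>H. (T ^^ n) (\<delta> s) h * (step H ^^ (p - n)) (\<delta> h) x)"
    by (simp add: keep_sum[OF H(1)] step_pow_sum)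
  finally have "cmod ((T ^^ p) (\<delta> s) x) \<le>
      (\<Sum>n\<le>p. \<Sum>h\<in>H. cmod ((T ^^ n) (\<delta> s) h) * cmod ((step H ^^ (p - n)) (\<delta> h) x))"
    by (auto simp: norm_mult intro!: sum_norm_le)
  also have "\<dots> \<le> (\<Sum>n\<le>p. \<Sum>h\<in>H. cmod ((T ^^ n) (\<delta> s) h) *
    (cmod ((T ^^ (p - n)) (\<delta> h) x) +
    (\<Sum>j<p - n. \<Sum>h'\<in>H. \<kappa> ^ Suc j * cmod ((T ^^ (p - n - Suc j)) (\<delta> h') x))))"
    using H by (intro sum_mono mult_left_mono cmod_step_le) auto
  finally show ?thesis .
qed

text \<open>\<open>T\<close> multiplies from the left and therefore commutes with right
  translations.\<close>

lemma T_pow_translate: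
  assumes "s \<in> carrier G" "x \<in> carrier G"
  shows "(T ^^ n) (\<delta> s) x = (T ^^ n) (\<delta> \<one>) (x \<otimes> inv s)"
  using assms(2)
proof (induction n arbitrary: x)
  case 0
  then show ?case
    using assms(1) by (auto simp: \<delta>_def inv_solve_right')
next
  case (Suc n)
  then show ?case
    using assms(1) supp_carrier by (auto simp: T_eq m_assoc intro!: sum.cong)
qed

text \<open>Powers in the group algebra append the new factor on the right, whereas \<open>T\<close>
  puts it on the left. The two convolutions commute and agree on \<open>\<delta> \<one>\<close>,
  which reconciles them in \<open>ga_pow\<close>.\<close>

definition right_conv :: "('a \<Rightarrow> complex) \<Rightarrow> 'a \<Rightarrow> complex" where
  "right_conv f x = (if x \<in> carrier G then \<Sum>g\<in>supp. \<alpha> g * f (x \<otimes> inv g) else 0)"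

lemma T_right_conv: "T (right_conv f) = right_conv (T f)"
proof
  fix x
  show "T (right_conv f) x = right_conv (T f) x"
  proof (cases "x \<in> carrier G")
    case True
    have "T (right_conv f) x = (\<Sum>g\<in>supp. \<Sum>h\<in>supp. \<alpha> g * (\<alpha> h * f (inv g \<otimes> x \<otimes> inv h)))"
      using True supp_carrier by (auto simp: T_eq right_conv_def sum_distrib_left intro!: sum.cong)
    also have "\<dots> = (\<Sum>h\<in>supp. \<Sum>g\<in>supp. \<alpha> g * (\<alpha> h * f (inv g \<otimes> x \<otimes> inv h)))"
      by (rule sum.swap)
    also have "\<dots> = right_conv (T f) x"
      using True supp_carrier
      by (auto simp: T_eq right_conv_def sum_distrib_left m_assoc mult_ac intro!: sum.cong)
    finally show ?thesis .
  qed (simp add: T_eq right_conv_def)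
qed

lemma ga_mult_right_conv:
  assumes f: "f \<in> fin_supp"
  shows "f \<otimes>\<^bsub>group_algebra G\<^esub> \<alpha> = right_conv f"
proof
  fix z
  let ?P = "{(x, y). f x \<noteq> 0 \<and> \<alpha> y \<noteq> 0 \<and> x \<otimes> y = z}"
  have mult: "(f \<otimes>\<^bsub>group_algebra G\<^esub> \<alpha>) z = (\<Sum>(x, y)\<in>?P. f x * \<alpha> y)"
    by (simp add: group_algebra_def)
  have carr: "f x \<noteq> 0 \<Longrightarrow> x \<in> carrier G" for x
    using f by (auto simp: fin_supp_iff)
  show "(f \<otimes>\<^bsub>group_algebra G\<^esub> \<alpha>) z = right_conv f z"
  proof (cases "z \<in> carrier G")
    case False
    then have P: "?P = {}"
      using carr supp_carrier(2) m_closed by blast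
    show ?thesis
      unfolding mult P right_conv_def using False by simp
  next
    case True
    let ?S = "{g \<in> supp. f (z \<otimes> inv g) \<noteq> 0}"
    have "right_conv f z = (\<Sum>g\<in>?S. \<alpha> g * f (z \<otimes> inv g))"
      using True finite_supp unfolding right_conv_def by (auto intro!: sum.mono_neutral_right)
    also have "\<dots> = (\<Sum>(x, y)\<in>?P. f x * \<alpha> y)"
    proof (rule sum.reindex_bij_witness[where i = snd and j = "\<lambda>g. (z \<otimes> inv g, g)"])
      fix g assume "g \<in> ?S"
      then show "(z \<otimes> inv g, g) \<in> ?P"
        using True supp_carrier by (auto simp: m_assoc)
    next
      fix q assume q: "q \<in> ?P"
      obtain x y where xy: "q = (x, y)" by (cases q)
      then have "x = z \<otimes> inv y"
        using q carr supp_carrier(2) True by (auto simp: inv_solve_right)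
      then show "(z \<otimes> inv (snd q), snd q) = q" "snd q \<in> ?S"
        using q xy by auto
    qed auto
    finally show ?thesis
      using mult by simp
  qed
qed

lemma ga_pow: "\<alpha> [^]\<^bsub>group_algebra G\<^esub> p = (T ^^ p) (\<delta> \<one>)"
proof (induction p)
  case 0
  show ?case by (simp add: nat_pow_def group_algebra_def \<delta>_def)
next
  case (Suc p)
  have comm: "(T ^^ n) (right_conv f) = right_conv ((T ^^ n) f)" for n f
    by (induction n) (simp_all add: T_right_conv)
  have "\<alpha> [^]\<^bsub>group_algebra G\<^esub> Suc p = \<alpha> [^]\<^bsub>group_algebra G\<^esub> p \<otimes>\<^bsub>group_algebra G\<^esub> \<alpha>"
    by (simp add: nat_pow_def)
  also have "\<dots> = right_conv ((T ^^ p) (\<delta> \<one>))"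
    unfolding Suc using T_pow[OF \<delta>_fin_supp[OF one_closed], of p] by (intro ga_mult_right_conv) blast
  also have "\<dots> = (T ^^ p) (right_conv (\<delta> \<one>))"
    by (simp add: comm)
  also have "right_conv (\<delta> \<one>) = T (\<delta> \<one>)"
  proof
    fix x
    show "right_conv (\<delta> \<one>) x = T (\<delta> \<one>) x"
    proof (cases "x \<in> carrier G")
      case True
      have "x \<otimes> inv g = \<one> \<longleftrightarrow> inv g \<otimes> x = \<one>" if "g \<in> supp" for g
        using True supp_carrier(1)[OF that] by (metis inv_closed inv_comm)
      then show ?thesis
        using True by (auto simp: right_conv_def T_eq \<delta>_def intro!: sum.cong)
    qed (simp add: right_conv_def T_eq)
  qed
  finally show ?case
    by (simp add: funpow_swap1)
qed

section \<open>The Cauchy--Schwarz estimate across a cut\<close>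

abbreviation pw :: "nat \<Rightarrow> 'a \<Rightarrow> complex" where "pw p \<equiv> \<alpha> [^]\<^bsub>group_algebra G\<^esub> p"

lemma pw_fin_supp: "pw p \<in> fin_supp" and l2_norm_pw: "l2_norm G (pw p) \<le> \<kappa> ^ p"
  using T_pow[OF \<delta>_fin_supp[OF one_closed], of p] l2_norm_\<delta>[OF one_closed] by (simp_all add: ga_pow)

text \<open>\<open>pw m\<close> is the image of a unit vector under \<open>T ^^ m\<close>, so its l2
  norm is at most \<open>\<kappa> ^ m\<close>; injectivity of \<open>h\<close> and \<open>k\<close>
  makes each sum of squares a partial sum of such a norm.\<close>

lemma sum_pw_le:
  assumes I: "finite I" and h: "inj_on h I" "h ` I \<subseteq> carrier G" and k: "inj_on k I" "k ` I \<subseteq> carrier G"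
  shows "(\<Sum>i\<in>I. cmod (pw m (h i)) * cmod (pw n (k i))) \<le> \<kappa> ^ (m + n)"
proof -
  have "(\<Sum>i\<in>I. cmod (pw m (h i)) * cmod (pw n (k i)))\<^sup>2 \<le>
      (\<Sum>i\<in>I. (cmod (pw m (h i)))\<^sup>2) * (\<Sum>i\<in>I. (cmod (pw n (k i)))\<^sup>2)"
    by (rule Cauchy_Schwarz_ineq_sum)
  also have "\<dots> \<le> (l2_norm G (pw m))\<^sup>2 * (l2_norm G (pw n))\<^sup>2"
    using assms by (intro mult_mono sum_le_l2_norm_sq pw_fin_supp) (auto intro: sum_nonneg)
  also have "\<dots> \<le> (\<kappa> ^ m)\<^sup>2 * (\<kappa> ^ n)\<^sup>2"
    using l2_norm_pw l2_norm_nonneg by (intro mult_mono power_mono) auto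
  also have "\<dots> = (\<kappa> ^ (m + n))\<^sup>2"
    by (simp add: power_add power_mult_distrib)
  finally show ?thesis
    by (rule power2_le_imp_le) (simp add: \<kappa>_nonneg)
qed

text \<open>The cut is \<open>Bl\<close> translated by \<open>h i\<close>. By translation
  invariance, entries from \<open>z \<otimes> h i\<close> to \<open>k i \<otimes> h i\<close> depend
  only on \<open>k i \<otimes> inv z\<close>, so for fixed times and points of \<open>Bl\<close> the
  sum over \<open>i\<close> has the form of \<open>sum_pw_le\<close>. The polynomial factor counts
  at most \<open>p + 1\<close> times of the last visit, at most \<open>p + 1\<close> alternatives
  for the first return, and two points of \<open>Bl\<close>.\<close>

lemma sum_pw_through_cut:
  assumes I: "finite I" and h: "inj_on h I" "h ` I \<subseteq> carrier G" and k: "inj_on k I" "k ` I \<subseteq> carrier G"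
    and Bl: "finite Bl" "Bl \<subseteq> carrier G" "Bl \<noteq> {}"
    and V: "\<And>i y g. i \<in> I \<Longrightarrow> y \<in> carrier G \<Longrightarrow> y \<notin> V i \<Longrightarrow> g \<in> supp \<Longrightarrow> g \<otimes> y \<in> V i \<Longrightarrow> g \<otimes> y \<in> (\<lambda>z. z \<otimes> h i) ` Bl"
    and one: "\<And>i. i \<in> I \<Longrightarrow> \<one> \<in> V i \<Longrightarrow> \<one> \<in> (\<lambda>z. z \<otimes> h i) ` Bl"
    and kh: "\<And>i. i \<in> I \<Longrightarrow> k i \<otimes> h i \<in> V i"
  shows "(\<Sum>i\<in>I. cmod (pw p (k i \<otimes> h i))) \<le> (real (p + 1) * card Bl)\<^sup>2 * \<kappa> ^ p"
proof -
  let ?b = "card Bl"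
  have hc: "h i \<in> carrier G" and kc: "k i \<in> carrier G" if "i \<in> I" for i
    using that h k by auto
  have inj: "inj_on (\<lambda>z. z \<otimes> h i) Bl" if "i \<in> I" for i
    using Bl(2) hc[OF that] by (intro inj_onI) (metis right_cancel subsetD)
  have tr: "(T ^^ n) (\<delta> (z \<otimes> h i)) (k i \<otimes> h i) = pw n (k i \<otimes> inv z)" if "i \<in> I" "z \<in> Bl" for i z n
  proof -
    have "z \<in> carrier G" using that Bl by auto
    then have "k i \<otimes> h i \<otimes> inv (z \<otimes> h i) = k i \<otimes> inv z"
      using hc[OF that(1)] kc[OF that(1)] by (simp add: inv_mult_group m_assoc mult_inv_cancel_left)
    then show ?thesis
      using T_pow_translate[of "z \<otimes> h i" "k i \<otimes> h i" n] \<open>z \<in> carrier G\<close> hc[OF that(1)] kc[OF that(1)]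
      by (simp add: ga_pow)
  qed
  define A where "A m n z w = (\<Sum>i\<in>I. cmod (pw m (z \<otimes> h i)) * cmod (pw n (k i \<otimes> inv w)))" for m n z w
  have A: "A m n z w \<le> \<kappa> ^ (m + n)" if "z \<in> Bl" "w \<in> Bl" for m n z w
    unfolding A_def
  proof (rule sum_pw_le[OF I])
    have zw: "z \<in> carrier G" "w \<in> carrier G" using that Bl by auto
    show "inj_on (\<lambda>i. z \<otimes> h i) I" "inj_on (\<lambda>i. k i \<otimes> inv w) I"
      using zw h k hc kc by (auto simp: inj_on_def)
    show "(\<lambda>i. z \<otimes> h i) ` I \<subseteq> carrier G" "(\<lambda>i. k i \<otimes> inv w) ` I \<subseteq> carrier G"
      using zw hc kc by auto
  qed
  have "cmod (pw p (k i \<otimes> h i)) \<le> (\<Sum>n\<le>p. \<Sum>z\<in>Bl. cmod (pw n (z \<otimes> h i)) *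
    (cmod (pw (p - n) (k i \<otimes> inv z)) +
    (\<Sum>j<p - n. \<Sum>w\<in>Bl. \<kappa> ^ Suc j * cmod (pw (p - n - Suc j) (k i \<otimes> inv w)))))" if i: "i \<in> I" for i
  proof -
    let ?H = "(\<lambda>z. z \<otimes> h i) ` Bl"
    have H: "finite ?H" "?H \<subseteq> carrier G"
      using Bl hc[OF i] by auto
    show ?thesis
      using cmod_T_pow_le[OF H one_closed V[OF i] one[OF i] kh[OF i], of p] i
      by (simp add: sum.reindex[OF inj[OF i]] tr ga_pow[symmetric])
  qed
  then have "(\<Sum>i\<in>I. cmod (pw p (k i \<otimes> h i))) \<le> (\<Sum>i\<in>I. \<Sum>n\<le>p. \<Sum>z\<in>Bl. cmod (pw n (z \<otimes> h i)) *
    (cmod (pw (p - n) (k i \<otimes> inv z)) +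
    (\<Sum>j<p - n. \<Sum>w\<in>Bl. \<kappa> ^ Suc j * cmod (pw (p - n - Suc j) (k i \<otimes> inv w)))))"
    by (rule sum_mono)
  also have "\<dots> = (\<Sum>n\<le>p. \<Sum>z\<in>Bl. A n (p - n) z z + (\<Sum>j<p - n. \<Sum>w\<in>Bl. \<kappa> ^ Suc j * A n (p - n - Suc j) z w))"
    unfolding A_def sum_distrib_left distrib_left sum.distrib
    by (simp add: sum.swap[of _ _ I] mult_ac)
  also have "\<dots> \<le> (\<Sum>n\<le>p. \<Sum>z\<in>Bl. \<kappa> ^ p + (\<Sum>j<p - n. \<Sum>w\<in>Bl. \<kappa> ^ p))"
  proof (intro sum_mono add_mono)
    fix n z assume n: "n \<in> {..p}" and z: "z \<in> Bl"
    show "A n (p - n) z z \<le> \<kappa> ^ p"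
      using A[OF z z, of n "p - n"] n by simp
    fix j w assume j: "j \<in> {..<p - n}" and w: "w \<in> Bl"
    have "\<kappa> ^ Suc j * A n (p - n - Suc j) z w \<le> \<kappa> ^ Suc j * \<kappa> ^ (n + (p - n - Suc j))"
      by (intro mult_left_mono A z w zero_le_power \<kappa>_nonneg)
    also have "\<dots> = \<kappa> ^ p"
      using n j unfolding power_add[symmetric] by simp
    finally show "\<kappa> ^ Suc j * A n (p - n - Suc j) z w \<le> \<kappa> ^ p" .
  qed
  also have "\<dots> = (\<Sum>n\<le>p. (?b * (1 + real (p - n) * ?b)) * \<kappa> ^ p)"
    by (simp add: algebra_simps)
  also have "\<dots> \<le> (\<Sum>n\<le>p. (?b * (real (p + 1) * ?b)) * \<kappa> ^ p)"
  proof (intro sum_mono mult_right_mono mult_left_mono zero_le_power \<kappa>_nonneg)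
    fix n
    \<comment> \<open>Nonemptiness of \<open>Bl\<close> lets \<open>?b\<close> absorb the term
      without a return.\<close>
    have "1 \<le> real ?b" using Bl by (simp add: Suc_le_eq card_gt_0_iff)
    moreover have "real (p - n) * ?b \<le> real p * ?b"
      by (intro mult_right_mono) auto
    moreover have "real (p + 1) * ?b = ?b + real p * ?b"
      by (simp add: algebra_simps)
    ultimately show "1 + real (p - n) * ?b \<le> real (p + 1) * ?b"
      by linarith
  qed simp
  also have "\<dots> = (real (p + 1) * ?b)\<^sup>2 * \<kappa> ^ p"
    by (simp add: power2_eq_square algebra_simps)
  finally show ?thesis .
qed

end

section \<open>Words in an element of order 2 and an element of order 3\<close>

text \<open>The letters stand for \<open>b\<close>, \<open>c\<close> and \<open>c\<inverse> = c\<^sup>2\<close>.\<close>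

datatype letter = B | C | D

fun linv :: "letter \<Rightarrow> letter" where
  "linv B = B" | "linv C = D" | "linv D = C"

definition winv :: "letter list \<Rightarrow> letter list" where
  "winv w = rev (map linv w)"

definition reduced :: "letter list \<Rightarrow> bool" where
  "reduced = successively (\<lambda>x y. (x = B) \<noteq> (y = B))"

text \<open>Left multiplication by a letter on normal forms. Two equal letters of order 3 fuse into
  the inverse letter, so the head can change while the length stays the same.\<close>

fun push :: "letter \<Rightarrow> letter list \<Rightarrow> letter list" where
  "push B (B # r) = r"
| "push C (C # r) = D # r"
| "push C (D # r) = r"
| "push D (C # r) = r"
| "push D (D # r) = C # r"
| "push x r = x # r"

abbreviation normal_form :: "letter list \<Rightarrow> letter list" where
  "normal_form w \<equiv> foldr push w []"

lemma reduced_simps [simp]: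
  "reduced []"
  "reduced [x]"
  "reduced (x # y # r) \<longleftrightarrow> ((x = B) \<noteq> (y = B)) \<and> reduced (y # r)"
  by (simp_all add: reduced_def)

lemma reduced_Cons: "reduced (x # r) \<longleftrightarrow> (r = [] \<or> ((x = B) \<noteq> (hd r = B)) \<and> reduced r)"
  by (cases r) auto

lemma reduced_append:
  "reduced (u @ v) \<longleftrightarrow> reduced u \<and> reduced v \<and> (u = [] \<or> v = [] \<or> ((last u = B) \<noteq> (hd v = B)))"
  by (auto simp: reduced_def successively_append_iff)

lemma linv_linv [simp]: "linv (linv x) = x"
  by (cases x) auto

lemma linv_eq_B [simp]: "linv x = B \<longleftrightarrow> x = B"
  by (cases x) auto

lemma winv_simps [simp]: "winv [] = []" "winv (x # w) = winv w @ [linv x]"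
  "winv (u @ v) = winv v @ winv u" "winv (winv w) = w" "length (winv w) = length w"
  by (auto simp: winv_def rev_map comp_def)

lemma reduced_push: "reduced w \<Longrightarrow> reduced (push x w)"
  by (induction x w rule: push.induct) (auto simp: reduced_Cons split: if_splits)

lemma reduced_foldr_push: "reduced w \<Longrightarrow> reduced (foldr push v w)"
  by (induction v) (auto intro: reduced_push)

lemma foldr_push_append_reduced: "reduced (u @ v) \<Longrightarrow> foldr push u v = u @ v"
proof (induction u)
  case (Cons x u)
  then have "foldr push u v = u @ v"
    by (cases "u @ v") auto
  with Cons.prems show ?case
    by (cases x; cases "u @ v" rule: list.exhaust; cases "hd (u @ v)") auto
qed auto

lemma normal_form_reduced: "reduced w \<Longrightarrow> normal_form w = w"
  using foldr_push_append_reduced[of w "[]"] by simp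

lemma push_push_linv: "reduced w \<Longrightarrow> push x (push (linv x) w) = w"
  by (cases x; cases w rule: list.exhaust; cases "hd w"; cases "tl w"; cases "hd (tl w)") auto

text \<open>Words act on reduced words by invertible maps, in the manner of van der Waerden;
  uniqueness of normal forms will rest on this action.\<close>

lemma foldr_push_winv: "reduced w \<Longrightarrow> foldr push v (foldr push (winv v) w) = w"
proof (induction v arbitrary: w)
  case (Cons x v)
  show ?case
    using Cons by (simp add: push_push_linv reduced_push reduced_foldr_push)
qed auto

lemma suffix_push:
  assumes "length u \<ge> 1"
  shows "\<exists>u'. push x (u @ v) = u' @ v \<and> length u' \<ge> length u - 1"
proof -
  obtain y u' where "u = y # u'"
    using assms by (cases u) auto
  then have "push x (u @ v) \<in> {u' @ v, (linv y # u') @ v, (x # y # u') @ v}"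
    by (cases x; cases y) auto
  then show ?thesis
    using \<open>u = y # u'\<close> by force
qed

text \<open>Each letter alters at most the front of the word, so a suffix preceded by enough letters
  survives. This tree-like geometry is what makes a neighbourhood of \<open>h\<close> a cut.\<close>

lemma suffix_foldr_push:
  "length u \<ge> length w \<Longrightarrow> \<exists>u'. foldr push w (u @ v) = u' @ v \<and> length u' \<ge> length u - length w"
proof (induction w)
  case (Cons x w)
  then obtain u' where u': "foldr push w (u @ v) = u' @ v" "length u' \<ge> length u - length w"
    by auto
  then have "length u' \<ge> 1"
    using Cons.prems by simp
  from suffix_push[OF this, of x v] obtain u'' where
    "push x (u' @ v) = u'' @ v" "length u'' \<ge> length u' - 1"
    by blast
  then show ?case
    using u' by (intro exI[of _ u'']) auto
qed auto

text \<open>Stated for any monoid so that the same word can be evaluated in the modular group and in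
  symmetric groups; writing \<open>D\<close> as \<open>c \<otimes> c\<close> avoids
  inverses.\<close>

fun (in monoid) word_eval :: "'a \<Rightarrow> 'a \<Rightarrow> letter list \<Rightarrow> 'a" where
  "word_eval b c [] = \<one>"
| "word_eval b c (B # w) = b \<otimes> word_eval b c w"
| "word_eval b c (C # w) = c \<otimes> word_eval b c w"
| "word_eval b c (D # w) = (c \<otimes> c) \<otimes> word_eval b c w"

locale order23 = group G for G (structure) +
  fixes b c
  assumes b_closed [simp, intro]: "b \<in> carrier G" and c_closed [simp, intro]: "c \<in> carrier G"
    and bb: "b \<otimes> b = \<one>" and ccc: "c \<otimes> (c \<otimes> c) = \<one>"
begin

abbreviation ev :: "letter list \<Rightarrow> 'a" where "ev \<equiv> word_eval b c"

lemma ev_closed [simp, intro]: "ev w \<in> carrier G"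
proof (induction w)
  case (Cons x w)
  then show ?case by (cases x) auto
qed auto

lemma ev_append: "ev (u @ v) = ev u \<otimes> ev v"
proof (induction u)
  case (Cons x u)
  then show ?case by (cases x) (auto simp: m_assoc)
qed auto

lemma bb': "x \<in> carrier G \<Longrightarrow> b \<otimes> (b \<otimes> x) = x"
  by (metis b_closed bb l_one m_assoc)

lemma ccc': "x \<in> carrier G \<Longrightarrow> c \<otimes> (c \<otimes> (c \<otimes> x)) = x"
  by (metis c_closed ccc l_one m_assoc m_closed)

lemma ev_push: "ev (push x w) = ev (x # w)"
  by (induction x w rule: push.induct) (auto simp: m_assoc bb' ccc')

lemma ev_foldr_push: "ev (foldr push u v) = ev (u @ v)"
proof (induction u)
  case (Cons x u)
  have "ev (foldr push (x # u) v) = ev ([x] @ foldr push u v)"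
    by (simp add: ev_push)
  then show ?case
    using Cons by (metis append_Cons append_Nil ev_append)
qed auto

lemma ev_normal_form: "ev (normal_form w) = ev w"
  using ev_foldr_push[of w "[]"] by simp

lemma ev_linv: "ev [linv x] \<otimes> ev [x] = \<one>"
  by (cases x) (auto simp: m_assoc bb ccc)

lemma ev_winv_l: "ev (winv w) \<otimes> ev w = \<one>"
proof (induction w)
  case (Cons x w)
  have "ev (winv (x # w)) \<otimes> ev (x # w) = ev (winv w) \<otimes> ((ev [linv x] \<otimes> ev [x]) \<otimes> ev w)"
    using ev_append[of "winv w" "[linv x]"] ev_append[of "[x]" w] by (simp add: m_assoc)
  then show ?case
    using Cons by (simp only: ev_linv) simp
qed auto

lemma ev_winv: "ev (winv w) = inv (ev w)"
  using ev_winv_l inv_equality by (metis ev_closed)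

end

text \<open>The free product of groups of order 2 and 3, expressed through words: reduced words
  other than the empty one are nontrivial, and words exhaust the group.\<close>

locale free_order23 = order23 +
  assumes free: "reduced w \<Longrightarrow> ev w = \<one> \<Longrightarrow> w = []"
    and gen: "x \<in> carrier G \<Longrightarrow> \<exists>w. ev w = x"
begin

text \<open>By freeness the normal form of \<open>winv u @ v\<close> is empty; acting on it with
  \<open>u\<close> gives \<open>v\<close> on the one hand and \<open>u\<close> on the other.\<close>

lemma ev_inj:
  assumes "reduced u" "reduced v" "ev u = ev v"
  shows "u = v"
proof -
  have "ev (normal_form (winv u @ v)) = \<one>"
    using assms by (simp only: ev_normal_form ev_append ev_winv) simp
  then have "foldr push (winv u) v = []"
    using free[OF reduced_foldr_push] assms by (simp add: normal_form_reduced)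
  then show ?thesis
    using foldr_push_winv[of v u] assms by (simp add: normal_form_reduced)
qed

definition nf :: "'a \<Rightarrow> letter list" where
  "nf x = (THE w. reduced w \<and> ev w = x)"

lemma nf_ev: "reduced w \<Longrightarrow> nf (ev w) = w"
  unfolding nf_def by (rule the_equality) (auto intro: ev_inj)

lemma nf:
  assumes "x \<in> carrier G"
  shows "reduced (nf x)" "ev (nf x) = x"
proof -
  obtain w where w: "ev w = x"
    using gen assms by blast
  have "reduced (normal_form w)" "ev (normal_form w) = x"
    using w by (auto simp: ev_normal_form reduced_foldr_push)
  then show "reduced (nf x)" "ev (nf x) = x"
    using nf_ev by auto
qed

lemma nf_mult:
  assumes "x \<in> carrier G" "y \<in> carrier G"
  shows "nf (x \<otimes> y) = foldr push (nf x) (nf y)"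
  using nf_ev[of "foldr push (nf x) (nf y)"] assms
  by (simp add: ev_foldr_push ev_append nf reduced_foldr_push)

lemma nf_inv:
  assumes "x \<in> carrier G"
  shows "nf (inv x) = winv (nf x)"
proof -
  have "reduced (winv (nf x))"
    using nf(1)[OF assms] unfolding reduced_def winv_def successively_rev successively_map
    by (rule successively_mono) auto
  then show ?thesis
    using nf_ev[of "winv (nf x)"] assms by (simp add: ev_winv nf)
qed

definition lift :: "('h, 'm) monoid_scheme \<Rightarrow> 'h \<Rightarrow> 'h \<Rightarrow> 'a \<Rightarrow> 'h" where
  "lift H s t = restrict (\<lambda>x. monoid.word_eval H s t (nf x)) (carrier G)"

lemma lift_ev:
  assumes "order23 H s t"
  shows "lift H s t (ev w) = monoid.word_eval H s t w"
proof -
  interpret H: order23 H s t by fact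
  have "nf (ev w) = normal_form w"
    using nf_ev[OF reduced_foldr_push, of "[]" w] by (simp add: ev_normal_form)
  then show ?thesis
    by (simp add: lift_def H.ev_normal_form)
qed

lemma lift_hom:
  assumes "order23 H s t"
  shows "lift H s t \<in> hom G H"
proof -
  interpret H: order23 H s t by fact
  show ?thesis
  proof (rule homI)
    show "lift H s t x \<in> carrier H" if "x \<in> carrier G" for x
      using that by (simp add: lift_def)
    show "lift H s t (x \<otimes> y) = lift H s t x \<otimes>\<^bsub>H\<^esub> lift H s t y"
      if "x \<in> carrier G" "y \<in> carrier G" for x y
      using lift_ev[OF assms, of "nf x @ nf y"] that
      by (simp add: H.ev_append ev_append nf) (simp add: lift_def)
  qed
qed

lemma hom_eq_lift:
  assumes H: "order23 H s t" and h: "h \<in> hom G H" "h \<in> extensional (carrier G)" "h b = s" "h c = t"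
  shows "h = lift H s t"
proof
  interpret H: order23 H s t by fact
  interpret hom: group_hom G H h by unfold_locales (rule h)
  have *: "h (ev w) = H.ev w" for w
  proof (induction w)
    case (Cons x w)
    then show ?case by (cases x) (auto simp: h)
  qed auto
  show "h x = lift H s t x" for x
  proof (cases "x \<in> carrier G")
    case True
    then show ?thesis using *[of "nf x"] by (simp add: nf lift_def)
  next
    case False
    then show ?thesis using h(2) by (simp add: lift_def extensional_def)
  qed
qed

text \<open>The universal property, in the form of the \<open>THE\<close> that defines
  \<open>Phi\<close>.\<close>

lemma the_lift:
  assumes H: "order23 H s t"
  shows "(THE h. h \<in> hom G H \<and> h \<in> extensional (carrier G) \<and> h b = s \<and> h c = t) = lift H s t"
proof (rule the_equality)
  interpret H: order23 H s t by fact
  have "lift H s t b = s" "lift H s t c = t"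
    using lift_ev[OF H, of "[B]"] lift_ev[OF H, of "[C]"] by simp_all
  then show "lift H s t \<in> hom G H \<and> lift H s t \<in> extensional (carrier G) \<and>
      lift H s t b = s \<and> lift H s t c = t"
    using lift_hom[OF H] by (simp add: lift_def)
qed (use hom_eq_lift[OF H] in blast)

end

section \<open>The modular group\<close>

lemma SL2Z_simps [simp]: "carrier SL2Z = {A. det A = 1}" "mult SL2Z = (**)" "one SL2Z = mat 1"
  by (simp_all add: SL2Z_def)

lemma det_uminus_2: "det (- A :: int^2^2) = det A"
  by (simp add: det_2)

lemma matrix_mult_uminus:
  fixes A M :: "int^2^2"
  shows "(- A) ** M = - (A ** M)" "A ** (- M) = - (A ** M)"
  by (simp_all add: matrix_matrix_mult_def vec_eq_iff sum_negf)

lemma group_SL2Z: "group SL2Z"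
proof (rule groupI)
  show "\<exists>N\<in>carrier SL2Z. N \<otimes>\<^bsub>SL2Z\<^esub> M = \<one>\<^bsub>SL2Z\<^esub>" if "M \<in> carrier SL2Z" for M
  proof
    let ?N = "vector [vector [M $ 2 $ 2, - M $ 1 $ 2], vector [- M $ 2 $ 1, M $ 1 $ 1]] :: int^2^2"
    have d: "M $ 1 $ 1 * M $ 2 $ 2 - M $ 1 $ 2 * M $ 2 $ 1 = 1"
      using that by (simp add: det_2)
    then show "?N \<in> carrier SL2Z" "?N \<otimes>\<^bsub>SL2Z\<^esub> M = \<one>\<^bsub>SL2Z\<^esub>"
      by (auto simp: det_2 matrix_matrix_mult_def vec_eq_iff forall_2 sum_2 mat_def algebra_simps)
  qed
qed (auto simp: det_mul matrix_mul_assoc)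

interpretation SL2Z: group SL2Z by (rule group_SL2Z)

abbreviation pm_one :: "(int^2^2) set" where "pm_one \<equiv> {mat 1, - mat 1}"

lemma normal_pm_one: "pm_one \<lhd> SL2Z"
proof (rule SL2Z.normal_invI)
  show "subgroup pm_one SL2Z"
  proof (rule SL2Z.subgroupI)
    show "inv\<^bsub>SL2Z\<^esub> a \<in> pm_one" if "a \<in> pm_one" for a
      using that SL2Z.inv_equality[of "- mat 1" "- mat 1"] SL2Z.inv_one
      by (auto simp: matrix_mult_uminus det_uminus_2)
  qed (auto simp: det_uminus_2 matrix_mult_uminus)
  show "x \<otimes>\<^bsub>SL2Z\<^esub> h \<otimes>\<^bsub>SL2Z\<^esub> inv\<^bsub>SL2Z\<^esub> x \<in> pm_one"
    if "x \<in> carrier SL2Z" "h \<in> pm_one" for x h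
    using that SL2Z.r_inv[of x] by (auto simp: matrix_mult_uminus)
qed

interpretation pm_one: normal pm_one SL2Z by (rule normal_pm_one)

definition psl :: "int^2^2 \<Rightarrow> (int^2^2) set" where
  "psl A = pm_one #>\<^bsub>SL2Z\<^esub> A"

lemma psl_eq: "psl A = {A, - A}"
  by (auto simp: psl_def r_coset_def matrix_mult_uminus)

lemma psl_eq_iff: "psl A = psl M \<longleftrightarrow> A = M \<or> A = - M"
  unfolding psl_eq by (metis doubleton_eq_iff insert_iff minus_minus singletonD)

lemma group_PSL2Z: "group PSL2Z"
  unfolding PSL2Z_def by (rule pm_one.factorgroup_is_group)

interpretation PSL2Z: group PSL2Z by (rule group_PSL2Z)

lemma carrier_PSL2Z: "carrier PSL2Z = psl ` {A. det A = 1}"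
  by (auto simp: PSL2Z_def FactGroup_def RCOSETS_def psl_def)

lemma one_PSL2Z: "\<one>\<^bsub>PSL2Z\<^esub> = psl (mat 1)"
  by (auto simp: PSL2Z_def FactGroup_def psl_eq)

lemma mult_PSL2Z: "det A = 1 \<Longrightarrow> det M = 1 \<Longrightarrow> psl A \<otimes>\<^bsub>PSL2Z\<^esub> psl M = psl (A ** M)"
  using pm_one.rcos_sum[of A M] by (simp add: PSL2Z_def FactGroup_def psl_def)

definition mat_b :: "int^2^2" where "mat_b = vector [vector [0, 1], vector [-1, 0]]"
definition mat_c :: "int^2^2" where "mat_c = vector [vector [0, 1], vector [-1, 1]]"

lemma gen_psl: "gen_b = psl mat_b" "gen_c = psl mat_c"
  by (simp_all add: gen_b_def gen_c_def psl_def mat_b_def mat_c_def)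

lemma det_mat_b [simp]: "det mat_b = 1" and det_mat_c [simp]: "det mat_c = 1"
  by (simp_all add: det_2 mat_b_def mat_c_def)

interpretation PSL2Z: order23 PSL2Z gen_b gen_c
proof
  show "gen_b \<in> carrier PSL2Z" "gen_c \<in> carrier PSL2Z"
    by (auto simp: carrier_PSL2Z gen_psl)
  have "mat_b ** mat_b = - mat 1" "mat_c ** (mat_c ** mat_c) = - mat 1"
    by (simp_all add: mat_b_def mat_c_def matrix_matrix_mult_def vec_eq_iff forall_2 sum_2 mat_def)
  then show "gen_b \<otimes>\<^bsub>PSL2Z\<^esub> gen_b = \<one>\<^bsub>PSL2Z\<^esub>"
      "gen_c \<otimes>\<^bsub>PSL2Z\<^esub> (gen_c \<otimes>\<^bsub>PSL2Z\<^esub> gen_c) = \<one>\<^bsub>PSL2Z\<^esub>"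
    by (simp_all add: gen_psl one_PSL2Z mult_PSL2Z det_mul psl_eq_iff)
qed

section \<open>Freeness by ping-pong\<close>

fun word_mat :: "letter list \<Rightarrow> int^2^2" where
  "word_mat [] = mat 1"
| "word_mat (B # w) = mat_b ** word_mat w"
| "word_mat (C # w) = mat_c ** word_mat w"
| "word_mat (D # w) = mat_c ** mat_c ** word_mat w"

lemma det_word_mat [simp]: "det (word_mat w) = 1"
  by (induction w rule: word_mat.induct) (auto simp: det_mul)

lemma ev_PSL2Z: "PSL2Z.ev w = psl (word_mat w)"
  by (induction w rule: word_mat.induct)
    (auto simp: one_PSL2Z gen_psl mult_PSL2Z det_mul)

text \<open>Ping-pong on the sign of the product of the two coordinates: \<open>c\<close> and \<open>c\<inverse>\<close> map vectors
  with coordinates of opposite signs to vectors with coordinates of equal signs, and \<open>b\<close> swaps the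
  two kinds.\<close>

definition opp :: "int^2 \<Rightarrow> bool" where "opp v \<longleftrightarrow> v $ 1 * v $ 2 < 0"
definition agr :: "int^2 \<Rightarrow> bool" where "agr v \<longleftrightarrow> v $ 1 * v $ 2 > 0"

lemma pingpong:
  "agr v \<Longrightarrow> opp (mat_b *v v)"
  "opp v \<Longrightarrow> agr (mat_b *v v)"
  "opp v \<Longrightarrow> agr (mat_c *v v)"
  "opp v \<Longrightarrow> agr (mat_c *v (mat_c *v v))"
proof -
  have "(mat_b *v v) $ 1 * (mat_b *v v) $ 2 = - (v $ 1 * v $ 2)"
    by (simp add: mat_b_def matrix_vector_mult_def sum_2)
  then show "agr v \<Longrightarrow> opp (mat_b *v v)" "opp v \<Longrightarrow> agr (mat_b *v v)"
    by (simp_all add: opp_def agr_def)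
  have "(mat_c *v v) $ 1 * (mat_c *v v) $ 2 = v $ 2 * v $ 2 - v $ 1 * v $ 2"
    by (simp add: mat_c_def matrix_vector_mult_def sum_2 algebra_simps)
  then show "opp v \<Longrightarrow> agr (mat_c *v v)"
    using zero_le_square[of "v $ 2"] by (simp add: opp_def agr_def del: zero_le_square)
  have "(mat_c *v (mat_c *v v)) $ 1 * (mat_c *v (mat_c *v v)) $ 2 = v $ 1 * v $ 1 - v $ 1 * v $ 2"
    by (simp add: mat_c_def matrix_vector_mult_def sum_2 algebra_simps)
  then show "opp v \<Longrightarrow> agr (mat_c *v (mat_c *v v))"
    using zero_le_square[of "v $ 1"] by (simp add: opp_def agr_def del: zero_le_square)
qed

lemma word_mat_pingpong:
  assumes "reduced w" "w \<noteq> []" "if last w = B then agr v else opp v"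
  shows "if hd w = B then opp (word_mat w *v v) else agr (word_mat w *v v)"
  using assms
proof (induction w)
  case (Cons x w)
  show ?case
  proof (cases "w = []")
    case True
    then show ?thesis
      using Cons.prems by (cases x) (auto simp: pingpong matrix_vector_mul_assoc[symmetric])
  next
    case False
    then show ?thesis
      using Cons by (cases x) (auto simp: pingpong matrix_vector_mul_assoc[symmetric] reduced_Cons split: if_splits)
  qed
qed auto

text \<open>The word moves a test vector to the other kind, whereas the identity matrix and its
  negative preserve the kind.\<close>

lemma ev_ne_one_same_ends:
  assumes "reduced w" "w \<noteq> []" "(hd w = B) = (last w = B)"
  shows "PSL2Z.ev w \<noteq> \<one>\<^bsub>PSL2Z\<^esub>"
proof
  assume "PSL2Z.ev w = \<one>\<^bsub>PSL2Z\<^esub>"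
  then have eq: "word_mat w = mat 1 \<or> word_mat w = - mat 1"
    by (simp add: ev_PSL2Z one_PSL2Z psl_eq_iff)
  have neg: "(- mat 1 :: int^2^2) *v u = - u" for u
    by (auto simp: matrix_vector_mult_def vec_eq_iff forall_2 sum_2 mat_def)
  define v :: "int^2" where "v = (if last w = B then vector [1, 1] else vector [1, -1])"
  have "if last w = B then agr v else opp v"
    by (simp add: v_def agr_def opp_def)
  from word_mat_pingpong[OF assms(1,2) this] show False
    using eq assms(3) by (auto simp: v_def neg agr_def opp_def split: if_splits)
qed

text \<open>If exactly one end is \<open>B\<close>, conjugation by the letter at the other end, or
  by its inverse, produces a reduced word with neither end equal to \<open>B\<close>, because the
  square of a letter of order 3 is its inverse.\<close>

lemma ev_ne_one:
  assumes "reduced w" "w \<noteq> []"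
  shows "PSL2Z.ev w \<noteq> \<one>\<^bsub>PSL2Z\<^esub>"
proof
  assume one: "PSL2Z.ev w = \<one>\<^bsub>PSL2Z\<^esub>"
  have conj: "PSL2Z.ev (u @ w @ winv u) = \<one>\<^bsub>PSL2Z\<^esub>" for u
    using one by (simp add: PSL2Z.ev_append PSL2Z.ev_winv)
  consider "(hd w = B) = (last w = B)" | "hd w = B" "last w \<noteq> B" | "hd w \<noteq> B" "last w = B"
    by blast
  then show False
  proof cases
    case 1
    then show False using ev_ne_one_same_ends assms one by blast
  next
    case 2
    define x where "x = last w"
    define w' where "w' = butlast w"
    have w: "w = w' @ [x]"
      using assms by (simp add: x_def w'_def)
    have w': "w' \<noteq> []" "hd w' = B"
    proof -
      show "w' \<noteq> []"
        using 2 w by (metis append_Nil last_snoc list.sel(1))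
      then show "hd w' = B"
        using 2 w by (metis hd_append2)
    qed
    have x: "x \<noteq> B" using 2 x_def by simp
    have "reduced (linv x # w' @ [linv x])"
      using assms w' x by (auto simp: w reduced_Cons reduced_append)
    moreover have "PSL2Z.ev (linv x # w' @ [linv x]) = PSL2Z.ev ([linv x] @ w @ winv [linv x])"
    proof -
      have "PSL2Z.ev [linv x] = PSL2Z.ev [x, x]"
        using x by (cases x) (auto simp: PSL2Z.m_assoc PSL2Z.ccc')
      then have "PSL2Z.ev (([linv x] @ w') @ [linv x]) = PSL2Z.ev (([linv x] @ w') @ [x, x])"
        by (simp only: PSL2Z.ev_append)
      then show ?thesis by (simp add: w)
    qed
    ultimately show False
      using ev_ne_one_same_ends[of "linv x # w' @ [linv x]"] conj[of "[linv x]"] x by simp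
  next
    case 3
    define x where "x = hd w"
    define w' where "w' = tl w"
    have w: "w = x # w'"
      using assms by (simp add: x_def w'_def)
    have w': "w' \<noteq> []" "last w' = B"
    proof -
      show "w' \<noteq> []"
        using 3 w by (metis last.simps list.sel(1))
      then show "last w' = B"
        using 3 w by (metis last_ConsR)
    qed
    have x: "x \<noteq> B" using 3 x_def by simp
    have "reduced (linv x # w' @ [linv x])"
      using assms w' x by (auto simp: w reduced_Cons reduced_append)
    moreover have "PSL2Z.ev (linv x # w' @ [linv x]) = PSL2Z.ev ([x] @ w @ winv [x])"
    proof -
      have "PSL2Z.ev [linv x] = PSL2Z.ev [x, x]"
        using x by (cases x) (auto simp: PSL2Z.m_assoc PSL2Z.ccc')
      then have "PSL2Z.ev ([linv x] @ (w' @ [linv x])) = PSL2Z.ev ([x, x] @ (w' @ [linv x]))"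
        by (simp only: PSL2Z.ev_append)
      then show ?thesis by (simp add: w)
    qed
    ultimately show False
      using ev_ne_one_same_ends[of "linv x # w' @ [linv x]"] conj[of "[x]"] x by simp
  qed
qed

section \<open>Generation by the Euclidean algorithm\<close>

lemma shear_eq_ev: "\<exists>w. PSL2Z.ev w = psl (vector [vector [1, q], vector [0, 1]])"
proof -
  let ?T = "\<lambda>q. vector [vector [1, q], vector [0, 1]] :: int^2^2"
  have det: "det (?T q) = 1" for q
    by (simp add: det_2)
  have add: "?T q ** ?T r = ?T (q + r)" for q r
    by (simp add: matrix_matrix_mult_def vec_eq_iff forall_2 sum_2)
  have nat: "\<exists>w. PSL2Z.ev w = psl (?T (int n * s))" if s: "\<exists>w. PSL2Z.ev w = psl (?T s)" for n s
  proof (induction n)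
    case 0
    have "?T 0 = mat 1" by (simp add: vec_eq_iff forall_2 mat_def)
    then show ?case
      by (intro exI[of _ "[]"]) (simp add: one_PSL2Z)
  next
    case (Suc n)
    obtain u v where "PSL2Z.ev u = psl (?T (int n * s))" "PSL2Z.ev v = psl (?T s)"
      using Suc s by blast
    then have "PSL2Z.ev (u @ v) = psl (?T (int n * s + s))"
      by (simp add: PSL2Z.ev_append mult_PSL2Z det add)
    then show ?case by (auto simp: algebra_simps)
  qed
  have "word_mat [B, C] = - ?T (-1)"
    by (simp add: mat_b_def mat_c_def matrix_matrix_mult_def vec_eq_iff forall_2 sum_2 mat_def)
  then have m: "PSL2Z.ev [B, C] = psl (?T (-1))"
    unfolding ev_PSL2Z psl_eq_iff by simp
  have "word_mat [D, B] = ?T 1 \<or> word_mat [D, B] = - ?T 1"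
    by (simp add: mat_b_def mat_c_def matrix_matrix_mult_def vec_eq_iff forall_2 sum_2 mat_def)
  then have p: "PSL2Z.ev [D, B] = psl (?T 1)"
    unfolding ev_PSL2Z psl_eq_iff by simp
  show ?thesis
    using nat[OF exI, OF p, of "nat q"] nat[OF exI, OF m, of "nat (- q)"]
    by (cases "q \<ge> 0") simp_all
qed

text \<open>Subtracting \<open>q\<close> times the second row from the first and swapping the rows
  by \<open>mat_b\<close> replaces the first column by the next pair of the Euclidean algorithm, up
  to sign.\<close>

lemma psl_eq_ev: "det M = 1 \<Longrightarrow> \<exists>w. PSL2Z.ev w = psl M"
proof (induction "nat \<bar>M $ 2 $ 1\<bar>" arbitrary: M rule: less_induct)
  case less
  let ?T = "\<lambda>q. vector [vector [1, q], vector [0, 1]] :: int^2^2"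
  have detT: "det (?T q) = 1" for q
    by (simp add: det_2)
  have d: "M $ 1 $ 1 * M $ 2 $ 2 - M $ 1 $ 2 * M $ 2 $ 1 = 1"
    using less.prems by (simp add: det_2)
  show ?case
  proof (cases "M $ 2 $ 1 = 0")
    case True
    then have "M $ 1 $ 1 * M $ 2 $ 2 = 1" using d by simp
    then have "M $ 1 $ 1 = 1 \<and> M $ 2 $ 2 = 1 \<or> M $ 1 $ 1 = -1 \<and> M $ 2 $ 2 = -1"
      using zmult_eq_1_iff by blast
    then have "M = ?T (M $ 1 $ 2) \<or> M = - ?T (- M $ 1 $ 2)"
      using True by (auto simp: vec_eq_iff forall_2)
    then have "psl M = psl (?T (M $ 1 $ 2)) \<or> psl M = psl (?T (- M $ 1 $ 2))"
      unfolding psl_eq_iff by blast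
    then show ?thesis
      using shear_eq_ev[of "M $ 1 $ 2"] shear_eq_ev[of "- M $ 1 $ 2"] by metis
  next
    case False
    define q where "q = M $ 1 $ 1 div M $ 2 $ 1"
    define N where "N = mat_b ** (?T (- q) ** M)"
    have detN: "det N = 1"
      using less.prems by (simp add: N_def det_mul detT)
    have "N $ 2 $ 1 = - (M $ 1 $ 1 mod M $ 2 $ 1)"
    proof -
      have "N $ 2 $ 1 = - (M $ 1 $ 1 - q * M $ 2 $ 1)"
        by (simp add: N_def mat_b_def matrix_matrix_mult_def sum_2)
      then show ?thesis
        unfolding q_def minus_div_mult_eq_mod .
    qed
    then have "nat \<bar>N $ 2 $ 1\<bar> < nat \<bar>M $ 2 $ 1\<bar>"
      using False abs_mod_less[of "M $ 2 $ 1" "M $ 1 $ 1"] by simp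
    from less.hyps[OF this detN] obtain w where w: "PSL2Z.ev w = psl N" by blast
    obtain u where u: "PSL2Z.ev u = psl (?T q)" using shear_eq_ev by blast
    \<comment> \<open>The sign comes from \<open>mat_b ** mat_b = - mat 1\<close> and disappears in
      the quotient.\<close>
    have M: "M = - (?T q ** (mat_b ** N))"
      by (simp add: N_def mat_b_def matrix_matrix_mult_def vec_eq_iff forall_2 sum_2 algebra_simps)
    have "PSL2Z.ev (u @ [B] @ w) = psl (?T q ** (mat_b ** N))"
    proof -
      have "PSL2Z.ev (u @ [B] @ w) = psl (?T q) \<otimes>\<^bsub>PSL2Z\<^esub> (gen_b \<otimes>\<^bsub>PSL2Z\<^esub> psl N)"
        using PSL2Z.ev_append[of u "B # w"] by (simp add: u w)
      then show ?thesis
        by (simp add: gen_psl mult_PSL2Z det_mul detT detN)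
    qed
    moreover have "psl M = psl (?T q ** (mat_b ** N))"
      unfolding psl_eq_iff using M by blast
    ultimately show ?thesis
      by metis
  qed
qed

interpretation PSL2Z: free_order23 PSL2Z gen_b gen_c
proof
  show "reduced w \<Longrightarrow> PSL2Z.ev w = \<one>\<^bsub>PSL2Z\<^esub> \<Longrightarrow> w = []" for w
    using ev_ne_one by blast
  show "x \<in> carrier PSL2Z \<Longrightarrow> \<exists>w. PSL2Z.ev w = x" for x
    by (auto simp: carrier_PSL2Z psl_eq_ev)
qed

section \<open>Torsion elements and proper powers\<close>

instance letter :: finite
proof
  have "(UNIV :: letter set) = {B, C, D}"
    by (auto intro: letter.exhaust)
  then show "finite (UNIV :: letter set)"
    by (metis finite.emptyI finite_insert)
qed

abbreviation wpow :: "letter list \<Rightarrow> nat \<Rightarrow> letter list" where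
  "wpow v m \<equiv> concat (replicate m v)"

lemma wpow_inj:
  assumes "wpow v m = wpow v' m" "m > 0"
  shows "v = v'"
proof -
  have "m * length v = m * length v'"
    using arg_cong[OF assms(1), of length] by (simp add: length_concat sum_list_replicate)
  then have "length v = length v'"
    using assms(2) by simp
  moreover obtain l where "m = Suc l"
    using assms(2) by (cases m) auto
  ultimately show ?thesis
    using assms(1) by simp
qed

lemma wpow_rotate: "wpow (x # v) m @ [x] = x # wpow (v @ [x]) m"
  by (induction m) auto

text \<open>Only mutually inverse ends are stripped, so that \<open>w\<close> stays a literal
  concatenation. Two equal ends \<open>C\<close> or \<open>D\<close> remain, although they would
  fuse cyclically; they lead to the twisted powers.\<close>

lemma cyclic_reduction:
  "reduced w \<Longrightarrow> w \<noteq> [] \<Longrightarrow>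
    \<exists>u v. w = winv u @ v @ u \<and> v \<noteq> [] \<and> (length v = 1 \<or> hd v \<noteq> linv (last v))"
proof (induction "length w" arbitrary: w rule: less_induct)
  case less
  show ?case
  proof (cases "length w = 1 \<or> hd w \<noteq> linv (last w)")
    case True
    then show ?thesis
      using less.prems by (intro exI[of _ "[]"] exI[of _ w]) auto
  next
    case False
    then obtain x w' where w': "w = x # w'" "w' \<noteq> []"
      using less.prems by (cases w) auto
    define w2 where "w2 = butlast w'"
    define y where "y = last w'"
    have w: "w = x # w2 @ [y]" "x = linv y"
      using w' False by (auto simp: w2_def y_def)
    have "w2 \<noteq> []"
      using less.prems w by auto
    moreover have "reduced w2"
      using less.prems w by (auto simp: reduced_append reduced_Cons)
    ultimately obtain u v where "w2 = winv u @ v @ u" "v \<noteq> []" "length v = 1 \<or> hd v \<noteq> linv (last v)"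
      using less.hyps[of w2] w by auto
    then show ?thesis
      using w by (intro exI[of _ "u @ [y]"] exI[of _ v]) auto
  qed
qed

text \<open>The pairs are the factors \<open>(k, h)\<close> of a conjugate of a letter; cutting next
  to the middle letter leaves \<open>u\<close> readable from either half.\<close>

definition torsion_family :: "letter \<Rightarrow> (letter list \<times> letter list) set" where
  "torsion_family x = {(winv u @ [x], u) | u. True}"

text \<open>The cut comes before the last period. With \<open>a\<close> and \<open>m\<close> fixed,
  either half determines \<open>u\<close> and \<open>v\<close>: the length of \<open>u\<close> is
  known, and for \<open>m \<ge> 2\<close> at least one copy of \<open>v\<close> remains on each
  side.\<close>

definition power_family :: "nat \<Rightarrow> nat \<Rightarrow> (letter list \<times> letter list) set" where
  "power_family a m = {(winv u @ wpow v (m - 1), v @ u) | u v. length u = a \<and> v \<noteq> []}"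

text \<open>Here \<open>[i] @ v @ [i]\<close> is conjugate to \<open>v @ [linv i]\<close>, which is cyclically reduced.\<close>

definition twisted_power_family :: "letter \<Rightarrow> nat \<Rightarrow> nat \<Rightarrow> (letter list \<times> letter list) set" where
  "twisted_power_family i a m =
    {(winv u @ [i] @ wpow (v @ [linv i]) (m - 1), v @ [i] @ u) | u v. length u = a}"

lemma winv_inj: "winv u = winv v \<longleftrightarrow> u = v"
  by (metis winv_simps(4))

lemma torsion_family_inj: "inj_on fst (torsion_family x)" "inj_on snd (torsion_family x)"
  by (auto simp: torsion_family_def inj_on_def winv_inj)

lemma power_family_inj:
  "m \<ge> 2 \<Longrightarrow> inj_on fst (power_family a m)" "inj_on snd (power_family a m)"
proof -
  show "inj_on fst (power_family a m)" if "m \<ge> 2"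
  proof (rule inj_onI)
    fix q q' assume "q \<in> power_family a m" "q' \<in> power_family a m" and eq: "fst q = fst q'"
    then obtain u v u' v' where q: "q = (winv u @ wpow v (m - 1), v @ u)" "length u = a"
      "q' = (winv u' @ wpow v' (m - 1), v' @ u')" "length u' = a"
      by (auto simp: power_family_def)
    then have "u = u'" "wpow v (m - 1) = wpow v' (m - 1)"
      using eq by (auto simp: winv_inj)
    then show "q = q'"
      using wpow_inj[of "m - 1" v v'] that by (simp add: q)
  qed
  show "inj_on snd (power_family a m)"
    by (auto simp: power_family_def inj_on_def)
qed

lemma twisted_power_family_inj:
  "m \<ge> 2 \<Longrightarrow> inj_on fst (twisted_power_family i a m)" "inj_on snd (twisted_power_family i a m)"
proof -
  show "inj_on fst (twisted_power_family i a m)" if "m \<ge> 2"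
  proof (rule inj_onI)
    fix q q' assume "q \<in> twisted_power_family i a m" "q' \<in> twisted_power_family i a m" and eq: "fst q = fst q'"
    then obtain u v u' v' where q: "q = (winv u @ [i] @ wpow (v @ [linv i]) (m - 1), v @ [i] @ u)" "length u = a"
      "q' = (winv u' @ [i] @ wpow (v' @ [linv i]) (m - 1), v' @ [i] @ u')" "length u' = a"
      by (auto simp: twisted_power_family_def)
    then have "u = u'" "wpow (v @ [linv i]) (m - 1) = wpow (v' @ [linv i]) (m - 1)"
      using eq by (auto simp: winv_inj)
    then show "q = q'"
      using wpow_inj[of "m - 1" "v @ [linv i]" "v' @ [linv i]"] that by (simp add: q)
  qed
  show "inj_on snd (twisted_power_family i a m)"
  proof (rule inj_onI)
    fix q q' assume "q \<in> twisted_power_family i a m" "q' \<in> twisted_power_family i a m" and eq: "snd q = snd q'"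
    then obtain u v u' v' where q: "q = (winv u @ [i] @ wpow (v @ [linv i]) (m - 1), v @ [i] @ u)" "length u = a"
      "q' = (winv u' @ [i] @ wpow (v' @ [linv i]) (m - 1), v' @ [i] @ u')" "length u' = a"
      by (auto simp: twisted_power_family_def)
    then have "v @ [i] = v' @ [i] \<and> u = u'"
      using eq by (subst append_eq_append_conv[symmetric]) auto
    then show "q = q'"
      by (simp add: q)
  qed
qed

definition exceptional :: "letter list set" where
  "exceptional = {[]} \<union> {u @ v | u v x. (u, v) \<in> torsion_family x} \<union>
    {u @ v | u v a m. m \<ge> 2 \<and> (u, v) \<in> power_family a m} \<union>
    {u @ v | u v a m i. m \<ge> 2 \<and> (u, v) \<in> twisted_power_family i a m}"

section \<open>Coefficients of powers on the exceptional words\<close>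

locale free_ga = free_order23 + ga_element
begin

text \<open>The length of the longest step of a walk; inserting 0 keeps \<open>Max\<close>
  meaningful when the support is empty.\<close>

definition rad :: nat where "rad = Max (insert 0 ((\<lambda>g. length (nf g)) ` supp))"

definition nball :: "'a set" where "nball = {z \<in> carrier G. length (nf z) \<le> rad}"

lemma length_nf_le_rad: "g \<in> supp \<Longrightarrow> length (nf g) \<le> rad"
  unfolding rad_def by (rule Max_ge) (use finite_supp in auto)

lemma nf_one: "nf \<one> = []"
  using nf_ev[of "[]"] by simp

lemma finite_nball: "finite nball"
proof (rule finite_subset)
  show "nball \<subseteq> ev ` {w. set w \<subseteq> UNIV \<and> length w \<le> rad}"
    using nf by (force simp: nball_def)
  show "finite (ev ` {w. set w \<subseteq> UNIV \<and> length w \<le> rad})"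
    by (intro finite_imageI finite_lists_length_le) simp
qed

lemma one_in_nball: "\<one> \<in> nball"
  by (simp add: nball_def nf_one)

text \<open>The region \<open>?V q\<close> consists of the elements whose normal form ends in the
  second factor. A step can enter it only within \<open>rad\<close> letters of that factor: farther
  out, undoing the step would leave the suffix intact, so the previous point would already lie in
  the region.\<close>

lemma sum_pw_words:
  assumes fin: "finite S" and red: "\<And>u v. (u, v) \<in> S \<Longrightarrow> reduced (u @ v)"
    and inj: "inj_on fst S" "inj_on snd S"
  shows "(\<Sum>(u, v)\<in>S. cmod (pw p (ev (u @ v)))) \<le> (real (p + 1) * card nball)\<^sup>2 * \<kappa> ^ p"
proof -
  let ?V = "\<lambda>q. {y \<in> carrier G. \<exists>z. nf y = z @ snd q}"
  have red': "reduced (fst q)" "reduced (snd q)" "reduced (fst q @ snd q)" if "q \<in> S" for q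
    using red[of "fst q" "snd q"] that by (auto simp: reduced_append)
  have "(\<Sum>q\<in>S. cmod (pw p (ev (fst q) \<otimes> ev (snd q)))) \<le> (real (p + 1) * card nball)\<^sup>2 * \<kappa> ^ p"
  proof (rule sum_pw_through_cut[where V = ?V])
    show "inj_on (\<lambda>q. ev (snd q)) S"
      using ev_inj red' inj(2) unfolding inj_on_def by blast
    show "inj_on (\<lambda>q. ev (fst q)) S"
      using ev_inj red' inj(1) unfolding inj_on_def by blast
    \<comment> \<open>The identity lies in the region only if the suffix is empty, and then it
      belongs to the cut.\<close>
    show "\<one> \<in> (\<lambda>z. z \<otimes> ev (snd q)) ` nball" if "q \<in> S" "\<one> \<in> ?V q" for q
      using that one_in_nball by (auto simp: nf_one intro!: image_eqI[of _ _ \<one>])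
    show "ev (fst q) \<otimes> ev (snd q) \<in> ?V q" if "q \<in> S" for q
      using nf_ev[OF red'(3)[OF that]] by (auto simp: ev_append)
    show "g \<otimes> y \<in> (\<lambda>z. z \<otimes> ev (snd q)) ` nball"
      if q: "q \<in> S" and y: "y \<in> carrier G" "y \<notin> ?V q" and g: "g \<in> supp" and gy: "g \<otimes> y \<in> ?V q" for q y g
    proof -
      have gc: "g \<in> carrier G" using g supp_carrier by blast
      obtain z where z: "nf (g \<otimes> y) = z @ snd q"
        using gy by auto
      have len: "length z \<le> rad"
      proof (rule ccontr)
        assume "\<not> length z \<le> rad"
        then have "length (winv (nf g)) \<le> length z"
          using length_nf_le_rad[OF g] by simp
        from suffix_foldr_push[OF this] obtain z' where "foldr push (winv (nf g)) (z @ snd q) = z' @ snd q"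
          by blast
        moreover have "nf (inv g \<otimes> (g \<otimes> y)) = foldr push (winv (nf g)) (z @ snd q)"
          using gc y by (subst nf_mult) (auto simp: nf_inv z)
        ultimately have "nf y = z' @ snd q"
          using gc y by (simp add: inv_mult_cancel_left)
        then show False using y by blast
      qed
      have "reduced z"
        using nf(1)[of "g \<otimes> y"] gc y z by (simp add: reduced_append)
      moreover have "g \<otimes> y = ev z \<otimes> ev (snd q)"
        using nf(2)[of "g \<otimes> y"] gc y z by (simp add: ev_append)
      ultimately show ?thesis
        using len by (auto simp: nball_def nf_ev intro!: image_eqI[of _ _ "ev z"])
    qed
  qed (use fin finite_nball one_in_nball in \<open>auto simp: nball_def\<close>)
  then show ?thesis
    by (simp add: ev_append case_prod_beta)
qed

lemma length_foldr_push: "length (foldr push u v) \<le> length u + length v"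
proof (induction u)
  case (Cons x u)
  have "length (push x w) \<le> Suc (length w)" for w
    by (cases x; cases w; cases "hd w") auto
  from this[of "foldr push u v"] Cons show ?case by simp
qed simp

lemma pw_support:
  "x \<in> carrier G \<Longrightarrow> pw p x \<noteq> 0 \<Longrightarrow> length (nf x) \<le> rad * p"
proof (induction p arbitrary: x)
  case 0
  moreover have "pw 0 x = \<delta> \<one> x"
    by (simp only: ga_pow funpow_0)
  ultimately have "x = \<one>"
    unfolding \<delta>_def by metis
  then show ?case
    by (simp add: nf_one)
next
  case (Suc p)
  have "pw (Suc p) = T (pw p)"
    unfolding ga_pow by simp
  then have "(\<Sum>g\<in>supp. \<alpha> g * pw p (inv g \<otimes> x)) \<noteq> 0"
    using Suc.prems by (simp add: T_eq)
  then obtain g where g: "g \<in> supp" "\<alpha> g * pw p (inv g \<otimes> x) \<noteq> 0"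
    by (rule sum.not_neutral_contains_not_neutral)
  have gc: "g \<in> carrier G" using g supp_carrier by blast
  have "nf x = foldr push (nf g) (nf (inv g \<otimes> x))"
    using gc Suc.prems by (subst nf_mult[symmetric]) (auto simp: mult_inv_cancel_left)
  then have "length (nf x) \<le> length (nf g) + length (nf (inv g \<otimes> x))"
    by (simp add: length_foldr_push)
  also have "\<dots> \<le> rad + rad * p"
    using Suc.IH[of "inv g \<otimes> x"] g gc Suc.prems by (intro add_mono length_nf_le_rad) auto
  finally show ?case by simp
qed

lemma sum_family_le:
  assumes inj: "inj_on fst F" "inj_on snd F"
  shows "(\<Sum>w\<in>{w. reduced w \<and> length w \<le> n \<and> w \<in> {u @ v | u v. (u, v) \<in> F}}. cmod (pw p (ev w)))
    \<le> (real (p + 1) * card nball)\<^sup>2 * \<kappa> ^ p"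
proof -
  define S where "S = {(u, v). (u, v) \<in> F \<and> reduced (u @ v) \<and> length (u @ v) \<le> n}"
  have "S \<subseteq> {u. set u \<subseteq> UNIV \<and> length u \<le> n} \<times> {u. set u \<subseteq> UNIV \<and> length u \<le> n}"
    by (auto simp: S_def)
  then have fin: "finite S"
    by (rule finite_subset) (intro finite_cartesian_product finite_lists_length_le finite)
  have eq: "{w. reduced w \<and> length w \<le> n \<and> w \<in> {u @ v | u v. (u, v) \<in> F}} = (\<lambda>(u, v). u @ v) ` S"
    by (auto simp: S_def image_iff)
  \<comment> \<open>One word may arise from several pairs, so passing to pairs can only enlarge the
    sum.\<close>
  have "(\<Sum>w\<in>(\<lambda>(u, v). u @ v) ` S. cmod (pw p (ev w))) \<le>
      (\<Sum>q\<in>S. cmod (pw p (ev (case q of (u, v) \<Rightarrow> u @ v))))"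
    by (rule sum_image_le[OF fin, of "\<lambda>w. cmod (pw p (ev w))", unfolded comp_def]) simp
  also have "\<dots> = (\<Sum>(u, v)\<in>S. cmod (pw p (ev (u @ v))))"
    by (intro sum.cong) auto
  also have "\<dots> \<le> (real (p + 1) * card nball)\<^sup>2 * \<kappa> ^ p"
    by (rule sum_pw_words[OF fin]) (auto simp: S_def intro: inj_on_subset[OF inj(1)] inj_on_subset[OF inj(2)])
  finally show ?thesis
    unfolding eq .
qed

lemma sum_exceptional_le:
  "(\<Sum>w\<in>{w. reduced w \<and> length w \<le> n \<and> w \<in> exceptional}. cmod (pw p (ev w)))
    \<le> 8 * (real n + 1)\<^sup>2 * ((real (p + 1) * card nball)\<^sup>2 * \<kappa> ^ p)"
proof -
  let ?K = "(real (p + 1) * card nball)\<^sup>2 * \<kappa> ^ p"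
  define W where "W F = {w. reduced w \<and> length w \<le> n \<and> w \<in> {u @ v | u v. (u, v) \<in> F}}" for F
  have finW: "finite (W F)" for F
    using finite_lists_length_le[of "UNIV :: letter set" n]
    by (rule finite_subset[rotated]) (auto simp: W_def)
  \<comment> \<open>The singleton accounts for the empty word. An \<open>m\<close>-th power occupies
    at least \<open>m\<close> letters, so \<open>a\<close> and \<open>m\<close> are at most
    \<open>n\<close>, and the number of families is quadratic in \<open>n\<close>.\<close>
  define Fs where "Fs = {{([], [])}} \<union> range torsion_family \<union>
    (\<lambda>(a, m). power_family a m) ` ({..n} \<times> {2..n}) \<union>
    (\<lambda>(i, a, m). twisted_power_family i a m) ` (UNIV \<times> {..n} \<times> {2..n})"
  have finF: "finite Fs"
    by (simp add: Fs_def)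
  have UNIV_letter: "(UNIV :: letter set) = {B, C, D}"
    by (auto intro: letter.exhaust)
  have "card Fs \<le> 1 + 3 + (n + 1) * (n - 1) + 3 * ((n + 1) * (n - 1))"
  proof -
    have 1: "card (range torsion_family) \<le> 3"
      using card_image_le[of "UNIV :: letter set" torsion_family] by (simp add: UNIV_letter)
    have 2: "card ((\<lambda>(a, m). power_family a m) ` ({..n} \<times> {2..n})) \<le> (n + 1) * (n - 1)"
      using card_image_le[of "{..n} \<times> {2..n}" "\<lambda>(a, m). power_family a m"] by (simp add: card_cartesian_product)
    have 3: "card ((\<lambda>(i, a, m). twisted_power_family i a m) ` (UNIV \<times> {..n} \<times> {2..n})) \<le> 3 * ((n + 1) * (n - 1))"
      using card_image_le[of "UNIV \<times> {..n} \<times> {2..n}" "\<lambda>(i, a, m). twisted_power_family i a m"]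
      by (simp add: card_cartesian_product UNIV_letter)
    show ?thesis
      unfolding Fs_def by (intro order.trans[OF card_Un_le] add_mono 1 2 3) simp
  qed
  also have "\<dots> \<le> 8 * (n + 1)\<^sup>2"
    by (cases n) (simp_all add: power2_eq_square)
  finally have "real (card Fs) \<le> real (8 * (n + 1)\<^sup>2)"
    unfolding of_nat_le_iff .
  then have card: "real (card Fs) \<le> 8 * (real n + 1)\<^sup>2"
    by (simp add: add.commute)
  have "inj_on fst F \<and> inj_on snd F" if "F \<in> Fs" for F
    using that torsion_family_inj power_family_inj twisted_power_family_inj by (auto simp: Fs_def)
  then have le: "(\<Sum>w\<in>W F. cmod (pw p (ev w))) \<le> ?K" if "F \<in> Fs" for F
    unfolding W_def using that sum_family_le by blast
  have sub: "{w. reduced w \<and> length w \<le> n \<and> w \<in> exceptional} \<subseteq> (\<Union>F\<in>Fs. W F)"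
  proof
    fix w assume "w \<in> {w. reduced w \<and> length w \<le> n \<and> w \<in> exceptional}"
    then have w: "reduced w" "length w \<le> n" "w \<in> exceptional" by auto
    have "\<exists>F\<in>Fs. \<exists>u v. w = u @ v \<and> (u, v) \<in> F"
    proof -
      consider "w = []" | u v x where "w = u @ v" "(u, v) \<in> torsion_family x"
        | u v a m where "w = u @ v" "m \<ge> 2" "(u, v) \<in> power_family a m"
        | u v a m i where "w = u @ v" "m \<ge> 2" "(u, v) \<in> twisted_power_family i a m"
        using w(3) by (auto simp: exceptional_def)
      then show ?thesis
      proof cases
        case 1
        then show ?thesis by (intro bexI[of _ "{([], [])}"]) (auto simp: Fs_def)
      next
        case (2 u v x)
        then show ?thesis by (intro bexI[of _ "torsion_family x"]) (auto simp: Fs_def)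
      next
        case (3 u v a m)
        obtain y z where yz: "u = winv y @ wpow z (m - 1)" "v = z @ y" "length y = a" "z \<noteq> []"
          using 3 by (auto simp: power_family_def)
        have len: "length z \<ge> 1" using yz by (cases z) auto
        then have "m - 1 \<le> (m - 1) * length z" by simp
        moreover have "length w = a + (m - 1) * length z + length z + a"
          using 3 yz by (simp add: length_concat sum_list_replicate)
        ultimately have "a \<le> n" "m \<le> n"
          using w(2) len by linarith+
        then show ?thesis using 3 by (intro bexI[of _ "power_family a m"]) (auto simp: Fs_def)
      next
        case (4 u v a m i)
        obtain y z where yz: "u = winv y @ [i] @ wpow (z @ [linv i]) (m - 1)" "v = z @ [i] @ y" "length y = a"
          using 4 by (auto simp: twisted_power_family_def)
        have "m - 1 \<le> (m - 1) * length (z @ [linv i])" by simp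
        moreover have "length w = a + 1 + (m - 1) * length (z @ [linv i]) + length z + 1 + a"
          using 4 yz by (simp add: length_concat sum_list_replicate)
        ultimately have "a \<le> n" "m \<le> n"
          using w(2) by linarith+
        then show ?thesis using 4
          by (intro bexI[of _ "twisted_power_family i a m"]) (auto simp: Fs_def intro!: rev_image_eqI[of "(i, a, m)"])
      qed
    qed
    then show "w \<in> (\<Union>F\<in>Fs. W F)"
      using w by (auto simp: W_def)
  qed
  have UN_le: "(\<Sum>w\<in>(\<Union>F\<in>A. W F). cmod (pw p (ev w))) \<le> (\<Sum>F\<in>A. \<Sum>w\<in>W F. cmod (pw p (ev w)))"
    if "finite A" for A
    using that
  proof (induction A rule: finite_induct)
    case (insert F A)
    have "(\<Sum>w\<in>W F \<union> (\<Union>F\<in>A. W F). cmod (pw p (ev w))) \<le>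
        (\<Sum>w\<in>W F. cmod (pw p (ev w))) + (\<Sum>w\<in>(\<Union>F\<in>A. W F). cmod (pw p (ev w)))"
      using finW insert.hyps by (subst sum_Un) (auto intro!: sum_nonneg)
    then show ?case using insert by simp
  qed simp
  have "(\<Sum>w\<in>{w. reduced w \<and> length w \<le> n \<and> w \<in> exceptional}. cmod (pw p (ev w))) \<le>
      (\<Sum>w\<in>(\<Union>F\<in>Fs. W F). cmod (pw p (ev w)))"
    by (rule sum_mono2[OF _ sub]) (use finW finF in auto)
  also have "\<dots> \<le> (\<Sum>F\<in>Fs. \<Sum>w\<in>W F. cmod (pw p (ev w)))"
    by (rule UN_le[OF finF])
  also have "\<dots> \<le> (\<Sum>F\<in>Fs. ?K)"
    by (intro sum_mono le)
  also have "\<dots> = card Fs * ?K" by simp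
  also have "\<dots> \<le> 8 * (real n + 1)\<^sup>2 * ?K"
    by (intro mult_right_mono card mult_nonneg_nonneg zero_le_power \<kappa>_nonneg) simp_all
  finally show ?thesis .
qed

end

section \<open>The function \<open>u1\<close>\<close>

lemma ord_eq_prime_iff:
  assumes "group G" "x \<in> carrier G" "prime (q :: nat)"
  shows "group.ord G x = q \<longleftrightarrow> x [^]\<^bsub>G\<^esub> q = \<one>\<^bsub>G\<^esub> \<and> x \<noteq> \<one>\<^bsub>G\<^esub>"
proof -
  interpret group G by fact
  have "ord x = q \<longleftrightarrow> ord x dvd q \<and> ord x \<noteq> 1"
    using assms(3) prime_nat_iff[of q] by auto
  then show ?thesis
    using assms(2) by (simp only: pow_eq_id ord_eq_1)
qed

lemma sym_group_pow: "p [^]\<^bsub>sym_group N\<^esub> (m :: nat) = p ^^ m"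
proof (induction m)
  case (Suc m)
  have "p [^]\<^bsub>sym_group N\<^esub> Suc m = p [^]\<^bsub>sym_group N\<^esub> m \<circ> p"
    by (simp add: nat_pow_def sym_group_mult)
  then show ?case
    by (simp only: Suc funpow_Suc_right)
qed (simp add: nat_pow_def sym_group_one)

text \<open>For prime \<open>q\<close>, order \<open>q\<close> means that the \<open>q\<close>-th
  power is the identity but the permutation is not; the latter follows from moving a point. At
  \<open>n = 0\<close> the left side is empty while the right side is not.\<close>

lemma perm_pairs_eq:
  assumes n: "n > 0"
  shows "perm_pairs n = fpf_perms 2 {1..6 * n} \<times> fpf_perms 3 {1..6 * n}"
proof -
  have "p \<in> carrier (sym_group (6 * n)) \<and> group.ord (sym_group (6 * n)) p = q \<and> (\<forall>i\<in>{1..6 * n}. p i \<noteq> i) \<longleftrightarrow>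
      p \<in> fpf_perms q {1..6 * n}" if q: "prime q" for p q
  proof -
    have "p \<noteq> id" if "\<forall>i\<in>{1..6 * n}. p i \<noteq> i"
      using that n by (auto dest!: bspec[of _ _ 1])
    then show ?thesis
      using ord_eq_prime_iff[OF sym_group_is_group[of "6 * n"], of p q] q
      by (auto simp: sym_group_carrier sym_group_pow sym_group_one fpf_perms_def fun_eq_iff)
  qed
  from this[of 2] this[of 3] show ?thesis
    unfolding perm_pairs_def by auto
qed

lemma order23_sym_group:
  assumes "s \<in> fpf_perms 2 {1..N}" "t \<in> fpf_perms 3 {1..N}"
  shows "order23 (sym_group N) s t"
proof -
  interpret group "sym_group N" by (rule sym_group_is_group)
  show ?thesis
    using fpf_permsD(1)[OF assms(1)] fpf_permsD(1)[OF assms(2)] fpf_perms_2D[OF assms(1)] fpf_perms_3D[OF assms(2)]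
    by unfold_locales (auto simp: sym_group_carrier sym_group_mult sym_group_one fun_eq_iff)
qed

abbreviation perm_word :: "nat \<Rightarrow> (nat \<Rightarrow> nat) \<times> (nat \<Rightarrow> nat) \<Rightarrow> letter list \<Rightarrow> nat \<Rightarrow> nat" where
  "perm_word N st \<equiv> monoid.word_eval (sym_group N) (fst st) (snd st)"

definition fix_count :: "nat \<Rightarrow> (nat \<Rightarrow> nat) \<Rightarrow> nat" where
  "fix_count N p = card {i \<in> {1..N}. p i = i}"

definition mean_fix :: "nat \<Rightarrow> letter list \<Rightarrow> real" where
  "mean_fix n w = (\<Sum>st\<in>perm_pairs n. real (fix_count (6 * n) (perm_word (6 * n) st w))) / card (perm_pairs n)"

lemma perm_pairsD:
  assumes "n > 0" "st \<in> perm_pairs n"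
  shows "order23 (sym_group (6 * n)) (fst st) (snd st)"
    "fst st \<in> fpf_perms 2 {1..6 * n}" "snd st \<in> fpf_perms 3 {1..6 * n}"
  using assms order23_sym_group by (auto simp: perm_pairs_eq)

lemma finite_perm_pairs: "n > 0 \<Longrightarrow> finite (perm_pairs n)"
  by (simp add: perm_pairs_eq finite_fpf_perms)

lemma card_perm_pairs: "n > 0 \<Longrightarrow> card (perm_pairs n) = count2 (3 * n) * count3 (2 * n)"
  using card_fpf_perms_2[of "{1..6 * n}" "3 * n"] card_fpf_perms_3[of "{1..6 * n}" "2 * n"]
  by (simp add: perm_pairs_eq card_cartesian_product)

lemma card_perm_pairs_pos: "n > 0 \<Longrightarrow> card (perm_pairs n) > 0"
  using count_pos by (simp add: card_perm_pairs)

lemma trPi_ev: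
  assumes n: "n > 0" and st: "st \<in> perm_pairs n"
  shows "trPi n (PSL2Z.ev w) st = (of_nat (fix_count (6 * n) (perm_word (6 * n) st w)) - 1) / of_nat (6 * n)"
proof -
  note H = perm_pairsD(1)[OF assms]
  interpret H: order23 "sym_group (6 * n)" "fst st" "snd st" by (rule H)
  have "Phi n st (PSL2Z.ev w) = perm_word (6 * n) st w"
    using PSL2Z.the_lift[OF H] PSL2Z.lift_ev[OF H, of w] by (simp add: Phi_def case_prod_beta)
  moreover have "perm_word (6 * n) st w permutes {1..6 * n}"
    using H.ev_closed[of w] by (simp only: sym_group_carrier)
  ultimately show ?thesis
    using n endo_trace_std[of "6 * n" "perm_word (6 * n) st w"] by (simp add: trPi_def fix_count_def)
qed

text \<open>The normalisation of the trace cancels the factor \<open>6 * n\<close> in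
  \<open>u1\<close>, so only the limit of \<open>mean_fix\<close> matters.\<close>

lemma expect_trPi_ev:
  assumes n: "n > 0"
  shows "of_nat (6 * n) * expect_trPi n (PSL2Z.ev w) = complex_of_real (mean_fix n w - 1)"
proof -
  let ?P = "perm_pairs n"
  let ?f = "\<lambda>st. real (fix_count (6 * n) (perm_word (6 * n) st w))"
  have fin: "finite ?P" and ne: "?P \<noteq> {}"
    using finite_perm_pairs[OF n] card_perm_pairs_pos[OF n] by auto
  have "expect_trPi n (PSL2Z.ev w) = (\<Sum>st\<in>?P. pmf (pmf_of_set ?P) st *\<^sub>R trPi n (PSL2Z.ev w) st)"
    unfolding expect_trPi_def by (rule integral_measure_pmf[OF fin]) (use fin ne in simp)
  also have "\<dots> = (\<Sum>st\<in>?P. complex_of_real ((?f st - 1) / (card ?P * (6 * n))))"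
    by (intro sum.cong refl) (simp add: trPi_ev[OF n] fin ne scaleR_conv_of_real)
  also have "\<dots> = complex_of_real ((\<Sum>st\<in>?P. ?f st - 1) / (card ?P * (6 * n)))"
    by (simp add: sum_divide_distrib)
  also have "(\<Sum>st\<in>?P. ?f st - 1) = (mean_fix n w - 1) * card ?P"
    using card_perm_pairs_pos[OF n] by (simp add: mean_fix_def sum_subtractf left_diff_distrib)
  finally show ?thesis
    using n card_perm_pairs_pos[OF n] by simp
qed

lemma u1_ev:
  assumes w: "reduced w" "w \<noteq> []" and lim: "(\<lambda>n. mean_fix n w) \<longlonglongrightarrow> L"
  shows "u1 (PSL2Z.ev w) = of_real (L - 1)"
proof -
  have "PSL2Z.ev w \<noteq> \<one>\<^bsub>PSL2Z\<^esub>"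
    using w PSL2Z.free by blast
  then have u0: "u0 (PSL2Z.ev w) = 0" by (simp add: u0_def)
  have "(\<lambda>n. complex_of_real (mean_fix n w - 1)) \<longlonglongrightarrow> of_real (L - 1)"
    by (intro tendsto_of_real tendsto_diff lim tendsto_const)
  moreover have "\<forall>\<^sub>F n in sequentially. complex_of_real (mean_fix n w - 1) =
      of_nat (6 * n) * (expect_trPi n (PSL2Z.ev w) - u0 (PSL2Z.ev w))"
    using eventually_gt_at_top[of 0] by eventually_elim (simp only: u0 diff_0_right expect_trPi_ev)
  ultimately show ?thesis
    unfolding u1_def by (intro limI) (rule Lim_transform_eventually)
qed

text \<open>The standard representation has dimension \<open>6 * n - 1\<close>, so the normalised
  trace at the identity falls short of 1 by exactly \<open>1 / (6 * n)\<close>.\<close>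

lemma u1_one: "u1 \<one>\<^bsub>PSL2Z\<^esub> = -1"
proof -
  have "of_nat (6 * n) * (expect_trPi n \<one>\<^bsub>PSL2Z\<^esub> - u0 \<one>\<^bsub>PSL2Z\<^esub>) = -1" if n: "n > 0" for n
  proof -
    have "fix_count (6 * n) (perm_word (6 * n) st []) = 6 * n" if "st \<in> perm_pairs n" for st
    proof -
      interpret H: order23 "sym_group (6 * n)" "fst st" "snd st" by (rule perm_pairsD(1)[OF n that])
      have "{i \<in> {1..6 * n}. id i = i} = {1..6 * n}" by auto
      then have "card {i \<in> {1..6 * n}. id i = i} = 6 * n" by simp
      then show ?thesis by (simp only: fix_count_def sym_group_one H.word_eval.simps)
    qed
    then have "mean_fix n [] = 6 * n"
      using card_perm_pairs_pos[OF n] by (simp add: mean_fix_def)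
    then show ?thesis
      using expect_trPi_ev[OF n, of "[]"] by (simp add: u0_def right_diff_distrib)
  qed
  then have "\<forall>\<^sub>F n in sequentially. -1 = of_nat (6 * n) * (expect_trPi n \<one>\<^bsub>PSL2Z\<^esub> - u0 \<one>\<^bsub>PSL2Z\<^esub>)"
    by (intro eventually_mono[OF eventually_gt_at_top[of 0]]) (rule sym)
  then show ?thesis
    unfolding u1_def by (intro limI) (rule Lim_transform_eventually[OF tendsto_const])
qed

section \<open>Conjugation invariance of the mean number of fixed points\<close>

lemma mean_fix_cong:
  assumes "\<And>st. st \<in> perm_pairs n \<Longrightarrow>
    fix_count (6 * n) (perm_word (6 * n) st v) = fix_count (6 * n) (perm_word (6 * n) st w)"
  shows "mean_fix n v = mean_fix n w"
  using assms by (simp add: mean_fix_def)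

lemma fix_count_conj:
  assumes q: "q permutes {1..N}" and eq: "q \<circ> p = r \<circ> q"
  shows "fix_count N p = fix_count N r"
  unfolding fix_count_def
proof (rule bij_betw_same_card)
  have "r (q i) = q i \<longleftrightarrow> p i = i" for i
  proof -
    have "r (q i) = q (p i)"
      using fun_cong[OF eq, of i] by simp
    then show ?thesis
      by (simp add: inj_eq[OF permutes_inj[OF q]])
  qed
  then show "bij_betw q {i \<in> {1..N}. p i = i} {i \<in> {1..N}. r i = i}"
    using permutes_imp_bij[OF q] by (intro bij_betw_Collect) auto
qed

lemma (in order23) ev_conj: "ev u \<otimes> ev (winv u @ v @ u) = ev v \<otimes> ev u"
  by (simp add: ev_append ev_winv mult_inv_cancel_left)

lemma mean_fix_conj:
  assumes n: "n > 0"
  shows "mean_fix n (winv u @ v @ u) = mean_fix n v"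
proof (rule mean_fix_cong)
  fix st assume st: "st \<in> perm_pairs n"
  interpret H: order23 "sym_group (6 * n)" "fst st" "snd st" by (rule perm_pairsD(1)[OF n st])
  have "H.ev u \<otimes>\<^bsub>sym_group (6 * n)\<^esub> H.ev (winv u @ v @ u) = H.ev v \<otimes>\<^bsub>sym_group (6 * n)\<^esub> H.ev u"
    by (rule H.ev_conj)
  then have "H.ev u \<circ> H.ev (winv u @ v @ u) = H.ev v \<circ> H.ev u"
    by (simp only: sym_group_mult)
  moreover have "H.ev u permutes {1..6 * n}"
    using H.ev_closed[of u] by (simp only: sym_group_carrier)
  ultimately show "fix_count (6 * n) (perm_word (6 * n) st (winv u @ v @ u)) =
      fix_count (6 * n) (perm_word (6 * n) st v)"
    by (intro fix_count_conj)
qed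

lemma mean_fix_rotate:
  assumes n: "n > 0"
  shows "mean_fix n (x # y) = mean_fix n (y @ [x])"
proof -
  have "mean_fix n (x # y) = mean_fix n (winv [x] @ (x # y) @ [x])"
    using mean_fix_conj[OF n, of "[x]" "x # y"] by simp
  also have "\<dots> = mean_fix n (y @ [x])"
  proof (rule mean_fix_cong)
    fix st assume st: "st \<in> perm_pairs n"
    interpret H: order23 "sym_group (6 * n)" "fst st" "snd st" by (rule perm_pairsD(1)[OF n st])
    have "H.ev (winv [x] @ (x # y) @ [x]) = H.ev ((winv [x] @ [x]) @ (y @ [x]))"
      by simp
    also have "\<dots> = H.ev (y @ [x])"
      unfolding H.ev_append[of "winv [x] @ [x]"] H.ev_append[of "winv [x]"] H.ev_winv_l by simp
    finally show "fix_count (6 * n) (perm_word (6 * n) st (winv [x] @ (x # y) @ [x])) =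
        fix_count (6 * n) (perm_word (6 * n) st (y @ [x]))"
      by simp
  qed
  finally show ?thesis .
qed

text \<open>Rotation brings the two equal ends together, and their product is the inverse
  letter.\<close>

lemma mean_fix_twisted:
  assumes n: "n > 0" and i: "i \<noteq> B"
  shows "mean_fix n (i # v @ [i]) = mean_fix n (v @ [linv i])"
  unfolding mean_fix_rotate[OF n]
proof (rule mean_fix_cong)
  fix st assume st: "st \<in> perm_pairs n"
  interpret H: order23 "sym_group (6 * n)" "fst st" "snd st" by (rule perm_pairsD(1)[OF n st])
  have "H.ev [i, i] = H.ev [linv i]"
    using i by (cases i) (auto simp: H.m_assoc H.ccc')
  then have "H.ev (v @ [i, i]) = H.ev (v @ [linv i])"
    by (simp only: H.ev_append)
  then show "fix_count (6 * n) (perm_word (6 * n) st ((v @ [i]) @ [i])) =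
      fix_count (6 * n) (perm_word (6 * n) st (v @ [linv i]))"
    by simp
qed

lemma mean_fix_letter:
  assumes n: "n > 0"
  shows "mean_fix n [x] = 0"
proof -
  have "fix_count (6 * n) (perm_word (6 * n) st [x]) = 0" if st: "st \<in> perm_pairs n" for st
  proof -
    interpret H: order23 "sym_group (6 * n)" "fst st" "snd st" by (rule perm_pairsD(1)[OF n st])
    note s = perm_pairsD(2)[OF n st] and t = perm_pairsD(3)[OF n st]
    have "H.ev [x] i \<noteq> i" if "i \<in> {1..6 * n}" for i
      using fpf_permsD(3)[OF s that] fpf_perms_3_distinct[OF t that]
      by (cases x) (auto simp: sym_group_mult sym_group_one)
    then show ?thesis
      by (simp add: fix_count_def)
  qed
  then show ?thesis
    by (simp add: mean_fix_def)
qed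

section \<open>Alternating words and closed walks\<close>

definition alt_word :: "letter list \<Rightarrow> letter list" where
  "alt_word es = concat (map (\<lambda>x. [B, x]) es)"

lemma alt_word_simps [simp]: "alt_word [] = []" "alt_word (x # es) = B # x # alt_word es"
  "alt_word (es @ fs) = alt_word es @ alt_word fs"
  by (simp_all add: alt_word_def)

lemma alt_word_wpow: "alt_word (wpow es m) = wpow (alt_word es) m"
  by (induction m) auto

lemma length_alt_word: "length (alt_word es) = 2 * length es"
  by (induction es) auto

lemma reduced_alt_word:
  "reduced w \<Longrightarrow> w \<noteq> [] \<Longrightarrow> hd w = B \<Longrightarrow> last w \<noteq> B \<Longrightarrow> \<exists>es. es \<noteq> [] \<and> B \<notin> set es \<and> w = alt_word es"
proof (induction "length w" arbitrary: w rule: less_induct)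
  case less
  then obtain x r where w: "w = B # x # r"
    by (metis hd_Cons_tl last_ConsL)
  show ?case
  proof (cases "r = []")
    case True
    then show ?thesis
      using less.prems w by (intro exI[of _ "[x]"]) auto
  next
    case False
    then have "reduced r" "hd r = B" "last r \<noteq> B"
      using less.prems by (auto simp: w reduced_Cons)
    then obtain es where "es \<noteq> []" "B \<notin> set es" "r = alt_word es"
      using less.hyps[of r] w False by auto
    then show ?thesis
      using less.prems w by (intro exI[of _ "x # es"]) auto
  qed
qed

lemma periodic_list:
  assumes "length xs = m * d" "\<And>j. j + d < length xs \<Longrightarrow> xs ! (j + d) = xs ! j"
  shows "xs = concat (replicate m (take d xs))"
  using assms
proof (induction m arbitrary: xs)
  case (Suc m)
  have per: "drop d xs ! (j + d) = drop d xs ! j" if "j + d < length (drop d xs)" for j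
    using Suc.prems(2)[of "d + j"] that Suc.prems(1) by (simp add: add.assoc add.commute)
  have IH: "drop d xs = concat (replicate m (take d (drop d xs)))"
    by (rule Suc.IH[OF _ per]) (use Suc.prems(1) in auto)
  have eq: "replicate m (take d (drop d xs)) = replicate m (take d xs)"
  proof (cases "m = 0")
    case False
    then have "m * d \<ge> d" by simp
    then have "xs ! (d + j) = xs ! j" if "j < d" for j
      using Suc.prems(2)[of j] Suc.prems(1) less_le_trans[OF that \<open>m * d \<ge> d\<close>] by (simp add: add.commute)
    then have "take d (drop d xs) = take d xs"
      using Suc.prems(1) \<open>m * d \<ge> d\<close> by (intro nth_equalityI) auto
    then show ?thesis by simp
  qed simp
  have "drop d xs = concat (replicate m (take d xs))"
    using IH[unfolded eq] .
  then show ?case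
    using append_take_drop_id[of d xs] by simp
qed simp

lemma mean_fix_alt_word:
  assumes es: "es \<noteq> []" "B \<notin> set es"
  obtains L :: nat where "(\<lambda>n. mean_fix n (alt_word es)) \<longlonglongrightarrow> real L" "1 \<le> L" "L \<le> length es"
    "L \<noteq> 1 \<longrightarrow> (\<exists>v m. m \<ge> 2 \<and> v \<noteq> [] \<and> es = wpow v m)"
proof -
  define k where "k = length es"
  \<comment> \<open>The letters are reversed because the rightmost syllable acts first: after
    \<open>j\<close> steps the walk has read the last \<open>j\<close> syllables.\<close>
  define f where "f j = rev es ! (j mod k)" for j
  define e where "e j = (if f j = C then 1 else 2 :: nat)" for j
  have k: "k > 0" using es by (simp add: k_def)
  interpret cyclic_word k e
    by unfold_locales (auto simp: k e_def f_def)
  have f_nB: "f j \<noteq> B" for j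
  proof -
    have "f j \<in> set (rev es)"
      using k unfolding f_def by (intro nth_mem) (simp add: k_def)
    then show ?thesis using es by auto
  qed
  have walk: "walk (fst st) (snd st) i j = perm_word (6 * n) st (alt_word (drop (k - j) es)) i"
    if n: "n > 0" and st: "st \<in> perm_pairs n" and j: "j \<le> k" for n st i j
    using j
  proof (induction j)
    interpret H: order23 "sym_group (6 * n)" "fst st" "snd st" by (rule perm_pairsD(1)[OF n st])
    {
      case 0
      show ?case by (simp add: k_def sym_group_one)
    next
      case (Suc j)
      have "drop (k - Suc j) es = es ! (k - Suc j) # drop (k - j) es"
        using Suc.prems by (subst Cons_nth_drop_Suc[symmetric]) (auto simp: k_def Suc_diff_Suc)
      moreover have "es ! (k - Suc j) = f j"
        using Suc.prems by (simp add: f_def rev_nth k_def)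
      ultimately show ?case
        using Suc f_nB[of j] by (cases "f j") (auto simp: e_def[of j] sym_group_mult numeral_2_eq_2)
    }
  qed
  have "real (card (closed_walks {1..6 * n})) / real (count2 (3 * n) * count3 (2 * n)) = mean_fix n (alt_word es)"
    if n: "n > 0" for n
  proof -
    let ?P = "fpf_perms 2 {1..6 * n}" and ?Q = "fpf_perms 3 {1..6 * n}"
    have "closed_walks {1..6 * n} = (SIGMA s : ?P. SIGMA t : ?Q. {i \<in> {1..6 * n}. walk s t i k = i})"
      by (auto simp: closed_walks_def)
    then have "card (closed_walks {1..6 * n}) = (\<Sum>s\<in>?P. \<Sum>t\<in>?Q. card {i \<in> {1..6 * n}. walk s t i k = i})"
      by (simp add: card_SigmaI finite_fpf_perms)
    also have "\<dots> = (\<Sum>st\<in>perm_pairs n. card {i \<in> {1..6 * n}. walk (fst st) (snd st) i k = i})"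
      by (simp add: perm_pairs_eq[OF n] sum.cartesian_product case_prod_beta)
    also have "\<dots> = (\<Sum>st\<in>perm_pairs n. fix_count (6 * n) (perm_word (6 * n) st (alt_word es)))"
      by (intro sum.cong refl) (simp add: walk[OF n] fix_count_def)
    finally show ?thesis
      by (simp add: mean_fix_def card_perm_pairs[OF n])
  qed
  then have ev: "\<forall>\<^sub>F n in sequentially. real (card (closed_walks {1..6 * n})) / real (count2 (3 * n) * count3 (2 * n))
      = mean_fix n (alt_word es)"
    by (rule eventually_mono[OF eventually_gt_at_top[of 0]])
  obtain L :: nat where L:
    "(\<lambda>n. real (card (closed_walks {1..6 * n})) / real (count2 (3 * n) * count3 (2 * n))) \<longlonglongrightarrow> real L"
    "1 \<le> L" "L \<le> k" "L \<noteq> 1 \<Longrightarrow> \<exists>d. 0 < d \<and> d < k \<and> d dvd k \<and> (\<forall>j. e (j + d) = e j)"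
    using closed_walks_limit by blast
  have "\<exists>v m. m \<ge> 2 \<and> v \<noteq> [] \<and> es = wpow v m" if L1: "L \<noteq> 1"
  proof -
    obtain d where d: "0 < d" "d < k" "d dvd k" "\<And>j. e (j + d) = e j"
      using L(4)[OF L1] by blast
    then obtain m where m: "k = m * d"
      by (metis dvd_div_mult_self)
    have "m \<ge> 2"
    proof (rule ccontr)
      assume "\<not> m \<ge> 2"
      then have "m = 0 \<or> m = 1" by auto
      then show False using m d by auto
    qed
    have "rev es ! (j + d) = rev es ! j" if "j + d < length (rev es)" for j
    proof -
      have "f (j + d) = f j"
        using d(4)[of j] f_nB[of j] f_nB[of "j + d"]
        by (cases "f j"; cases "f (j + d)") (auto simp: e_def)
      then show ?thesis
        using that by (simp add: f_def k_def)
    qed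
    then have "rev es = concat (replicate m (take d (rev es)))"
      using m by (intro periodic_list) (auto simp: k_def)
    then have "es = wpow (rev (take d (rev es))) m"
      by (metis rev_concat rev_replicate map_replicate rev_rev_ident)
    moreover have "rev (take d (rev es)) \<noteq> []"
      using d(1) es by simp
    ultimately show ?thesis
      using \<open>m \<ge> 2\<close> by blast
  qed
  then show ?thesis
    using that[of L] Lim_transform_eventually[OF L(1) ev] L(2,3) by (simp add: k_def)
qed

lemma wpow_Suc_right: "wpow v (Suc m) = wpow v m @ v"
  by (induction m) auto

text \<open>A rotation of a power is a power of the rotated root; this carries the property of being
  a power back to the word before rotation.\<close>

lemma wpow_snoc_rotate:
  assumes "y @ [x] = wpow v m" "m > 0"
  obtains v' where "v = v' @ [x]" "x # y = wpow (x # v') m"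
proof -
  obtain l where l: "m = Suc l" using assms(2) by (cases m) auto
  then have eq: "y @ [x] = wpow v l @ v"
    using assms(1) by (simp only: wpow_Suc_right)
  have "v \<noteq> []"
  proof
    assume "v = []"
    then have "y @ [x] = []"
      unfolding assms(1) by simp
    then show False by simp
  qed
  then have "last v = x"
    using arg_cong[OF eq, of last] by simp
  then have v: "v = butlast v @ [x]"
    using \<open>v \<noteq> []\<close> append_butlast_last_id by metis
  have "(x # y) @ [x] = x # wpow (butlast v @ [x]) m"
    using assms(1) v by simp
  also have "\<dots> = wpow (x # butlast v) m @ [x]"
    by (simp add: wpow_rotate)
  finally show ?thesis
    using that[of "butlast v"] v by simp
qed

lemma u1_reduced:
  assumes w: "reduced w"
  shows "cmod (u1 (PSL2Z.ev w)) \<le> length w + 1" "u1 (PSL2Z.ev w) \<noteq> 0 \<Longrightarrow> w \<in> exceptional"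
proof -
  have "cmod (u1 (PSL2Z.ev w)) \<le> length w + 1 \<and> (u1 (PSL2Z.ev w) \<noteq> 0 \<longrightarrow> w \<in> exceptional)"
  proof (cases "w = []")
    case True
    then show ?thesis
      using u1_one by (simp add: exceptional_def)
  next
    case False
    obtain u M where M: "w = winv u @ M @ u" "M \<noteq> []" "length M = 1 \<or> hd M \<noteq> linv (last M)"
      using cyclic_reduction[OF w False] by blast
    have redM: "reduced M"
      using w M by (simp add: reduced_append)
    have u1_if: "u1 (PSL2Z.ev w) = of_real (L - 1)"
      if "\<And>n. n > 0 \<Longrightarrow> mean_fix n M = mean_fix n v" "(\<lambda>n. mean_fix n v) \<longlonglongrightarrow> L" for v L
    proof (rule u1_ev[OF w False])
      have "\<forall>\<^sub>F n in sequentially. mean_fix n v = mean_fix n w"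
        using eventually_gt_at_top[of 0] by eventually_elim (simp add: M(1) mean_fix_conj that(1))
      then show "(\<lambda>n. mean_fix n w) \<longlonglongrightarrow> L"
        by (rule Lim_transform_eventually[OF that(2)])
    qed
    show ?thesis
    proof (cases "length M = 1")
      case True
      then obtain x where x: "M = [x]" by (cases M) auto
      have "\<forall>\<^sub>F n in sequentially. 0 = mean_fix n M"
        using eventually_gt_at_top[of 0] by eventually_elim (simp add: x mean_fix_letter)
      then have "(\<lambda>n. mean_fix n M) \<longlonglongrightarrow> 0"
        by (rule Lim_transform_eventually[OF tendsto_const])
      then have "u1 (PSL2Z.ev w) = -1"
        using u1_if[of M 0] by simp
      moreover have "w \<in> exceptional"
      proof -
        have "(winv u @ [x], u) \<in> torsion_family x" "w = (winv u @ [x]) @ u"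
          using M(1) x by (auto simp: torsion_family_def)
        then show ?thesis
          unfolding exceptional_def by blast
      qed
      ultimately show ?thesis by simp
    next
      case len: False
      then have ends: "hd M \<noteq> linv (last M)" using M by simp
      \<comment> \<open>\<open>M'\<close> is an alternating word with the same mean as
        \<open>M\<close> and no longer than \<open>M\<close>. Each remaining case has to find it and
        to carry a power structure of \<open>M'\<close> back to \<open>w\<close>.\<close>
      have alt: "cmod (u1 (PSL2Z.ev w)) \<le> length w + 1 \<and>
          (u1 (PSL2Z.ev w) \<noteq> 0 \<longrightarrow> (\<exists>v m. m \<ge> 2 \<and> v \<noteq> [] \<and> M' = wpow v m))"
        if M': "reduced M'" "M' \<noteq> []" "hd M' = B" "last M' \<noteq> B" "length M' \<le> length M"
          and mf: "\<And>n. n > 0 \<Longrightarrow> mean_fix n M = mean_fix n M'" for M'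
      proof -
        obtain es where es: "es \<noteq> []" "B \<notin> set es" "M' = alt_word es"
          using reduced_alt_word[OF M'(1-4)] by blast
        obtain L :: nat where L: "(\<lambda>n. mean_fix n (alt_word es)) \<longlonglongrightarrow> real L" "1 \<le> L" "L \<le> length es"
          "L \<noteq> 1 \<longrightarrow> (\<exists>v m. m \<ge> 2 \<and> v \<noteq> [] \<and> es = wpow v m)"
          by (rule mean_fix_alt_word[OF es(1,2)])
        have u1: "u1 (PSL2Z.ev w) = of_real (real L - 1)"
          using u1_if[of M'] mf L(1) es(3) by blast
        have "L \<le> length w"
          using L(3) M'(5) M(1) length_alt_word[of es] es(3) by simp
        then have "cmod (u1 (PSL2Z.ev w)) \<le> length w + 1"
          using L(2) unfolding u1 norm_of_real by simp
        moreover have "\<exists>v m. m \<ge> 2 \<and> v \<noteq> [] \<and> M' = wpow v m" if "u1 (PSL2Z.ev w) \<noteq> 0"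
        proof -
          have "L \<noteq> 1" using that u1 by auto
          then obtain v m where "m \<ge> 2" "v \<noteq> []" "es = wpow v m" using L(4) by blast
          moreover have "alt_word v \<noteq> []"
            using \<open>v \<noteq> []\<close> by (cases v) auto
          ultimately show ?thesis
            using es(3) alt_word_wpow by metis
        qed
        ultimately show ?thesis by blast
      qed
      have power: "w \<in> exceptional" if vm: "M = wpow v m" "m \<ge> 2" "v \<noteq> []" for v m
      proof -
        obtain l where l: "m = Suc l" using vm(2) by (cases m) auto
        have "wpow v m = wpow v (m - 1) @ v"
          using l by (simp only: wpow_Suc_right diff_Suc_1)
        then have "w = (winv u @ wpow v (m - 1)) @ (v @ u)"
          using M(1) vm(1) by simp
        moreover have "(winv u @ wpow v (m - 1), v @ u) \<in> power_family (length u) m"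
          using vm(3) by (auto simp: power_family_def)
        ultimately show ?thesis
          unfolding exceptional_def using vm(2) by blast
      qed
      have len2: "length M \<ge> 2" using len M(2) by (cases M; cases "tl M") auto
      \<comment> \<open>Two ends \<open>B\<close>, or one end \<open>C\<close> and the other
        \<open>D\<close>, would be mutually inverse, which \<open>ends\<close> excludes.\<close>
      consider "hd M = B" "last M \<noteq> B" | "hd M \<noteq> B" "last M = B" | "hd M \<noteq> B" "last M = hd M"
        using ends by (cases "hd M"; cases "last M") auto
      then show ?thesis
      proof cases
        case 1
        then show ?thesis
          using alt[OF redM M(2)] power by blast
      next
        case 2
        obtain x Y where Y: "M = x # Y" "Y \<noteq> []" using len2 by (cases M; cases "tl M") auto
        have props: "reduced (Y @ [x])" "hd (Y @ [x]) = B" "last (Y @ [x]) \<noteq> B"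
          using redM 2 Y by (auto simp: reduced_append reduced_Cons)
        have res: "cmod (u1 (PSL2Z.ev w)) \<le> length w + 1 \<and>
          (u1 (PSL2Z.ev w) \<noteq> 0 \<longrightarrow> (\<exists>v m. m \<ge> 2 \<and> v \<noteq> [] \<and> Y @ [x] = wpow v m))"
          by (rule alt[OF props(1) _ props(2,3)]) (use Y mean_fix_rotate in auto)
        moreover have "w \<in> exceptional" if vm: "Y @ [x] = wpow v m" "m \<ge> 2" for v m
        proof -
          obtain v' where "x # Y = wpow (x # v') m"
            using wpow_snoc_rotate[OF vm(1)] vm(2) by auto
          then show ?thesis using power[of m "x # v'"] vm(2) Y by simp
        qed
        ultimately show ?thesis by blast
      next
        case 3
        define i where "i = hd M"
        obtain X where X: "M = i # X @ [i]"
          using len2 3 i_def by (cases M; cases "tl M" rule: rev_cases) auto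
        have "X \<noteq> []" using redM X 3 by auto
        have props: "reduced (X @ [linv i])" "hd (X @ [linv i]) = B" "last (X @ [linv i]) \<noteq> B"
          using redM 3(1) X \<open>X \<noteq> []\<close> by (auto simp: reduced_append reduced_Cons i_def[symmetric])
        have res: "cmod (u1 (PSL2Z.ev w)) \<le> length w + 1 \<and>
          (u1 (PSL2Z.ev w) \<noteq> 0 \<longrightarrow> (\<exists>v m. m \<ge> 2 \<and> v \<noteq> [] \<and> X @ [linv i] = wpow v m))"
        proof (rule alt[OF props(1) _ props(2,3)])
          show "length (X @ [linv i]) \<le> length M"
            by (subst X) simp
          show "mean_fix n M = mean_fix n (X @ [linv i])" if "n > 0" for n
            unfolding mean_fix_twisted[OF that, of i X, symmetric, OF 3(1)[folded i_def]] X[symmetric] ..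
        qed simp
        moreover have "w \<in> exceptional" if vm: "X @ [linv i] = wpow v m" "m \<ge> 2" for v m
        proof -
          obtain v' where v': "v = v' @ [linv i]"
            using wpow_snoc_rotate[OF vm(1)] vm(2) by auto
          obtain l where l: "m = Suc l" using vm(2) by (cases m) auto
          have "X @ [linv i] = wpow v (m - 1) @ v"
            unfolding vm(1) using l by (simp only: wpow_Suc_right diff_Suc_1)
          \<comment> \<open>Dropping the last letter of the power exposes the shape of
            \<open>twisted_power_family\<close>.\<close>
          then have "X = wpow (v' @ [linv i]) (m - 1) @ v'"
            using v' by simp
          then have "w = (winv u @ [i] @ wpow (v' @ [linv i]) (m - 1)) @ (v' @ [i] @ u)"
            using M(1) X by simp
          moreover have "(winv u @ [i] @ wpow (v' @ [linv i]) (m - 1), v' @ [i] @ u)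
              \<in> twisted_power_family i (length u) m"
            by (auto simp: twisted_power_family_def)
          ultimately show ?thesis
            unfolding exceptional_def using vm(2) by blast
        qed
        ultimately show ?thesis by blast
      qed
    qed
  qed
  then show "cmod (u1 (PSL2Z.ev w)) \<le> length w + 1" "u1 (PSL2Z.ev w) \<noteq> 0 \<Longrightarrow> w \<in> exceptional"
    by auto
qed

section \<open>The growth of \<open>u1\<close> along powers\<close>

text \<open>The exponent 5 collects one power from the linear growth of \<open>u1\<close>, two from
  the number of families and two from the estimate across the cut; the lengths that occur are at
  most \<open>A.rad * p\<close>.\<close>

lemma u1_power_bound:
  assumes \<alpha>: "\<alpha> \<in> carrier (group_algebra PSL2Z)"
  obtains K where "K > 0"
    "\<And>p. cmod (linear_extension u1 (\<alpha> [^]\<^bsub>group_algebra PSL2Z\<^esub> p)) \<le>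
      K * (real p + 1) ^ 5 * l2_opnorm PSL2Z (left_reg_alg PSL2Z \<alpha>) ^ p"
proof -
  interpret A: free_ga PSL2Z gen_b gen_c \<alpha>
    by unfold_locales (rule \<alpha>)
  define K where "K = 8 * (real A.rad + 1) ^ 3 * (real (card A.nball))\<^sup>2"
  have "card A.nball > 0"
    using A.finite_nball A.one_in_nball by (auto simp: card_gt_0_iff)
  then have "K > 0" by (simp add: K_def)
  moreover have "cmod (linear_extension u1 (A.pw p)) \<le> K * (real p + 1) ^ 5 * A.\<kappa> ^ p" for p
  proof -
    define n where "n = A.rad * p"
    define X where "X = {x. A.pw p x \<noteq> 0}"
    have X: "finite X" "X \<subseteq> carrier PSL2Z"
      using A.pw_fin_supp[of p] by (auto simp: A.fin_supp_iff X_def)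
    let ?E = "{w. reduced w \<and> length w \<le> n \<and> w \<in> exceptional}"
    have finE: "finite ?E"
      using finite_lists_length_le[of "UNIV :: letter set" n] by (rule finite_subset[rotated]) auto
    have nf: "reduced (PSL2Z.nf x)" "PSL2Z.ev (PSL2Z.nf x) = x" "length (PSL2Z.nf x) \<le> n" if "x \<in> X" for x
      using that X A.pw_support[of x p] PSL2Z.nf[of x] by (auto simp: X_def n_def)
    have u1_le: "cmod (u1 x) \<le> real n + 1" if "x \<in> X" for x
      using u1_reduced(1)[OF nf(1)[OF that]] nf(2,3)[OF that] by simp
    have u1_exc: "PSL2Z.nf x \<in> ?E" if "x \<in> X" "u1 x \<noteq> 0" for x
      using u1_reduced(2)[OF nf(1)[OF that(1)]] nf[OF that(1)] that(2) by simp
    have "cmod (linear_extension u1 (A.pw p)) \<le> (\<Sum>x\<in>X. cmod (A.pw p x) * cmod (u1 x))"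
      unfolding linear_extension_def X_def[symmetric] by (rule sum_norm_le) (simp add: norm_mult)
    also have "\<dots> = (\<Sum>x\<in>{x \<in> X. u1 x \<noteq> 0}. cmod (A.pw p x) * cmod (u1 x))"
      using X by (intro sum.mono_neutral_right) auto
    also have "\<dots> \<le> (\<Sum>x\<in>{x \<in> X. u1 x \<noteq> 0}. cmod (A.pw p x) * (real n + 1))"
      by (intro sum_mono mult_left_mono u1_le) auto
    also have "\<dots> = (real n + 1) * (\<Sum>x\<in>{x \<in> X. u1 x \<noteq> 0}. cmod (A.pw p x))"
      by (simp add: sum_distrib_left mult.commute)
    also have "(\<Sum>x\<in>{x \<in> X. u1 x \<noteq> 0}. cmod (A.pw p x)) \<le> (\<Sum>w\<in>?E. cmod (A.pw p (PSL2Z.ev w)))"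
    proof (rule sum_le_included[where i = PSL2Z.ev])
      show "\<forall>x\<in>{x \<in> X. u1 x \<noteq> 0}. \<exists>w\<in>?E. PSL2Z.ev w = x \<and> cmod (A.pw p x) \<le> cmod (A.pw p (PSL2Z.ev w))"
        using u1_exc nf(2) by (intro ballI) (metis (mono_tags, lifting) mem_Collect_eq order_refl)
    qed (use X finE in auto)
    also have "\<dots> \<le> 8 * (real n + 1)\<^sup>2 * ((real (p + 1) * card A.nball)\<^sup>2 * A.\<kappa> ^ p)"
      by (rule A.sum_exceptional_le)
    also have "(real n + 1) * (8 * (real n + 1)\<^sup>2 * ((real (p + 1) * card A.nball)\<^sup>2 * A.\<kappa> ^ p)) =
        8 * (real n + 1) ^ 3 * (real (card A.nball))\<^sup>2 * (real p + 1)\<^sup>2 * A.\<kappa> ^ p"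
      by (simp add: power2_eq_square power3_eq_cube algebra_simps)
    also have "\<dots> \<le> 8 * ((real A.rad + 1) * (real p + 1)) ^ 3 * (real (card A.nball))\<^sup>2 * (real p + 1)\<^sup>2 * A.\<kappa> ^ p"
      by (intro mult_right_mono mult_left_mono power_mono zero_le_power A.\<kappa>_nonneg)
        (simp_all add: n_def algebra_simps)
    also have "\<dots> = K * (real p + 1) ^ 5 * A.\<kappa> ^ p"
      by (simp add: K_def power_mult_distrib mult_ac flip: power_add)
    finally show ?thesis
      by (simp add: mult_left_mono)
  qed
  ultimately show ?thesis by (rule that)
qed

theorem proposition1p3:
  fixes \<alpha> :: "(int^2^2) set \<Rightarrow> complex"
  assumes "\<alpha> \<in> carrier (group_algebra PSL2Z)"
    and "ga_self_adjoint PSL2Z \<alpha>"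
  shows "limsup (\<lambda>p. ereal (cmod (linear_extension u1 (\<alpha> [^]\<^bsub>group_algebra PSL2Z\<^esub> p)) powr (1 / real p)))
           \<le> ereal (l2_opnorm PSL2Z (left_reg_alg PSL2Z \<alpha>))"
proof -
  let ?\<kappa> = "l2_opnorm PSL2Z (left_reg_alg PSL2Z \<alpha>)"
  let ?f = "\<lambda>p. cmod (linear_extension u1 (\<alpha> [^]\<^bsub>group_algebra PSL2Z\<^esub> p))"
  interpret A: ga_element PSL2Z \<alpha>
    by unfold_locales (rule assms(1))
  obtain K where K: "K > 0" "\<And>p. ?f p \<le> K * (real p + 1) ^ 5 * ?\<kappa> ^ p"
    using u1_power_bound[OF assms(1)] by blast
  let ?g = "\<lambda>p. (K * (real p + 1) ^ 5) powr (1 / real p)"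
  have "?f p powr (1 / real p) \<le> ?g p * ?\<kappa>" if p: "p > 0" for p
  proof -
    have "?f p powr (1 / real p) \<le> (K * (real p + 1) ^ 5 * ?\<kappa> ^ p) powr (1 / real p)"
      by (rule powr_mono2) (use K(2) in auto)
    also have "\<dots> = ?g p * (?\<kappa> ^ p) powr (1 / real p)"
      by (rule powr_mult)
    \<comment> \<open>Norm 0 is treated separately: both sides are then 0, since
      \<open>p > 0\<close> and \<open>powr\<close> is 0 at base 0.\<close>
    also have "(?\<kappa> ^ p) powr (1 / real p) = ?\<kappa>"
    proof (cases "?\<kappa> = 0")
      case False
      then have "?\<kappa> > 0" using A.\<kappa>_nonneg by simp
      then show ?thesis
        using p by (simp add: powr_powr flip: powr_realpow)
    qed (use p in simp)
    finally show ?thesis .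
  qed
  then have "limsup (\<lambda>p. ereal (?f p powr (1 / real p))) \<le> limsup (\<lambda>p. ereal (?g p * ?\<kappa>))"
    by (intro Limsup_mono eventually_mono[OF eventually_gt_at_top[of 0]]) simp
  also have "limsup (\<lambda>p. ereal (?g p * ?\<kappa>)) = ereal ?\<kappa>"
  proof (rule lim_imp_Limsup)
    show "(\<lambda>p. ereal (?g p * ?\<kappa>)) \<longlonglongrightarrow> ereal ?\<kappa>"
    proof -
      \<comment> \<open>The \<open>p\<close>-th root of a polynomial in \<open>p\<close> tends to 1,
        so only the exponential rate survives.\<close>
      have "?g \<longlonglongrightarrow> 1"
        using K(1) by real_asymp
      from tendsto_mult_right[OF this, of ?\<kappa>] show ?thesis by simp
    qed
  qed simp
  finally show ?thesis .
qed

end
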